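(* Let $k$ be a field and let $S=k[x,y,z,w]$ be the polynomial ring with the standard grading. Let $\mathfrak{m}=(x,y,z,w)$, let $J=(x^2,y^2,z^2,w^2)$, and let $$I:=\mathfrak{m}J=(x^3,x^2y,x^2z,x^2w,xy^2,y^3,y^2z,y^2w,xz^2,yz^2,z^3,z^2w,xw^2,yw^2,zw^2,w^3).$$ Then the ring $R=S/I$ is not Golod.
   Context: Let $(R,\mathfrak{m}_R,k)$ be a Noetherian positively graded $k$-algebra with $R_0=k$ and irrelevant maximal ideal $\mathfrak{m}_R=\bigoplus_{i\geq 1}R_i$, and let $n=\dim_k \mathfrak{m}_R/\mathfrak{m}_R^2$. Let $P_R(t)=\sum_{i\geq 0}\dim_k \operatorname{Tor}_i^R(k,k)\,t^i$ be its Poincaré series, and let $H_i(R)$ denote the $i$-th homology of the Koszul complex over $R$ on a minimal homogeneous generating set of $\mathfrak{m}_R$. Serre showed that $P_R(t)$ is bounded above coefficientwise by $$\frac{(1+t)^n}{1-t\sum_{i\geq 1}\dim_k(H_i(R))\,t^i}.$$ The ring $R$ is called Golod if equality holds, i.e. if $P_R(t)$ equals this series. *)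

theory Defs
  imports
    "HOL-Library.Poly_Mapping"
    "HOL-Library.Function_Algebras"
    "HOL-Computational_Algebra.Formal_Power_Series"
begin

section \<open>Ideals\<close>

definition is_ideal :: "'r::comm_ring_1 set \<Rightarrow> bool" where
  "is_ideal = module.subspace (*)"

definition ideal_gen :: "'r::comm_ring_1 set \<Rightarrow> 'r set" where
  "ideal_gen = module.span (*)"

definition ideal_prod :: "'r::comm_ring_1 set \<Rightarrow> 'r set \<Rightarrow> 'r set" where
  "ideal_prod A B = ideal_gen {a * b | a b. a \<in> A \<and> b \<in> B}"

interpretation ideal: module "(*) :: 'r::comm_ring_1 \<Rightarrow> 'r \<Rightarrow> 'r"
  by standard (simp_all add: algebra_simps)

section \<open>Dimensions of quotient spaces\<close>

text \<open>\<open>T\<close> maps bijectively onto a basis of the quotient space \<open>Z / B\<close>. The last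
  clause is linear independence modulo \<open>B\<close>, in the form of \<open>vector_space.dependent_def\<close>.\<close>

definition basis_modulo ::
  "('k::field \<Rightarrow> 'v::ab_group_add \<Rightarrow> 'v) \<Rightarrow> 'v set \<Rightarrow> 'v set \<Rightarrow> 'v set \<Rightarrow> bool" where
  "basis_modulo s Z B T \<longleftrightarrow>
     T \<subseteq> Z \<and> Z \<subseteq> module.span s (T \<union> B) \<and> (\<forall>t\<in>T. t \<notin> module.span s ((T - {t}) \<union> B))"

text \<open>Meant for subspaces \<open>B \<subseteq> Z\<close> with \<open>Z / B\<close> of finite dimension.\<close>

definition quotient_dim ::
  "('k::field \<Rightarrow> 'v::ab_group_add \<Rightarrow> 'v) \<Rightarrow> 'v set \<Rightarrow> 'v set \<Rightarrow> nat" where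
  "quotient_dim s Z B = card (SOME T. basis_modulo s Z B T)"

section \<open>Positively graded algebras and the Golod property\<close>

locale pos_graded_algebra =
  fixes scale :: "'k::field \<Rightarrow> 'r::comm_ring_1 \<Rightarrow> 'r"
    and G :: "nat \<Rightarrow> 'r set"
  assumes vector_space: "vector_space scale"
    and scale_mult: "scale c x * y = scale c (x * y)"
    and G_subspace: "module.subspace scale (G i)"
    and G_direct_sum:
      "\<exists>!f. (\<forall>i. f i \<in> G i) \<and> finite {i. f i \<noteq> 0} \<and> x = (\<Sum>i | f i \<noteq> 0. f i)"
    and G_mult: "x \<in> G i \<Longrightarrow> y \<in> G j \<Longrightarrow> x * y \<in> G (i + j)"
    and G_0: "G 0 = range (\<lambda>c. scale c 1)"
    and noetherian: "is_ideal (N :: 'r set) \<Longrightarrow> \<exists>A. finite A \<and> N = ideal_gen A"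
begin

definition irrelevant_ideal :: "'r set" ("\<mm>") where
  "\<mm> = module.span scale (\<Union>i\<in>{1..}. G i)"

definition embedding_dim :: nat where
  "embedding_dim = quotient_dim scale \<mm> (ideal_prod \<mm> \<mm>)"

definition pointwise_scale :: "'k \<Rightarrow> ('i \<Rightarrow> 'r) \<Rightarrow> 'i \<Rightarrow> 'r" where
  "pointwise_scale c v = (\<lambda>i. scale c (v i))"

subsection \<open>Tor and the Poincare series\<close>

text \<open>A sequence of free modules of finite rank \<open>F\<^sub>i = R^(b i)\<close> with differentials
  \<open>F\<^sub>i \<rightarrow> F\<^sub>i\<^sub>-\<^sub>1\<close> for \<open>i \<ge> 1\<close> given by the \<open>b (i - 1) \<times> b i\<close> matrices \<open>D i\<close>; the differential
  out of \<open>F\<^sub>0\<close> is zero. Elements of \<open>R^n\<close> are functions on \<open>nat\<close> vanishing from \<open>n\<close> on.\<close>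

definition free_module :: "nat \<Rightarrow> (nat \<Rightarrow> 'r) set" where
  "free_module n = {v. \<forall>j\<ge>n. v j = 0}"

definition differential ::
  "(nat \<Rightarrow> nat) \<Rightarrow> (nat \<Rightarrow> nat \<Rightarrow> nat \<Rightarrow> 'r) \<Rightarrow> nat \<Rightarrow> (nat \<Rightarrow> 'r) \<Rightarrow> nat \<Rightarrow> 'r" where
  "differential b D i v =
     (\<lambda>r. if 0 < i \<and> r < b (i - 1) then \<Sum>c<b i. D i r c * v c else 0)"

text \<open>The submodule \<open>\<mm>F\<close> of \<open>F = R^n\<close>.\<close>

definition irrelevant_submodule :: "nat \<Rightarrow> (nat \<Rightarrow> 'r) set" where
  "irrelevant_submodule n = {v \<in> free_module n. \<forall>j. v j \<in> \<mm>}"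

text \<open>Free resolutions of \<open>k = R / \<mm>\<close> that start with the projection \<open>F\<^sub>0 = R \<rightarrow> R / \<mm>\<close>.\<close>

definition free_resolution :: "(nat \<Rightarrow> nat) \<Rightarrow> (nat \<Rightarrow> nat \<Rightarrow> nat \<Rightarrow> 'r) \<Rightarrow> bool" where
  "free_resolution b D \<longleftrightarrow>
     b 0 = 1 \<and>
     differential b D 1 ` free_module (b 1) = irrelevant_submodule (b 0) \<and>
     (\<forall>i\<ge>1. differential b D (Suc i) ` free_module (b (Suc i)) =
            {v \<in> free_module (b i). differential b D i v = 0})"

text \<open>The dimension of the \<open>i\<close>-th homology of the complex \<open>F \<otimes> k\<close>, whose terms are
  \<open>F\<^sub>i \<otimes> k = F\<^sub>i / \<mm>F\<^sub>i\<close>. Cycles and boundaries are represented by their preimages in \<open>F\<^sub>i\<close>.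
  Scalars from \<open>k = R / \<mm>\<close> act through \<open>k \<rightarrow> R\<close>.\<close>

definition tensor_homology_dim ::
  "(nat \<Rightarrow> nat) \<Rightarrow> (nat \<Rightarrow> nat \<Rightarrow> nat \<Rightarrow> 'r) \<Rightarrow> nat \<Rightarrow> nat" where
  "tensor_homology_dim b D i = quotient_dim pointwise_scale
     {v \<in> free_module (b i). \<forall>r. differential b D i v r \<in> \<mm>}
     {differential b D (Suc i) u + w | u w.
        u \<in> free_module (b (Suc i)) \<and> w \<in> irrelevant_submodule (b i)}"

text \<open>The value does not depend on the chosen resolution; one exists as \<open>R\<close> is Noetherian.\<close>

definition tor_dim :: "nat \<Rightarrow> nat" where
  "tor_dim i = (let (b, D) = (SOME (b, D). free_resolution b D) in tensor_homology_dim b D i)"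

definition poincare_series :: "rat fps" where
  "poincare_series = Abs_fps (\<lambda>i. of_nat (tor_dim i))"

subsection \<open>Koszul homology\<close>

definition minimal_homogeneous_generators :: "'r list \<Rightarrow> bool" where
  "minimal_homogeneous_generators xs \<longleftrightarrow>
     distinct xs \<and> set xs \<subseteq> (\<Union>i. G i) \<and> ideal_gen (set xs) = \<mm> \<and>
     (\<forall>A. A \<subset> set xs \<longrightarrow> ideal_gen A \<noteq> \<mm>)"

text \<open>The \<open>i\<close>-th exterior power of \<open>R^n\<close>: \<open>f\<close> stands for the sum of all \<open>f A \<cdot> e\<^sub>A\<close>, where for
  \<open>A = {a\<^sub>1 < \<dots> < a\<^sub>i} \<subseteq> {0..<n}\<close> one puts \<open>e\<^sub>A = e\<^bsub>a\<^sub>1\<^esub> \<and> \<dots> \<and> e\<^bsub>a\<^sub>i\<^esub>\<close>.\<close>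

definition koszul_module :: "nat \<Rightarrow> nat \<Rightarrow> (nat set \<Rightarrow> 'r) set" where
  "koszul_module n i = {f. \<forall>A. f A \<noteq> 0 \<longrightarrow> A \<subseteq> {..<n} \<and> card A = i}"

text \<open>The differential sends \<open>e\<^sub>A\<close> to the sum over \<open>j \<in> A\<close> of
  \<open>(-1)^(card {l \<in> A. l < j}) \<cdot> x\<^sub>j \<cdot> e\<^bsub>A - {j}\<^esub>\<close>; below are the coefficients at \<open>e\<^sub>B\<close>.\<close>

definition koszul_differential :: "'r list \<Rightarrow> (nat set \<Rightarrow> 'r) \<Rightarrow> nat set \<Rightarrow> 'r" where
  "koszul_differential xs f =
     (\<lambda>B. \<Sum>j\<in>{..<length xs} - B. (-1) ^ card {l \<in> B. l < j} * xs ! j * f (insert j B))"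

definition koszul_homology_dim :: "'r list \<Rightarrow> nat \<Rightarrow> nat" where
  "koszul_homology_dim xs i = quotient_dim pointwise_scale
     {f \<in> koszul_module (length xs) i. koszul_differential xs f = 0}
     (koszul_differential xs ` koszul_module (length xs) (Suc i))"

subsection \<open>Golod algebras\<close>

text \<open>Koszul homology does not depend on the chosen minimal homogeneous generators. The zeroth
  homology is left out of the sum.\<close>

definition serre_bound :: "rat fps" where
  "serre_bound =
     (let xs = (SOME xs. minimal_homogeneous_generators xs)
      in (1 + fps_X) ^ embedding_dim /
         (1 - fps_X * Abs_fps (\<lambda>i. if i = 0 then 0 else of_nat (koszul_homology_dim xs i))))"

definition golod :: bool where
  "golod \<longleftrightarrow> poincare_series = serre_bound"

end

section \<open>The ring \<open>R = k[x,y,z,w] / I\<close>\<close>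

datatype var = Var_x | Var_y | Var_z | Var_w

lemma UNIV_var: "UNIV = {Var_x, Var_y, Var_z, Var_w}"
  using var.exhaust by blast

instance var :: finite
  by standard (simp add: UNIV_var)

type_synonym monomial = "var \<Rightarrow>\<^sub>0 nat"
type_synonym 'k polynomial = "monomial \<Rightarrow>\<^sub>0 'k"

definition indeterminate :: "var \<Rightarrow> 'k::field polynomial" where
  "indeterminate v = Poly_Mapping.single (Poly_Mapping.single v 1) 1"

abbreviation pX :: "'k::field polynomial" where "pX \<equiv> indeterminate Var_x"
abbreviation pY :: "'k::field polynomial" where "pY \<equiv> indeterminate Var_y"
abbreviation pZ :: "'k::field polynomial" where "pZ \<equiv> indeterminate Var_z"
abbreviation pW :: "'k::field polynomial" where "pW \<equiv> indeterminate Var_w"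

definition constant_poly :: "'k::field \<Rightarrow> 'k polynomial" where
  "constant_poly c = Poly_Mapping.single 0 c"

definition monomial_degree :: "monomial \<Rightarrow> nat" where
  "monomial_degree m = (\<Sum>v\<in>UNIV. Poly_Mapping.lookup m v)"

definition homogeneous :: "nat \<Rightarrow> 'k::field polynomial set" where
  "homogeneous d = {p. \<forall>m\<in>Poly_Mapping.keys p. monomial_degree m = d}"

definition ideal_m :: "'k::field polynomial set" where
  "ideal_m = ideal_gen {pX, pY, pZ, pW}"

definition ideal_J :: "'k::field polynomial set" where
  "ideal_J = ideal_gen {pX^2, pY^2, pZ^2, pW^2}"

definition ideal_I :: "'k::field polynomial set" where
  "ideal_I = ideal_prod ideal_m ideal_J"

subsection \<open>The monomials in \<open>I\<close>\<close>

definition bad :: "monomial \<Rightarrow> bool" where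
  "bad m \<longleftrightarrow> 3 \<le> monomial_degree m \<and> (\<exists>v. 2 \<le> Poly_Mapping.lookup m v)"

lemma monomial_degree_add: "monomial_degree (m + n) = monomial_degree m + monomial_degree n"
  by (simp add: monomial_degree_def lookup_add sum.distrib)

lemma monomial_degree_zero [simp]: "monomial_degree 0 = 0"
  by (simp add: monomial_degree_def)

lemma monomial_degree_single [simp]: "monomial_degree (Poly_Mapping.single v n) = n"
  by (simp add: monomial_degree_def lookup_single when_def)

lemma bad_add: "bad m \<Longrightarrow> bad (n + m)"
  unfolding bad_def monomial_degree_add lookup_add by (meson trans_le_add2)

lemma subspace_keys: "is_ideal {p :: 'k::field polynomial. \<forall>m\<in>Poly_Mapping.keys p. bad m}"
  unfolding is_ideal_def
proof (rule ideal.subspaceI)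
  fix p q :: "'k polynomial"
  assume "p \<in> {p. \<forall>m\<in>Poly_Mapping.keys p. bad m}" "q \<in> {p. \<forall>m\<in>Poly_Mapping.keys p. bad m}"
  then show "p + q \<in> {p. \<forall>m\<in>Poly_Mapping.keys p. bad m}"
    using Poly_Mapping.keys_add[of p q] by auto
next
  fix c p :: "'k polynomial"
  assume "p \<in> {p. \<forall>m\<in>Poly_Mapping.keys p. bad m}"
  then show "c * p \<in> {p. \<forall>m\<in>Poly_Mapping.keys p. bad m}"
    using keys_mult[of c p] bad_add by blast
qed simp

lemma keys_ideal_m: "p \<in> ideal_m \<Longrightarrow> m \<in> Poly_Mapping.keys p \<Longrightarrow> 1 \<le> monomial_degree m"
  for p :: "'k::field polynomial"
proof -
  let ?N = "{p :: 'k polynomial. \<forall>m\<in>Poly_Mapping.keys p. 1 \<le> monomial_degree m}"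
  have "ideal.subspace ?N"
  proof (rule ideal.subspaceI)
    show "p + q \<in> ?N" if "p \<in> ?N" "q \<in> ?N" for p q
      using that Poly_Mapping.keys_add[of p q] by auto
    show "c * p \<in> ?N" if "p \<in> ?N" for c p
      using that keys_mult[of c p] by (fastforce simp: monomial_degree_add)
  qed simp
  moreover have "{pX, pY, pZ, pW} \<subseteq> ?N"
    by (auto simp: indeterminate_def)
  ultimately have "ideal_m \<subseteq> ?N"
    unfolding ideal_m_def ideal_gen_def by (intro ideal.span_minimal)
  then show "p \<in> ideal_m \<Longrightarrow> m \<in> Poly_Mapping.keys p \<Longrightarrow> 1 \<le> monomial_degree m" by auto
qed

lemma indeterminate_sq:
  "indeterminate v ^ 2 = Poly_Mapping.single (Poly_Mapping.single v 2) (1 :: 'k::field)"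
  by (simp add: indeterminate_def power2_eq_square mult_single single_add[symmetric] numeral_2_eq_2)

lemma keys_ideal_J: 
  "p \<in> ideal_J \<Longrightarrow> m \<in> Poly_Mapping.keys p \<Longrightarrow> \<exists>v. 2 \<le> Poly_Mapping.lookup m v"
  for p :: "'k::field polynomial"
proof -
  let ?N = "{p :: 'k polynomial. \<forall>m\<in>Poly_Mapping.keys p. \<exists>v. 2 \<le> Poly_Mapping.lookup m v}"
  have "ideal.subspace ?N"
  proof (rule ideal.subspaceI)
    show "p + q \<in> ?N" if "p \<in> ?N" "q \<in> ?N" for p q
      using that Poly_Mapping.keys_add[of p q] by auto
    show "c * p \<in> ?N" if "p \<in> ?N" for c p
      using that keys_mult[of c p] by (fastforce simp: lookup_add intro: trans_le_add2)
  qed simp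
  moreover have "{pX^2, pY^2, pZ^2, pW^2} \<subseteq> ?N"
    by (auto simp: indeterminate_sq intro: exI[of _ Var_x] exI[of _ Var_y] exI[of _ Var_z] exI[of _ Var_w])
  ultimately have "ideal_J \<subseteq> ?N"
    unfolding ideal_J_def ideal_gen_def by (intro ideal.span_minimal)
  then show "p \<in> ideal_J \<Longrightarrow> m \<in> Poly_Mapping.keys p \<Longrightarrow> \<exists>v. 2 \<le> Poly_Mapping.lookup m v" by auto
qed

lemma lookup_le_degree: "Poly_Mapping.lookup m v \<le> monomial_degree m"
  unfolding monomial_degree_def by (rule member_le_sum) auto

lemma is_ideal_I: "is_ideal ideal_I"
  by (simp add: ideal_I_def is_ideal_def ideal_prod_def ideal_gen_def)

lemma poly_sum: "p = (\<Sum>m\<in>Poly_Mapping.keys p. Poly_Mapping.single m (Poly_Mapping.lookup p m))"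
  by (rule poly_mapping_eqI)
    (auto simp: lookup_sum lookup_single when_def sum.delta in_keys_iff)

lemma indeterminate_m: "indeterminate v \<in> ideal_m"
  unfolding ideal_m_def ideal_gen_def by (rule ideal.span_base) (cases v; simp)

lemma indeterminate_J: "indeterminate v ^ 2 \<in> ideal_J"
  unfolding ideal_J_def ideal_gen_def by (rule ideal.span_base) (cases v; simp)

lemma single_bad_I:
  assumes "bad m"
  shows "Poly_Mapping.single m (c :: 'k::field) \<in> ideal_I"
proof -
  from assms obtain v where v: "2 \<le> Poly_Mapping.lookup m v" and d: "3 \<le> monomial_degree m"
    by (auto simp: bad_def)
  define n where "n = m - Poly_Mapping.single v 2"
  have m: "m = n + Poly_Mapping.single v 2"
    using v by (intro poly_mapping_eqI) (auto simp: n_def lookup_add lookup_minus lookup_single when_def)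
  then have "monomial_degree n \<noteq> 0" using d by (auto simp: monomial_degree_add)
  then obtain u where u: "1 \<le> Poly_Mapping.lookup n u"
    by (auto simp: monomial_degree_def Suc_le_eq)
  define l where "l = n - Poly_Mapping.single u 1"
  have n: "n = l + Poly_Mapping.single u 1"
    using u by (intro poly_mapping_eqI) (auto simp: l_def lookup_add lookup_minus lookup_single when_def)
  have "Poly_Mapping.single m c =
      Poly_Mapping.single l c * (indeterminate u * indeterminate v ^ 2)"
    by (simp add: m n indeterminate_sq mult_single) (simp add: indeterminate_def mult_single add.assoc)
  also have "\<dots> \<in> ideal_I"
    unfolding ideal_I_def ideal_prod_def ideal_gen_def
    by (intro ideal.span_scale ideal.span_base) (use indeterminate_m indeterminate_J in blast)
  finally show ?thesis .
qed

lemma mem_ideal_I_iff: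
  "(p :: 'k::field polynomial) \<in> ideal_I \<longleftrightarrow> (\<forall>m\<in>Poly_Mapping.keys p. bad m)"
proof
  let ?N = "{p :: 'k polynomial. \<forall>m\<in>Poly_Mapping.keys p. bad m}"
  have "{a * b |a b. a \<in> ideal_m \<and> b \<in> ideal_J} \<subseteq> ?N"
  proof clarify
    fix a b :: "'k polynomial" and m
    assume a: "a \<in> ideal_m" and b: "b \<in> ideal_J" and "m \<in> Poly_Mapping.keys (a * b)"
    then obtain n l where nl: "m = n + l" "n \<in> Poly_Mapping.keys a" "l \<in> Poly_Mapping.keys b"
      using keys_mult[of a b] by blast
    have 1: "1 \<le> monomial_degree n" using keys_ideal_m[OF a nl(2)] .
    obtain v where v: "2 \<le> Poly_Mapping.lookup l v" using keys_ideal_J[OF b nl(3)] by blast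
    show "bad m"
      using 1 v lookup_le_degree[of l v] unfolding bad_def nl(1)
      by (auto simp: monomial_degree_add lookup_add intro!: exI[of _ v])
  qed
  then have "ideal_I \<subseteq> ?N"
    unfolding ideal_I_def ideal_prod_def ideal_gen_def
    using subspace_keys unfolding is_ideal_def by (rule ideal.span_minimal)
  then show "p \<in> ideal_I \<Longrightarrow> \<forall>m\<in>Poly_Mapping.keys p. bad m" by auto
next
  assume *: "\<forall>m\<in>Poly_Mapping.keys p. bad m"
  show "p \<in> ideal_I"
    by (subst poly_sum)
      (use is_ideal_I * in \<open>auto simp: is_ideal_def intro!: ideal.subspace_sum single_bad_I\<close>)
qed

lemma ideal_I_zero: "0 \<in> ideal_I"
  by (simp add: mem_ideal_I_iff)

lemma ideal_I_add: "p \<in> ideal_I \<Longrightarrow> q \<in> ideal_I \<Longrightarrow> p + q \<in> ideal_I" for p :: "'k::field polynomial"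
  by (rule ideal.subspace_add[OF is_ideal_I[unfolded is_ideal_def]])

lemma ideal_I_diff: "p \<in> ideal_I \<Longrightarrow> q \<in> ideal_I \<Longrightarrow> p - q \<in> ideal_I" for p :: "'k::field polynomial"
  by (rule ideal.subspace_diff[OF is_ideal_I[unfolded is_ideal_def]])

lemma ideal_I_mult: "p \<in> ideal_I \<Longrightarrow> q * p \<in> ideal_I" for p :: "'k::field polynomial"
  by (rule ideal.subspace_scale[OF is_ideal_I[unfolded is_ideal_def]])

lemma ideal_I_proper: "0 - 1 \<notin> (ideal_I :: 'k::field polynomial set)"
proof
  assume "0 - 1 \<in> (ideal_I :: 'k polynomial set)"
  from ideal_I_diff[OF ideal_I_zero this] have "(1 :: 'k polynomial) \<in> ideal_I"
    by (simp only: diff_0 minus_minus)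
  then show False
    unfolding mem_ideal_I_iff bad_def by simp
qed

subsection \<open>The quotient ring\<close>

quotient_type (overloaded) 'k quot_ring = "'k::field polynomial" / "\<lambda>p q. p - q \<in> ideal_I"
  morphisms rep_quot quot
proof (rule equivpI)
  show "reflp (\<lambda>p q. p - q \<in> (ideal_I :: 'k polynomial set))"
    by (auto intro!: reflpI simp: ideal_I_zero)
  show "symp (\<lambda>p q. p - q \<in> (ideal_I :: 'k polynomial set))"
  proof (rule sympI)
    fix p q :: "'k polynomial"
    assume "p - q \<in> ideal_I"
    from ideal_I_diff[OF ideal_I_zero this] show "q - p \<in> ideal_I" by simp
  qed
  show "transp (\<lambda>p q. p - q \<in> (ideal_I :: 'k polynomial set))"
  proof (rule transpI)
    fix p q r :: "'k polynomial"
    assume "p - q \<in> ideal_I" "q - r \<in> ideal_I"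
    then show "p - r \<in> ideal_I" using ideal_I_add[of "p - q" "q - r"] by simp
  qed
qed

instantiation quot_ring :: (field) comm_ring_1
begin

lift_definition zero_quot_ring :: "'a quot_ring" is 0 .

lift_definition one_quot_ring :: "'a quot_ring" is 1 .

lift_definition plus_quot_ring :: "'a quot_ring \<Rightarrow> 'a quot_ring \<Rightarrow> 'a quot_ring" is "(+)"
proof -
  fix p q r s :: "'a polynomial"
  assume "p - q \<in> ideal_I" "r - s \<in> ideal_I"
  then have "(p - q) + (r - s) \<in> ideal_I" by (rule ideal_I_add)
  then show "p + r - (q + s) \<in> ideal_I" by (simp add: algebra_simps)
qed

lift_definition minus_quot_ring :: "'a quot_ring \<Rightarrow> 'a quot_ring \<Rightarrow> 'a quot_ring" is "(-)"
proof -
  fix p q r s :: "'a polynomial"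
  assume "p - q \<in> ideal_I" "r - s \<in> ideal_I"
  then have "(p - q) - (r - s) \<in> ideal_I" by (rule ideal_I_diff)
  then show "p - r - (q - s) \<in> ideal_I" by (simp add: algebra_simps)
qed

lift_definition uminus_quot_ring :: "'a quot_ring \<Rightarrow> 'a quot_ring" is "uminus"
proof -
  fix p q :: "'a polynomial"
  assume "p - q \<in> ideal_I"
  from ideal_I_diff[OF ideal_I_zero this] show "- p - - q \<in> ideal_I" by simp
qed

lift_definition times_quot_ring :: "'a quot_ring \<Rightarrow> 'a quot_ring \<Rightarrow> 'a quot_ring" is "(*)"
proof -
  fix p q r s :: "'a polynomial"
  assume "p - q \<in> ideal_I" "r - s \<in> ideal_I"
  then have "r * (p - q) + q * (r - s) \<in> ideal_I" by (intro ideal_I_add ideal_I_mult)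
  then show "p * r - q * s \<in> ideal_I" by (simp add: algebra_simps)
qed

instance
proof
  show "(0 :: 'a quot_ring) \<noteq> 1"
    unfolding zero_quot_ring_def one_quot_ring_def quot_ring.abs_eq_iff by (rule ideal_I_proper)
next
  fix a b c :: "'a quot_ring"
  show "a * b * c = a * (b * c)" by transfer (simp only: mult.assoc diff_self ideal_I_zero)
  show "a * b = b * a" by transfer (simp add: mult.commute ideal_I_zero)
  show "1 * a = a" by transfer (simp add: ideal_I_zero)
  show "(a + b) * c = a * c + b * c" by transfer (simp add: distrib_right ideal_I_zero)
  show "a + b + c = a + (b + c)" by transfer (simp add: add.assoc ideal_I_zero)
  show "a + b = b + a" by transfer (simp add: add.commute ideal_I_zero)
  show "0 + a = a" by transfer (simp add: ideal_I_zero)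
  show "- a + a = 0" by transfer (simp add: ideal_I_zero)
  show "a - b = a + - b" by transfer (simp add: ideal_I_zero)
qed

end

definition quot_scale :: "'k::field \<Rightarrow> 'k quot_ring \<Rightarrow> 'k quot_ring" where
  "quot_scale c r = quot (constant_poly c) * r"

definition quot_grading :: "nat \<Rightarrow> 'k::field quot_ring set" where
  "quot_grading d = quot ` homogeneous d"

subsection \<open>The quotient ring is a positively graded algebra\<close>

lemma quot_add: "quot (p + q) = quot p + quot q"
  by (rule plus_quot_ring.abs_eq[symmetric])

lemma quot_diff: "quot (p - q) = quot p - quot q"
  by (rule minus_quot_ring.abs_eq[symmetric])

lemma quot_mult: "quot (p * q) = quot p * quot q"
  by (rule times_quot_ring.abs_eq[symmetric])

lemma quot_0: "quot 0 = 0" and quot_1: "quot 1 = 1"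
  unfolding zero_quot_ring_def one_quot_ring_def by (rule refl)+

lemma quot_sum: "quot (\<Sum>i\<in>A. f i) = (\<Sum>i\<in>A. quot (f i))"
  by (induction A rule: infinite_finite_induct) (simp_all add: quot_0 quot_add)

lemma quot_eq_iff: "quot p = quot q \<longleftrightarrow> p - q \<in> ideal_I"
  by (rule quot_ring.abs_eq_iff)

lemma quot_eq_0_iff: "quot p = 0 \<longleftrightarrow> p \<in> ideal_I"
  using quot_eq_iff[of p 0] by (simp add: quot_0)

lemma quot_surj: "\<exists>p. r = quot p"
  by (rule exI[of _ "rep_quot r"], rule Quotient3_abs_rep[OF Quotient3_quot_ring, symmetric])

lemma constant_poly_add: "constant_poly (a + b) = constant_poly a + constant_poly b"
  by (simp add: constant_poly_def single_add)

lemma constant_poly_mult: "constant_poly (a * b) = constant_poly a * constant_poly b"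
  by (simp add: constant_poly_def mult_single)

lemma constant_poly_1: "constant_poly 1 = 1"
  by (simp add: constant_poly_def)

lemma vector_space_quot: "vector_space quot_scale"
  by standard
    (simp_all only: quot_scale_def constant_poly_add constant_poly_mult constant_poly_1
      quot_add quot_mult quot_1 distrib_left distrib_right mult.assoc mult_1_left)

lemma keys_constant_mult: "Poly_Mapping.keys (constant_poly c * p) \<subseteq> Poly_Mapping.keys p"
  using keys_mult[of "constant_poly c" p] by (auto simp: constant_poly_def split: if_splits)

lemma homogeneous_component_I:
  fixes h :: "nat \<Rightarrow> 'k::field polynomial"
  assumes "finite A" "\<And>i. i \<in> A \<Longrightarrow> h i \<in> homogeneous i" "(\<Sum>i\<in>A. h i) \<in> ideal_I" "i \<in> A"
  shows "h i \<in> ideal_I"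
  unfolding mem_ideal_I_iff
proof
  fix m assume m: "m \<in> Poly_Mapping.keys (h i)"
  then have deg: "monomial_degree m = i" using assms by (auto simp: homogeneous_def)
  have "Poly_Mapping.lookup (h j) m = 0" if "j \<in> A - {i}" for j
    using that assms(2)[of j] deg by (auto simp: homogeneous_def in_keys_iff)
  then have "Poly_Mapping.lookup (\<Sum>i\<in>A. h i) m = Poly_Mapping.lookup (h i) m"
    unfolding lookup_sum using assms by (subst sum.remove[of _ i]) auto
  then have "m \<in> Poly_Mapping.keys (\<Sum>i\<in>A. h i)" using m by (simp add: in_keys_iff)
  then show "bad m" using assms(3) by (simp add: mem_ideal_I_iff)
qed

lemma direct_sum_exists:
  fixes r :: "'k::field quot_ring"
  shows "\<exists>f. (\<forall>i. f i \<in> quot_grading i) \<and> finite {i. f i \<noteq> 0} \<and> r = (\<Sum>i | f i \<noteq> 0. f i)"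
proof -
  obtain p where p: "r = quot p" using quot_surj by blast
  define K where "K = Poly_Mapping.keys p"
  define h where "h i = (\<Sum>m\<in>{m\<in>K. monomial_degree m = i}.
    Poly_Mapping.single m (Poly_Mapping.lookup p m))" for i
  have fin: "finite K" by (simp add: K_def)
  have hom: "h i \<in> homogeneous i" for i
    using keys_sum[of "\<lambda>m. Poly_Mapping.single m (Poly_Mapping.lookup p m)" "{m\<in>K. monomial_degree m = i}"]
    by (fastforce simp: homogeneous_def h_def split: if_splits)
  have h0: "h i = 0" if "i \<notin> monomial_degree ` K" for i
    unfolding h_def using that by (intro sum.neutral) auto
  have sub: "{i. quot (h i) \<noteq> 0} \<subseteq> monomial_degree ` K"
  proof
    fix i assume i: "i \<in> {i. quot (h i) \<noteq> 0}"
    show "i \<in> monomial_degree ` K"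
    proof (rule ccontr)
      assume "i \<notin> monomial_degree ` K"
      then show False using i h0 by (simp add: quot_0)
    qed
  qed
  have "p = (\<Sum>i\<in>monomial_degree ` K. h i)"
    unfolding h_def using fin by (subst sum.image_gen[symmetric]) (auto simp: K_def poly_sum[symmetric])
  then have "r = (\<Sum>i\<in>monomial_degree ` K. quot (h i))"
    unfolding p quot_sum[symmetric] by simp
  also have "\<dots> = (\<Sum>i | quot (h i) \<noteq> 0. quot (h i))"
    using sub fin by (intro sum.mono_neutral_right) auto
  finally have "r = (\<Sum>i | quot (h i) \<noteq> 0. quot (h i))" .
  moreover have "finite {i. quot (h i) \<noteq> 0}"
    using fin by (intro finite_subset[OF sub] finite_imageI)
  ultimately show ?thesis
    using hom by (intro exI[of _ "\<lambda>i. quot (h i)"]) (auto simp: quot_grading_def)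
qed

lemma direct_sum_unique:
  fixes f g :: "nat \<Rightarrow> 'k::field quot_ring"
  assumes f: "\<forall>i. f i \<in> quot_grading i" "finite {i. f i \<noteq> 0}" "r = (\<Sum>i | f i \<noteq> 0. f i)"
    and g: "\<forall>i. g i \<in> quot_grading i" "finite {i. g i \<noteq> 0}" "r = (\<Sum>i | g i \<noteq> 0. g i)"
  shows "f = g"
proof
  fix i
  define A where "A = insert i ({i. f i \<noteq> 0} \<union> {i. g i \<noteq> 0})"
  have fin: "finite A" using f g by (simp add: A_def)
  obtain p where p: "f i = quot (p i)" "p i \<in> homogeneous i" for i
    using f(1) unfolding quot_grading_def image_iff by metis
  obtain q where q: "g i = quot (q i)" "q i \<in> homogeneous i" for i
    using g(1) unfolding quot_grading_def image_iff by metis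
  have "(\<Sum>i\<in>A. f i) = (\<Sum>i | f i \<noteq> 0. f i)"
    using fin by (intro sum.mono_neutral_right) (auto simp: A_def)
  moreover have "(\<Sum>i\<in>A. g i) = (\<Sum>i | g i \<noteq> 0. g i)"
    using fin by (intro sum.mono_neutral_right) (auto simp: A_def)
  ultimately have "quot (\<Sum>i\<in>A. p i - q i) = 0"
    using f(3) g(3) by (simp add: quot_sum quot_diff sum_subtractf flip: p(1) q(1))
  moreover have "p i - q i \<in> homogeneous i" for i
    using p(2)[of i] q(2)[of i] keys_diff[of "p i" "q i"] by (auto simp: homogeneous_def)
  ultimately have "p i - q i \<in> ideal_I"
    using homogeneous_component_I[OF fin, of "\<lambda>i. p i - q i" i]
    by (simp add: quot_eq_0_iff A_def)
  then show "f i = g i" by (simp add: p q quot_eq_iff)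
qed

lemma finite_monomials: "finite {m. monomial_degree m \<le> 4}"
proof (rule finite_subset)
  let ?F = "{f. \<forall>v. (v \<in> (UNIV :: var set) \<longrightarrow> f v \<in> {..4::nat}) \<and> (v \<notin> UNIV \<longrightarrow> f v = 0)}"
  show "finite (Abs_poly_mapping ` ?F)"
    by (intro finite_imageI finite_set_of_finite_funs) auto
  show "{m. monomial_degree m \<le> 4} \<subseteq> Abs_poly_mapping ` ?F"
  proof
    fix m assume "m \<in> {m. monomial_degree m \<le> 4}"
    then have "Poly_Mapping.lookup m v \<le> 4" for v using lookup_le_degree[of m v] by simp
    then have "Poly_Mapping.lookup m \<in> ?F" by simp
    then show "m \<in> Abs_poly_mapping ` ?F"
      by (intro image_eqI[of _ _ "Poly_Mapping.lookup m"]) (simp_all add: lookup_inverse)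
  qed
qed

lemma degree_not_bad:
  assumes "\<not> bad m"
  shows "monomial_degree m \<le> 4"
proof (cases "3 \<le> monomial_degree m")
  case True
  then have "Poly_Mapping.lookup m v \<le> 1" for v
    using assms by (auto simp: bad_def not_le less_Suc_eq_le numeral_2_eq_2)
  then have "monomial_degree m \<le> (\<Sum>v\<in>(UNIV :: var set). 1)"
    unfolding monomial_degree_def by (intro sum_mono)
  then show ?thesis by (simp add: UNIV_var)
qed simp

lemma quot_finite_span:
  "\<exists>B :: 'k::field quot_ring set. finite B \<and> module.span quot_scale B = UNIV"
proof -
  interpret vector_space "quot_scale :: 'k \<Rightarrow> _" by (rule vector_space_quot)
  let ?q = "\<lambda>m. quot (Poly_Mapping.single m (1 :: 'k))"
  define B where "B = ?q ` {m. monomial_degree m \<le> 4}"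
  have "r \<in> span B" for r
  proof -
    obtain p where p: "r = quot p" using quot_surj by blast
    have "quot (Poly_Mapping.single m c) \<in> span B" for m c
    proof (cases "bad m")
      case True
      then have "quot (Poly_Mapping.single m c) = 0" by (simp add: quot_eq_0_iff single_bad_I)
      then show ?thesis by (simp add: span_zero)
    next
      case False
      then have "?q m \<in> B" using degree_not_bad by (auto simp: B_def)
      moreover have "quot (Poly_Mapping.single m c) = quot_scale c (?q m)"
        by (simp add: quot_scale_def constant_poly_def mult_single flip: quot_mult)
      ultimately show ?thesis by (simp add: span_base span_scale)
    qed
    then show ?thesis unfolding p by (subst poly_sum) (simp add: quot_sum span_sum)
  qed
  then show ?thesis using finite_monomials by (intro exI[of _ B]) (auto simp: B_def)
qed

lemma quot_noetherian:
  fixes N :: "'k::field quot_ring set"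
  assumes "is_ideal N"
  shows "\<exists>A. finite A \<and> N = ideal_gen A"
proof -
  interpret vector_space "quot_scale :: 'k \<Rightarrow> _" by (rule vector_space_quot)
  obtain B :: "'k quot_ring set" where B: "finite B" "span B = UNIV" using quot_finite_span by blast
  obtain A where A: "A \<subseteq> N" "independent A" "N \<subseteq> span A"
    using maximal_independent_subset[of N] by blast
  have "finite A" using independent_span_bound[OF B(1) A(2)] B(2) by simp
  moreover have "N = ideal_gen A"
  proof
    show "ideal_gen A \<subseteq> N"
      unfolding ideal_gen_def using A(1) assms unfolding is_ideal_def by (rule ideal.span_minimal)
    have "subspace (ideal.span A)"
      by (rule subspaceI) (auto simp: quot_scale_def ideal.span_zero ideal.span_add ideal.span_scale)
    then have "span A \<subseteq> ideal.span A" by (intro span_minimal ideal.span_superset)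
    then show "N \<subseteq> ideal_gen A" using A(3) by (auto simp: ideal_gen_def)
  qed
  ultimately show ?thesis by blast
qed

lemma quot_grading_cases:
  assumes "r \<in> quot_grading d"
  obtains p where "p \<in> homogeneous d" "r = quot p"
  using assms unfolding quot_grading_def by (elim imageE)

lemma quot_gradingI: "p \<in> homogeneous d \<Longrightarrow> quot p \<in> quot_grading d"
  unfolding quot_grading_def by (rule imageI)

lemma quot_grading_subspace:
  "module.subspace quot_scale (quot_grading d :: 'k::field quot_ring set)"
proof -
  interpret vector_space "quot_scale :: 'k::field \<Rightarrow> _" by (rule vector_space_quot)
  show ?thesis
  proof (rule subspaceI)
    have "(0 :: 'k polynomial) \<in> homogeneous d" by (simp add: homogeneous_def)
    from quot_gradingI[OF this] show "0 \<in> (quot_grading d :: 'k quot_ring set)"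
      unfolding quot_0 .
  next
    fix r s :: "'k quot_ring"
    assume "r \<in> quot_grading d" "s \<in> quot_grading d"
    then obtain p q where pq: "p \<in> homogeneous d" "q \<in> homogeneous d" "r = quot p" "s = quot q"
      by (elim quot_grading_cases)
    then have "p + q \<in> homogeneous d"
      using Poly_Mapping.keys_add[of p q] by (auto simp: homogeneous_def)
    from quot_gradingI[OF this] show "r + s \<in> quot_grading d"
      unfolding pq quot_add .
  next
    fix c and r :: "'k quot_ring"
    assume "r \<in> quot_grading d"
    then obtain p where p: "p \<in> homogeneous d" "r = quot p" by (elim quot_grading_cases)
    then have "constant_poly c * p \<in> homogeneous d"
      using keys_constant_mult[of c p] by (auto simp: homogeneous_def)
    from quot_gradingI[OF this] show "quot_scale c r \<in> quot_grading d"
      unfolding p quot_scale_def quot_mult .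
  qed
qed

lemma quot_grading_mult:
  fixes r s :: "'k::field quot_ring"
  assumes "r \<in> quot_grading i" "s \<in> quot_grading j"
  shows "r * s \<in> quot_grading (i + j)"
proof -
  from assms obtain p q
    where pq: "p \<in> homogeneous i" "q \<in> homogeneous j" "r = quot p" "s = quot q"
    by (elim quot_grading_cases)
  have "p * q \<in> homogeneous (i + j)"
    unfolding homogeneous_def mem_Collect_eq
  proof
    fix m assume "m \<in> Poly_Mapping.keys (p * q)"
    then obtain a b where "m = a + b" "a \<in> Poly_Mapping.keys p" "b \<in> Poly_Mapping.keys q"
      using keys_mult[of p q] by blast
    then show "monomial_degree m = i + j"
      using pq by (simp add: homogeneous_def monomial_degree_add)
  qed
  from quot_gradingI[OF this] show ?thesis unfolding pq quot_mult .
qed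

lemma homogeneous_0: "homogeneous 0 = range (constant_poly :: 'k::field \<Rightarrow> _)"
proof (intro equalityI subsetI)
  fix p :: "'k polynomial" assume p: "p \<in> homogeneous 0"
  have "m = 0" if "m \<in> Poly_Mapping.keys p" for m
  proof (rule poly_mapping_eqI)
    fix v
    show "Poly_Mapping.lookup m v = Poly_Mapping.lookup 0 v"
      using p that lookup_le_degree[of m v] by (simp add: homogeneous_def)
  qed
  then have "p = constant_poly (Poly_Mapping.lookup p 0)"
    by (intro poly_mapping_eqI) (auto simp: constant_poly_def lookup_single when_def in_keys_iff)
  then show "p \<in> range constant_poly" by (rule range_eqI)
next
  fix p :: "'k polynomial" assume "p \<in> range constant_poly"
  then show "p \<in> homogeneous 0"
    by (auto simp: constant_poly_def homogeneous_def split: if_splits)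
qed

theorem pos_graded_algebra_quot:
  "pos_graded_algebra (quot_scale :: 'k::field \<Rightarrow> 'k quot_ring \<Rightarrow> 'k quot_ring) quot_grading"
proof (rule pos_graded_algebra.intro)
  show "vector_space (quot_scale :: 'k \<Rightarrow> 'k quot_ring \<Rightarrow> 'k quot_ring)"
    by (rule vector_space_quot)
  show "quot_scale c r * s = quot_scale c (r * s)" for c :: 'k and r s
    unfolding quot_scale_def by (rule mult.assoc)
  show "module.subspace quot_scale (quot_grading d :: 'k quot_ring set)" for d
    by (rule quot_grading_subspace)
  show "\<exists>!f. (\<forall>i. f i \<in> quot_grading i) \<and> finite {i. f i \<noteq> 0} \<and> r = (\<Sum>i | f i \<noteq> 0. f i)"
    for r :: "'k quot_ring"
  proof (rule ex_ex1I)
    show "\<exists>f. (\<forall>i. f i \<in> quot_grading i) \<and> finite {i. f i \<noteq> 0} \<and> r = (\<Sum>i | f i \<noteq> 0. f i)"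
      by (rule direct_sum_exists)
  qed (elim conjE, rule direct_sum_unique)
  show "r * s \<in> quot_grading (i + j)" if "r \<in> quot_grading i" "s \<in> quot_grading j"
    for i j and r s :: "'k quot_ring"
    using that by (rule quot_grading_mult)
  show "quot_grading 0 = range (\<lambda>c. quot_scale c (1 :: 'k quot_ring))"
    unfolding quot_grading_def quot_scale_def homogeneous_0 image_image mult_1_right ..
  show "\<exists>A. finite A \<and> N = ideal_gen A" if "is_ideal N" for N :: "'k quot_ring set"
    using that by (rule quot_noetherian)
qed

end

theory Submission
  imports Defs
begin

text \<open>
  Let \<open>K\<close> be the Koszul complex on \<open>x, y, z, w\<close> and \<open>h\<^sub>i = dim H\<^sub>i(K)\<close>. In \<open>R\<close> every product
  of a square of a variable with an element of \<open>\<mm>\<close> vanishes. Therefore \<open>xy \<cdot> e\<^sub>x \<and> e\<^sub>y\<close> and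
  \<open>zw \<cdot> e\<^sub>z \<and> e\<^sub>w\<close> are cycles in \<open>K\<^sub>2\<close>, and their product \<open>xyzw \<cdot> e\<^sub>x \<and> e\<^sub>y \<and> e\<^sub>z \<and> e\<^sub>w\<close> is not a
  boundary, because \<open>K\<^sub>5 = 0\<close> and \<open>xyzw \<noteq> 0\<close>. A nonzero product in Koszul homology is known to
  prevent a ring from being Golod; here it is used directly, to show that the fifth Betti
  number is too small.

  Take any free resolution \<open>F\<close> of \<open>k\<close>, let \<open>M\<^sub>j \<subseteq> F\<^sub>j\<^sub>-\<^sub>1\<close> be its syzygies and \<open>\<beta>\<^sub>j\<close> the dimensions
  of Tor. The exact sequences \<open>0 \<rightarrow> M\<^sub>j\<^sub>+\<^sub>1 \<rightarrow> F\<^sub>j \<rightarrow> M\<^sub>j \<rightarrow> 0\<close> give long exact sequences in Koszul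
  homology, where \<open>H\<^sub>p(F\<^sub>j)\<close> is a sum of copies of \<open>H\<^sub>p(R)\<close>. Walking down from \<open>\<beta>\<^sub>5\<close>, which is a
  dimension in \<open>H\<^sub>0(M\<^sub>5)\<close>, through \<open>H\<^sub>1(M\<^sub>4)\<close>, \<open>H\<^sub>2(M\<^sub>3)\<close>, \<open>H\<^sub>3(M\<^sub>2)\<close> to \<open>H\<^sub>4(M\<^sub>1)\<close> yields
  \<open>\<beta>\<^sub>5 \<le> h\<^sub>4 + h\<^sub>3\<beta>\<^sub>1 + h\<^sub>2\<beta>\<^sub>2 + h\<^sub>1\<beta>\<^sub>3\<close>, the recursive form of Serre's inequality. Equality forces
  the maps \<open>H\<^sub>p(F\<^sub>j) \<rightarrow> H\<^sub>p(M\<^sub>j)\<close> to have the smallest possible rank (\<open>tor_bound\<close>). The resolution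
  may fail to be minimal, so this rank need not be zero, but it is at least \<open>h\<^sub>p\<close> times the rank of
  \<open>F\<^sub>j \<rightarrow> F\<^sub>j\<^sub>-\<^sub>1\<close> modulo \<open>\<mm>\<close> (\<open>rank_homology_map\<close>); minimality of the rank means that a class coming
  from \<open>F\<^sub>j\<close> and vanishing in \<open>H\<^sub>p(F\<^sub>j\<^sub>-\<^sub>1)\<close> already vanishes in \<open>H\<^sub>p(M\<^sub>j)\<close>.

  The product violates this. Let \<open>\<eta> \<in> F\<^sub>2\<close> be a Koszul relation between \<open>x\<close> and \<open>y\<close> and let
  \<open>u \<in> F\<^sub>3\<close> be the generator that kills \<open>xy\<eta>\<close>. The cycle \<open>zw \<cdot> e\<^sub>z \<and> e\<^sub>w \<otimes> u\<close> is pushed through the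
  resolution by a zigzag whose last term is \<open>xyzw \<cdot> e\<^sub>x \<and> e\<^sub>y \<and> e\<^sub>z \<and> e\<^sub>w\<close> in \<open>K\<^sub>4 \<otimes> M\<^sub>1\<close>, so
  equality would give \<open>xyzw = 0\<close> (\<open>tor_strict_bound\<close>).

  On the other hand, for a Golod ring \<open>P(t) (1 - t \<Sum>\<^sub>i\<^sub>\<ge>\<^sub>1 h\<^sub>i t\<^sup>i) = (1 + t)\<^sup>n\<close>, and the coefficient of
  \<open>t\<^sup>5\<close> on the right is not negative, which gives the opposite inequality whatever \<open>n\<close> is
  (\<open>golod_coefficient_5\<close>). The Koszul homology in Serre's bound belongs to an unspecified minimal
  system of generators; \<open>homology_dim_le\<close> compares it with that of the variables.
\<close>

unbundle fps_syntax

section \<open>Dimensions of finite-dimensional subspaces\<close>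

definition fin_dim :: "('k::field \<Rightarrow> 'v::ab_group_add \<Rightarrow> 'v) \<Rightarrow> 'v set \<Rightarrow> bool" where
  "fin_dim s V \<longleftrightarrow> module.subspace s V \<and> (\<exists>B. finite B \<and> V \<subseteq> module.span s B)"

context vector_space
begin

lemma fin_dim_subspace: "fin_dim scale V \<Longrightarrow> subspace V"
  by (simp add: fin_dim_def)

lemma fin_dim_subset: "fin_dim scale W \<Longrightarrow> subspace V \<Longrightarrow> V \<subseteq> W \<Longrightarrow> fin_dim scale V"
  unfolding fin_dim_def by blast

lemma fin_dim_finite_independent:
  assumes "fin_dim scale V" "B \<subseteq> V" "independent B"
  shows "finite B" "card B \<le> dim V"
proof -
  obtain C where C: "finite C" "V \<subseteq> span C" using assms(1) by (auto simp: fin_dim_def)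
  show "finite B" using independent_span_bound[OF C(1) assms(3)] assms(2) C(2) by blast
  obtain A where A: "A \<subseteq> V" "independent A" "V \<subseteq> span A" "card A = dim V"
    using basis_exists .
  have "finite A" using independent_span_bound[OF C(1) A(2)] A(1) C(2) by blast
  then show "card B \<le> dim V"
    using independent_span_bound[OF _ assms(3)] assms(2) A by force
qed

lemma fin_dim_basis:
  assumes "fin_dim scale V"
  obtains B where "finite B" "B \<subseteq> V" "independent B" "span B = V" "card B = dim V"
proof -
  obtain A where A: "A \<subseteq> V" "independent A" "V \<subseteq> span A" "card A = dim V"
    using basis_exists .
  moreover have "span A \<subseteq> V" using A(1) local.fin_dim_subspace[OF assms] by (rule span_minimal)
  ultimately show ?thesis using that local.fin_dim_finite_independent(1)[OF assms A(1,2)] by blast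
qed

lemma dim_mono_fin:
  assumes "fin_dim scale W" "V \<subseteq> W" shows "dim V \<le> dim W"
proof -
  obtain A where A: "A \<subseteq> V" "independent A" "V \<subseteq> span A" "card A = dim V"
    using basis_exists .
  show ?thesis using local.fin_dim_finite_independent(2)[OF assms(1) _ A(2)] A assms(2) by auto
qed

lemma dim_strict_mono_fin:
  assumes "fin_dim scale W" "subspace V" "V \<subset> W" shows "dim V < dim W"
proof -
  have "fin_dim scale V" using assms local.fin_dim_subset by blast
  then obtain A where A: "finite A" "A \<subseteq> V" "independent A" "span A = V" "card A = dim V"
    by (rule local.fin_dim_basis)
  obtain w where w: "w \<in> W" "w \<notin> V" using assms(3) by blast
  then have "independent (insert w A)" using A independent_insert by auto
  moreover have "insert w A \<subseteq> W" using w A assms by blast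
  ultimately have "card (insert w A) \<le> dim W" using local.fin_dim_finite_independent(2)[OF assms(1)] by blast
  moreover have "w \<notin> A" using w A(2) by blast
  ultimately show ?thesis using A by simp
qed

lemma span_Un_basis: "span C = B \<Longrightarrow> span (A \<union> C) = span (A \<union> B)"
  unfolding span_Un by (metis span_span)

lemma independent_Un_modulo:
  assumes T: "finite T" "\<And>t. t \<in> T \<Longrightarrow> t \<notin> span ((T - {t}) \<union> B)"
    and C: "independent C" "span C = B"
  shows "independent (T \<union> C)" "T \<inter> C = {}"
proof -
  show "T \<inter> C = {}"
    using T(2) C(2) by (meson Un_iff disjoint_iff span_base span_superset subsetD)
  have "independent (T' \<union> C)" if "finite T'" "T' \<subseteq> T" for T'
    using that
  proof (induction T')
    case (insert t T')
    then have "span (T' \<union> C) \<subseteq> span ((T - {t}) \<union> B)"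
      unfolding local.span_Un_basis[OF C(2)] by (intro span_mono) auto
    then show ?case using insert T(2)[of t] by (auto simp: independent_insert)
  qed (use C in auto)
  then show "independent (T \<union> C)" using T(1) by blast
qed

text \<open>A basis modulo \<open>B\<close> and a basis of \<open>B\<close> together form a basis of \<open>Z\<close>.\<close>

lemma basis_modulo_card:
  assumes Z: "fin_dim scale Z" and B: "subspace B" "B \<subseteq> Z" and T: "basis_modulo scale Z B T"
  shows "finite T" "card T + dim B = dim Z"
proof -
  have "fin_dim scale B" using Z B by (rule local.fin_dim_subset)
  then obtain C where C: "finite C" "C \<subseteq> B" "independent C" "span C = B" "card C = dim B"
    by (rule local.fin_dim_basis)
  have T: "T \<subseteq> Z" "Z \<subseteq> span (T \<union> B)" "\<And>t. t \<in> T \<Longrightarrow> t \<notin> span ((T - {t}) \<union> B)"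
    using T by (auto simp: basis_modulo_def)
  have ind: "card T' \<le> dim Z" if "finite T'" "T' \<subseteq> T" for T'
  proof -
    have "t \<notin> span ((T' - {t}) \<union> B)" if "t \<in> T'" for t
      using T(3)[of t] that \<open>T' \<subseteq> T\<close> span_mono[of "(T' - {t}) \<union> B" "(T - {t}) \<union> B"] by blast
    then have "independent (T' \<union> C)" using local.independent_Un_modulo that(1) C by blast
    then have "independent T'" by (rule independent_mono) blast
    moreover have "T' \<subseteq> Z" using that T(1) by blast
    ultimately show ?thesis using local.fin_dim_finite_independent(2)[OF Z] by blast
  qed
  show fin: "finite T"
  proof (rule ccontr)
    assume "infinite T"
    then obtain T' where "finite T'" "card T' = Suc (dim Z)" "T' \<subseteq> T"
      using infinite_arbitrarily_large by metis
    with ind[of T'] show False by simp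
  qed
  note TC = local.independent_Un_modulo[OF fin T(3) C(3,4)]
  moreover have "T \<union> C \<subseteq> Z" using T(1) C(2) B(2) by blast
  moreover have "Z \<subseteq> span (T \<union> C)" using T(2) local.span_Un_basis[OF C(4)] by simp
  ultimately have "dim Z = card (T \<union> C)" by (metis basis_card_eq_dim)
  then show "card T + dim B = dim Z" using fin C TC(2) card_Un_disjoint[of T C] by simp
qed

lemma basis_modulo_exists:
  assumes Z: "fin_dim scale Z" and B: "subspace B" "B \<subseteq> Z"
  shows "\<exists>T. basis_modulo scale Z B T"
proof -
  have "fin_dim scale B" using Z B by (rule local.fin_dim_subset)
  then obtain C where C: "finite C" "C \<subseteq> B" "independent C" "span C = B" "card C = dim B"
    by (rule local.fin_dim_basis)
  obtain E where E: "C \<subseteq> E" "E \<subseteq> Z" "independent E" "Z \<subseteq> span E"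
    using maximal_independent_subset_extend[of C Z] C B by (metis subset_trans)
  have sp: "span (A \<union> C) = span (A \<union> B)" for A
    unfolding span_Un using C(4) by (metis span_span)
  have "basis_modulo scale Z B (E - C)"
    unfolding basis_modulo_def
  proof (intro conjI ballI)
    show "E - C \<subseteq> Z" using E by blast
    show "Z \<subseteq> span (E - C \<union> B)" using E sp[of "E - C"] by (simp add: Un_absorb2)
    fix t assume t: "t \<in> E - C"
    have "(E - C - {t}) \<union> C = E - {t}" using t E(1) by blast
    then have "span (E - C - {t} \<union> B) = span (E - {t})" using sp[of "E - C - {t}"] by simp
    then show "t \<notin> span (E - C - {t} \<union> B)" using t E(3) by (auto simp: dependent_def)
  qed
  then show ?thesis by blast
qed

lemma quotient_dim_eq:
  assumes "fin_dim scale Z" "subspace B" "B \<subseteq> Z"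
  shows "quotient_dim scale Z B + dim B = dim Z"
  unfolding quotient_dim_def
  using local.basis_modulo_card(2)[OF assms someI_ex[OF local.basis_modulo_exists[OF assms]]] .

text \<open>The quotient \<open>Y / (Y \<inter> B)\<close> embeds into \<open>A / (A \<inter> B)\<close>.\<close>

lemma codim_mono:
  assumes A: "fin_dim scale A" and Y: "subspace Y" "Y \<subseteq> A" and B: "subspace B"
  shows "dim Y + dim (A \<inter> B) \<le> dim A + dim (Y \<inter> B)"
proof -
  have finY: "fin_dim scale Y" using A Y by (rule local.fin_dim_subset)
  have YB: "subspace (Y \<inter> B)" using Y B by (intro subspace_inter)
  obtain T where T: "basis_modulo scale Y (Y \<inter> B) T"
    using local.basis_modulo_exists[OF finY YB] by blast
  note card = local.basis_modulo_card[OF finY YB _ T]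
  have AB: "subspace (A \<inter> B)" using A B by (intro subspace_inter) (auto simp: fin_dim_def)
  then have "fin_dim scale (A \<inter> B)" using local.fin_dim_subset[OF A] by blast
  then obtain C where C: "finite C" "C \<subseteq> A \<inter> B" "independent C" "span C = A \<inter> B" "card C = dim (A \<inter> B)"
    by (rule local.fin_dim_basis)
  have TY: "T \<subseteq> Y" using T by (simp add: basis_modulo_def)
  have "t \<notin> span ((T - {t}) \<union> (A \<inter> B))" if t: "t \<in> T" for t
  proof
    assume "t \<in> span ((T - {t}) \<union> (A \<inter> B))"
    then obtain y c where yc: "t = y + c" "y \<in> span (T - {t})" "c \<in> A \<inter> B"
      unfolding span_Un using span_eq_iff[THEN iffD2, OF AB] by auto
    have "span (T - {t}) \<subseteq> Y" using TY Y(1) by (intro span_minimal) auto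
    then have "c \<in> Y" using yc TY t Y(1) subspace_diff[of Y t y] by auto
    then have "t \<in> span ((T - {t}) \<union> (Y \<inter> B))"
      unfolding yc(1) using yc(2,3) span_mono[of "T - {t}" "(T - {t}) \<union> (Y \<inter> B)"]
      by (intro span_add) (auto simp: yc(1)[symmetric] intro: span_base)
    then show False using T t by (auto simp: basis_modulo_def)
  qed
  note TC = local.independent_Un_modulo[OF card(1) this C(3,4)]
  have "T \<union> C \<subseteq> A" using TY Y(2) C(2) by blast
  then have "card (T \<union> C) \<le> dim A" using local.fin_dim_finite_independent(2)[OF A] TC(1) by blast
  then show ?thesis using card C TC(2) card_Un_disjoint[of T C] by simp
qed

end

context vector_space_pair
begin

lemma rank_nullity:
  assumes f: "Vector_Spaces.linear s1 s2 f" and V: "fin_dim s1 V"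
  shows "vs1.dim V = vs2.dim (f ` V) + vs1.dim {v \<in> V. f v = 0}"
proof -
  interpret f: Vector_Spaces.linear s1 s2 f by fact
  let ?K = "{v \<in> V. f v = 0}"
  have subV: "vs1.subspace V" using V by (simp add: fin_dim_def)
  have subK: "vs1.subspace ?K"
    using subV by (auto simp: vs1.subspace_def f.zero f.add f.scale)
  then have "fin_dim s1 ?K" using V by (auto intro: vs1.fin_dim_subset)
  then obtain C where C: "finite C" "C \<subseteq> ?K" "vs1.independent C" "vs1.span C = ?K" "card C = vs1.dim ?K"
    by (rule vs1.fin_dim_basis)
  obtain E where E: "C \<subseteq> E" "E \<subseteq> V" "vs1.independent E" "V \<subseteq> vs1.span E"
    using vs1.maximal_independent_subset_extend[of C V] C by (metis (no_types, lifting) mem_Collect_eq subset_iff)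
  have finE: "finite E" using vs1.fin_dim_finite_independent(1)[OF V E(2,3)] .
  have dV: "vs1.dim V = card E" using E by (metis vs1.basis_card_eq_dim)
  define A where "A = E - C"
  have A: "A \<subseteq> V" "finite A" "E = A \<union> C" "A \<inter> C = {}" using E finE by (auto simp: A_def)
  have spV: "vs1.span E = V" using E subV by (metis subset_antisym vs1.span_minimal)
  have inj: "inj_on f (vs1.span A)"
  proof (rule f.inj_on_iff_eq_0[THEN iffD2])
    show "vs1.subspace (vs1.span A)" by simp
    show "\<forall>x\<in>vs1.span A. f x = 0 \<longrightarrow> x = 0"
    proof (intro ballI impI)
      fix x assume x: "x \<in> vs1.span A" "f x = 0"
      have "x \<in> V" using x A(3) spV by (metis Un_upper1 subsetD vs1.span_mono)
      then have xC: "x \<in> vs1.span C" using x C by simp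
      have "vs1.representation E x = vs1.representation A x"
        "vs1.representation E x = vs1.representation C x"
        using vs1.representation_extend[OF E(3) x(1)] vs1.representation_extend[OF E(3) xC] A(3) by auto
      then have "vs1.representation E x b = 0" for b
        using vs1.representation_ne_zero[of A x b] vs1.representation_ne_zero[of C x b] A(4) by auto
      then show "x = 0"
        using vs1.sum_representation_eq[OF E(3) _ finE order_refl, of x] \<open>x \<in> V\<close> E(4) by auto
    qed
  qed
  have "vs2.independent (f ` A)"
    using A(3) E(3) vs1.independent_mono by (intro f.independent_injective_image inj) blast
  moreover have "f ` V \<subseteq> vs2.span (f ` A)"
  proof -
    have "f ` E \<subseteq> insert 0 (f ` A)" using A C by auto
    then have "vs2.span (f ` E) \<subseteq> vs2.span (f ` A)"
      by (metis vs2.span_insert_0 vs2.span_mono)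
    then show ?thesis using f.span_image[of E] spV by simp
  qed
  moreover have "f ` A \<subseteq> f ` V" using A by blast
  ultimately have "vs2.dim (f ` V) = card (f ` A)" by (metis vs2.basis_card_eq_dim)
  also have "\<dots> = card A" using inj vs1.span_superset by (intro card_image) (meson inj_on_subset)
  finally show ?thesis using dV A C card_Un_disjoint[of A C] by simp
qed

lemma dim_image_inj:
  assumes "Vector_Spaces.linear s1 s2 f" "fin_dim s1 V" "\<And>v. v \<in> V \<Longrightarrow> f v = 0 \<Longrightarrow> v = 0"
  shows "vs2.dim (f ` V) = vs1.dim V"
proof -
  have "{v \<in> V. f v = 0} \<subseteq> {0}" using assms(3) by auto
  then have "vs1.dim {v \<in> V. f v = 0} = 0"
    by (metis finite.intros(1) vs1.dim_le_card card.empty vs1.span_empty le_zero_eq)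
  then show ?thesis using rank_nullity[OF assms(1,2)] by simp
qed

end

(* It rewrites a * (b * c) to (a * b) * c and so loops with mult.assoc. *)
declare ideal.scale_scale [simp del]

section \<open>Koszul complexes over finite sets of indices\<close>

definition sign :: "nat set \<Rightarrow> nat \<Rightarrow> 'r::comm_ring_1" where
  "sign B j = (-1) ^ card {l \<in> B. l < j}"

text \<open>The differential of the Koszul complex on the family \<open>g\<close> restricted to the indices in \<open>N\<close>.
  Arbitrary index sets, rather than initial segments, allow adding one index at any position.\<close>

definition koszul :: "nat set \<Rightarrow> (nat \<Rightarrow> 'r::comm_ring_1) \<Rightarrow> (nat set \<Rightarrow> 'r) \<Rightarrow> nat set \<Rightarrow> 'r" where
  "koszul N g f = (\<lambda>B. \<Sum>j\<in>N - B. sign B j * g j * f (insert j B))"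

definition chains :: "nat set \<Rightarrow> nat \<Rightarrow> (nat set \<Rightarrow> 'r::comm_ring_1) set" where
  "chains N i = {f. \<forall>A. f A \<noteq> 0 \<longrightarrow> A \<subseteq> N \<and> card A = i}"

text \<open>Splitting off the index \<open>m\<close> writes a chain as \<open>f\<^sub>0 + e\<^sub>m \<and> f\<^sub>1\<close> with \<open>f\<^sub>0, f\<^sub>1\<close> free of \<open>m\<close>;
  \<open>slice m\<close> extracts \<open>f\<^sub>1\<close>, and \<open>wedge m\<close> is exterior multiplication by \<open>e\<^sub>m\<close>. In these terms the
  differential is \<open>(f\<^sub>0, f\<^sub>1) \<mapsto> (d f\<^sub>0 + g\<^sub>m f\<^sub>1, - d f\<^sub>1)\<close>: the Koszul complex over \<open>insert m N\<close> is the
  mapping cone of multiplication by \<open>g\<^sub>m\<close> on the one over \<open>N\<close>. That the differential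
  squares to zero, the null homotopies, and the effect of a redundant element on homology are all
  read off from this description.\<close>

definition slice :: "nat \<Rightarrow> (nat set \<Rightarrow> 'r::comm_ring_1) \<Rightarrow> nat set \<Rightarrow> 'r" where
  "slice m f = (\<lambda>B. if m \<in> B then 0 else sign B m * f (insert m B))"

definition wedge :: "nat \<Rightarrow> (nat set \<Rightarrow> 'r::comm_ring_1) \<Rightarrow> nat set \<Rightarrow> 'r" where
  "wedge m f = (\<lambda>B. if m \<in> B then sign B m * f (B - {m}) else 0)"

lemma koszul_cong:
  "(\<And>j. j \<in> N - B \<Longrightarrow> f (insert j B) = f' (insert j B)) \<Longrightarrow> koszul N g f B = koszul N g f' B"
  unfolding koszul_def by (intro sum.cong) auto

lemma koszul_add: "koszul N g (\<lambda>A. f A + f' A) B = koszul N g f B + koszul N g f' B"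
  by (simp add: koszul_def distrib_left sum.distrib)

lemma koszul_diff: "koszul N g (\<lambda>A. f A - f' A) B = koszul N g f B - koszul N g f' B"
  by (simp add: koszul_def right_diff_distrib sum_subtractf)

lemma koszul_mult: "koszul N g (\<lambda>A. r * f A) B = r * koszul N g f B"
  unfolding koszul_def sum_distrib_left by (intro sum.cong refl) (simp only: mult_ac)

lemma koszul_zero: "koszul N g (\<lambda>A. 0) B = 0"
  by (simp add: koszul_def)

lemma koszul_minus: "koszul N g (\<lambda>A. - f A) B = - koszul N g f B"
  by (simp add: koszul_def sum_negf)

lemma koszul_insert:
  assumes "finite N" "m \<notin> N" "m \<notin> B"
  shows "koszul (insert m N) g f B = koszul N g f B + g m * slice m f B"
proof -
  have "insert m N - B = insert m (N - B)" using assms by blast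
  then show ?thesis
    using assms by (simp add: koszul_def slice_def ac_simps)
qed

lemma sign_square: "sign B j * sign B j = (1 :: 'r::comm_ring_1)"
  by (simp add: sign_def flip: power_add mult_2)

lemma sign_cancel: "sign B j * (sign B j * x) = (x :: 'r::comm_ring_1)"
  by (simp add: sign_square flip: mult.assoc)

lemma sign_insert_same: "sign (insert m B) m = sign B m" "sign (B - {m}) m = sign B m"
proof -
  have "{l \<in> insert m B. l < m} = {l \<in> B. l < m}" "{l \<in> B - {m}. l < m} = {l \<in> B. l < m}" by auto
  then show "sign (insert m B) m = sign B m" "sign (B - {m}) m = sign B m" by (simp_all add: sign_def)
qed

lemma sign_insert:
  assumes "m \<notin> B"
  shows "sign (insert m B) j = (if m < j then - sign B j else (sign B j :: 'r::comm_ring_1))"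
proof -
  have "{l \<in> insert m B. l < j} = (if m < j then insert m {l \<in> B. l < j} else {l \<in> B. l < j})"
    by auto
  moreover have "finite {l \<in> B. l < j}" by (rule finite_subset[of _ "{..<j}"]) auto
  ultimately show ?thesis using assms by (simp add: sign_def)
qed

lemma sign_swap:
  assumes "j \<noteq> m" "j \<notin> B" "m \<notin> B"
  shows "sign B m * sign (insert m B) j = - (sign B j * sign (insert j B) m :: 'r::comm_ring_1)"
  using assms by (auto simp: sign_insert mult.commute)

lemma slice_koszul:
  assumes "m \<notin> N"
  shows "slice m (koszul (insert m N) g f) B = - koszul N g (slice m f) B"
proof (cases "m \<in> B")
  case True
  then show ?thesis by (simp add: slice_def koszul_def)
next
  case False
  have "insert m N - insert m B = N - B" using assms by blast
  then have "slice m (koszul (insert m N) g f) B = (\<Sum>j\<in>N - B. sign B m *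
      sign (insert m B) j * (g j * f (insert j (insert m B))))"
    using False by (simp add: slice_def koszul_def sum_distrib_left mult.assoc)
  also have "\<dots> = (\<Sum>j\<in>N - B. - (sign B j *
      sign (insert j B) m) * (g j * f (insert m (insert j B))))"
  proof (rule sum.cong)
    fix j assume "j \<in> N - B"
    then have j: "j \<noteq> m" "j \<notin> B" using assms by auto
    show "sign B m * sign (insert m B) j *
        (g j * f (insert j (insert m B))) =
      - (sign B j * sign (insert j B) m) *
        (g j * f (insert m (insert j B)))"
      unfolding sign_swap[OF j False] by (simp add: insert_commute)
  qed simp
  also have "\<dots> = - koszul N g (slice m f) B"
    unfolding koszul_def sum_negf[symmetric]
    using False assms by (intro sum.cong) (auto simp: slice_def mult_ac)
  finally show ?thesis .
qed

lemma slice_eqI: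
  assumes "\<And>B. m \<notin> B \<Longrightarrow> f B = f' B" "slice m f = slice m f'"
  shows "f = f'"
proof
  fix B
  show "f B = f' B"
  proof (cases "m \<in> B")
    case True
    then have "insert m (B - {m}) = B" by blast
    then have "sign (B - {m}) m * f B = sign (B - {m}) m * f' B"
      using fun_cong[OF assms(2), of "B - {m}"] by (simp add: slice_def)
    then have "sign (B - {m}) m * (sign (B - {m}) m * f B) =
        sign (B - {m}) m * (sign (B - {m}) m * f' B)" by simp
    then show ?thesis by (simp add: sign_cancel sign_insert_same)
  qed (use assms in auto)
qed

lemma slice_wedge:
  assumes "\<And>B. m \<in> B \<Longrightarrow> f B = 0"
  shows "slice m (wedge m f) = f"
proof
  fix B
  show "slice m (wedge m f) B = f B"
    using assms by (auto simp: slice_def wedge_def simp: sign_cancel sign_insert_same)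
qed

lemma koszul_wedge_off: "m \<notin> N \<Longrightarrow> m \<notin> B \<Longrightarrow> koszul N g (wedge m f) B = 0"
  by (auto simp: koszul_def wedge_def intro!: sum.neutral)

lemma koszul_koszul:
  assumes "finite N"
  shows "koszul N g (koszul N g f) = (\<lambda>B. 0)"
  using assms
proof (induction N arbitrary: f)
  case empty
  then show ?case by (simp add: koszul_def)
next
  case (insert m N)
  let ?D = "koszul (insert m N) g"
  show ?case
  proof (rule slice_eqI)
    fix B assume B: "m \<notin> B"
    have "koszul N g (?D f) B = koszul N g (\<lambda>A. koszul N g f A + g m * slice m f A) B"
      using insert.hyps B by (intro koszul_cong koszul_insert) auto
    also have "\<dots> = g m * koszul N g (slice m f) B"
      unfolding koszul_add koszul_mult insert.IH by simp
    finally show "?D (?D f) B = 0"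
      using insert.hyps B by (simp add: koszul_insert slice_koszul)
  next
    show "slice m (?D (?D f)) = slice m (\<lambda>B. 0)"
    proof
      fix B
      have "slice m (?D f) = (\<lambda>A. - koszul N g (slice m f) A)"
        using insert.hyps by (auto simp: slice_koszul)
      then have "koszul N g (slice m (?D f)) B = koszul N g (\<lambda>A. - koszul N g (slice m f) A) B"
        by simp
      then show "slice m (?D (?D f)) B = slice m (\<lambda>B. 0) B"
        using insert.hyps insert.IH[of "slice m f"]
        by (simp add: slice_koszul koszul_minus) (simp add: slice_def)
    qed
  qed
qed

definition cycles :: "nat set \<Rightarrow> (nat \<Rightarrow> 'r::comm_ring_1) \<Rightarrow> nat \<Rightarrow> (nat set \<Rightarrow> 'r) set" where
  "cycles N g i = {f \<in> chains N i. koszul N g f = (\<lambda>B. 0)}"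

definition boundaries :: "nat set \<Rightarrow> (nat \<Rightarrow> 'r::comm_ring_1) \<Rightarrow> nat \<Rightarrow> (nat set \<Rightarrow> 'r) set" where
  "boundaries N g i = koszul N g ` chains N (Suc i)"

lemma koszul_chains:
  assumes "finite N" "f \<in> chains N (Suc i)"
  shows "koszul N g f \<in> chains N i"
proof -
  have "A \<subseteq> N \<and> card A = i" if "koszul N g f A \<noteq> 0" for A
  proof -
    obtain j where j: "j \<in> N - A" "f (insert j A) \<noteq> 0"
    proof (rule ccontr)
      assume "\<not> thesis"
      then have "\<forall>j\<in>N - A. f (insert j A) = 0" using that by blast
      then have "koszul N g f A = 0" unfolding koszul_def by (intro sum.neutral) simp
      then show False using \<open>koszul N g f A \<noteq> 0\<close> by simp
    qed
    then have "insert j A \<subseteq> N" "card (insert j A) = Suc i" using assms(2) by (auto simp: chains_def)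
    then show ?thesis using j assms(1) finite_subset[of A N] by simp
  qed
  then show ?thesis by (simp add: chains_def)
qed

lemma koszul_chains_0:
  assumes "finite N" "f \<in> chains N 0"
  shows "koszul N g f = (\<lambda>B. 0)"
proof
  fix B
  have "f (insert j B) = 0" for j
  proof (rule ccontr)
    assume "f (insert j B) \<noteq> 0"
    then have "insert j B \<subseteq> N" "card (insert j B) = 0" using assms(2) by (auto simp: chains_def)
    then show False using assms(1) finite_subset[of "insert j B" N] by simp
  qed
  then show "koszul N g f B = 0" by (simp add: koszul_def)
qed

lemma boundaries_subset_cycles: "finite N \<Longrightarrow> boundaries N g i \<subseteq> cycles N g i"
  by (auto simp: boundaries_def cycles_def koszul_chains koszul_koszul)

lemma wedge_chains:
  assumes "finite N" "m \<in> N" "f \<in> chains N i"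
  shows "wedge m f \<in> chains N (Suc i)"
proof -
  have "A \<subseteq> N \<and> card A = Suc i" if "wedge m f A \<noteq> 0" for A
  proof -
    have "m \<in> A" "f (A - {m}) \<noteq> 0" using that by (auto simp: wedge_def split: if_splits)
    then have "A - {m} \<subseteq> N" "card (A - {m}) = i" using assms(3) by (auto simp: chains_def)
    moreover have "finite (A - {m})" using calculation assms(1) finite_subset by blast
    ultimately show ?thesis using \<open>m \<in> A\<close> assms(2) by (metis card.remove finite_Diff2 finite.intros finite_insert insert_Diff insert_subset)
  qed
  then show ?thesis by (simp add: chains_def)
qed

text \<open>Exterior multiplication by the basis vector \<open>e\<^sub>c\<close> is a null homotopy for multiplication
  by \<open>g c\<close>.\<close>

lemma mult_cycle_boundary:
  assumes N: "finite N" "c \<in> N" and f: "f \<in> cycles N g i"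
  shows "(\<lambda>A. g c * f A) \<in> boundaries N g i"
proof -
  define M where "M = N - {c}"
  have M: "N = insert c M" "finite M" "c \<notin> M" using N by (auto simp: M_def)
  have f0: "koszul N g f B = 0" for B using f by (simp add: cycles_def)
  have slice: "slice c (wedge c f) = (\<lambda>B. if c \<in> B then 0 else f B)"
  proof
    fix B
    show "slice c (wedge c f) B = (if c \<in> B then 0 else f B)"
      by (auto simp: slice_def wedge_def simp: sign_cancel sign_insert_same)
  qed
  have "koszul N g (wedge c f) = (\<lambda>A. g c * f A)"
  proof (rule slice_eqI)
    fix B assume "c \<notin> B"
    then show "koszul N g (wedge c f) B = g c * f B"
      using M by (simp add: koszul_insert koszul_wedge_off slice)
  next
    show "slice c (koszul N g (wedge c f)) = slice c (\<lambda>A. g c * f A)"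
    proof
      fix B
      show "slice c (koszul N g (wedge c f)) B = slice c (\<lambda>A. g c * f A) B"
      proof (cases "c \<in> B")
        case False
        have "koszul M g (slice c (wedge c f)) B = koszul M g f B"
          unfolding slice using False M by (intro koszul_cong) auto
        then have "slice c (koszul N g (wedge c f)) B = - koszul M g f B"
          using M slice_koszul[of c M g "wedge c f" B] by simp
        also have "\<dots> = g c * slice c f B"
          using f0[of B] False M by (simp add: koszul_insert neg_eq_iff_add_eq_0)
        finally show ?thesis by (simp add: slice_def mult.left_commute)
      qed (simp add: slice_def)
    qed
  qed
  moreover have "wedge c f \<in> chains N (Suc i)"
    using f N by (intro wedge_chains) (auto simp: cycles_def)
  ultimately show ?thesis unfolding boundaries_def by (metis image_eqI)
qed

lemma chains_iff: "f \<in> chains N i \<longleftrightarrow> (\<forall>A. \<not> (A \<subseteq> N \<and> card A = i) \<longrightarrow> f A = 0)"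
  by (auto simp: chains_def)

lemma chains_closed:
  "(\<lambda>A. 0) \<in> chains N i"
  "f \<in> chains N i \<Longrightarrow> f' \<in> chains N i \<Longrightarrow> (\<lambda>A. f A + f' A) \<in> chains N i"
  "f \<in> chains N i \<Longrightarrow> f' \<in> chains N i \<Longrightarrow> (\<lambda>A. f A - f' A) \<in> chains N i"
  "f \<in> chains N i \<Longrightarrow> (\<lambda>A. r * f A) \<in> chains N i"
  by (simp_all add: chains_iff)

lemma cycles_closed:
  "(\<lambda>A. 0) \<in> cycles N g i"
  "f \<in> cycles N g i \<Longrightarrow> f' \<in> cycles N g i \<Longrightarrow> (\<lambda>A. f A + f' A) \<in> cycles N g i"
  "f \<in> cycles N g i \<Longrightarrow> (\<lambda>A. r * f A) \<in> cycles N g i"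
  by (auto simp: cycles_def chains_closed koszul_add koszul_mult koszul_zero fun_eq_iff)

lemma boundaries_closed:
  "(\<lambda>A. 0) \<in> boundaries N g i"
  "f \<in> boundaries N g i \<Longrightarrow> f' \<in> boundaries N g i \<Longrightarrow> (\<lambda>A. f A + f' A) \<in> boundaries N g i"
  "f \<in> boundaries N g i \<Longrightarrow> (\<lambda>A. r * f A) \<in> boundaries N g i"
proof -
  show "(\<lambda>A. 0) \<in> boundaries N g i"
    unfolding boundaries_def
    by (rule image_eqI[of _ _ "\<lambda>A. 0"]) (auto simp: koszul_zero chains_closed)
  show "(\<lambda>A. f A + f' A) \<in> boundaries N g i" if ff: "f \<in> boundaries N g i" "f' \<in> boundaries N g i"
  proof -
    obtain u v where "u \<in> chains N (Suc i)" "v \<in> chains N (Suc i)" "f = koszul N g u" "f' = koszul N g v"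
      using ff unfolding boundaries_def by blast
    then show ?thesis unfolding boundaries_def
      by (intro image_eqI[of _ _ "\<lambda>A. u A + v A"]) (auto simp: koszul_add chains_closed)
  qed
  show "(\<lambda>A. r * f A) \<in> boundaries N g i" if ff: "f \<in> boundaries N g i"
  proof -
    obtain u where "u \<in> chains N (Suc i)" "f = koszul N g u"
      using ff by (auto simp: boundaries_def)
    then show ?thesis unfolding boundaries_def
      by (intro image_eqI[of _ _ "\<lambda>A. r * u A"]) (auto simp: koszul_mult chains_closed)
  qed
qed

lemma ideal_mult_cycle_boundary:
  assumes N: "finite N" and a: "a \<in> ideal_gen (g ` N)" and f: "f \<in> cycles N g i"
  shows "(\<lambda>A. a * f A) \<in> boundaries N g i"
  using a[unfolded ideal_gen_def]
proof (induction a rule: ideal.span_induct_alt)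
  case base
  then show ?case by (simp add: boundaries_closed)
next
  case (step r x y)
  then obtain c where c: "c \<in> N" "x = g c" by blast
  have "(\<lambda>A. r * (g c * f A) + y * f A) \<in> boundaries N g i"
    by (intro boundaries_closed step.IH mult_cycle_boundary N c f)
  then show ?case using c by (simp add: algebra_simps)
qed

lemma slice_chains:
  assumes "finite N" "f \<in> chains (insert m N) (Suc i)" "m \<notin> N"
  shows "slice m f \<in> chains N i"
proof -
  have "A \<subseteq> N \<and> card A = i" if "slice m f A \<noteq> 0" for A
  proof -
    have "m \<notin> A" "f (insert m A) \<noteq> 0" using that by (auto simp: slice_def split: if_splits)
    then have "insert m A \<subseteq> insert m N" "card (insert m A) = Suc i" using assms by (auto simp: chains_def)
    moreover from this have "A \<subseteq> N" using \<open>m \<notin> A\<close> by blast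
    ultimately show ?thesis using \<open>m \<notin> A\<close> assms(1) finite_subset[of A N] by simp
  qed
  then show ?thesis by (simp add: chains_def)
qed

lemma chains_insert_mono: "f \<in> chains N i \<Longrightarrow> f \<in> chains (insert m N) i"
  by (auto simp: chains_def)

lemma chains_vanish: "f \<in> chains N i \<Longrightarrow> m \<notin> N \<Longrightarrow> m \<in> B \<Longrightarrow> f B = 0"
  by (auto simp: chains_def)

lemma slice_chains_0: "f \<in> chains N i \<Longrightarrow> m \<notin> N \<Longrightarrow> slice m f = (\<lambda>B. 0)"
  by (auto simp: slice_def chains_vanish fun_eq_iff)

lemma slice_zero_chains:
  assumes "f \<in> chains (insert m N) i" "slice m f = (\<lambda>B. 0)"
  shows "f \<in> chains N i"
proof -
  have "f = (\<lambda>B. if m \<in> B then 0 else f B)"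
    by (rule slice_eqI[of m]) (use assms(2) in \<open>auto simp: slice_def fun_eq_iff\<close>)
  then show ?thesis using assms(1) unfolding chains_def by (smt (verit) insertE mem_Collect_eq subset_iff)
qed

lemma slice_diff: "slice m (\<lambda>A. f A - f' A) B = slice m f B - slice m f' B"
  by (simp add: slice_def algebra_simps)

lemma koszul_insert_chains:
  assumes "finite N" "m \<notin> N" "f \<in> chains N i"
  shows "koszul (insert m N) g f = koszul N g f"
proof (rule slice_eqI)
  fix B assume "m \<notin> B"
  then show "koszul (insert m N) g f B = koszul N g f B"
    using assms by (simp add: koszul_insert slice_chains_0)
next
  have "koszul N g f B = 0" if "m \<in> B" for B
    using that assms by (auto simp: koszul_def chains_vanish)
  then have "slice m (koszul N g f) = (\<lambda>B. 0)" by (auto simp: slice_def)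
  then show "slice m (koszul (insert m N) g f) = slice m (koszul N g f)"
    using assms by (auto simp: slice_koszul slice_chains_0 koszul_zero)
qed

lemma slice_image_chains:
  assumes "finite N" "m \<notin> N"
  shows "slice m ` chains (insert m N) (Suc i) = chains N i"
proof (intro equalityI subsetI)
  fix f assume f: "f \<in> chains N i"
  then have "wedge m f \<in> chains (insert m N) (Suc i)"
    using assms by (intro wedge_chains chains_insert_mono) auto
  moreover have "slice m (wedge m f) = f"
    using chains_vanish[OF f assms(2)] by (rule slice_wedge)
  ultimately show "f \<in> slice m ` chains (insert m N) (Suc i)" by (metis image_eqI)
qed (use assms slice_chains in auto)

lemma slice_kernel_chains:
  assumes "m \<notin> N"
  shows "{f \<in> chains (insert m N) i. slice m f = 0} = chains N i"
  using assms slice_zero_chains[of _ m N i] slice_chains_0[of _ N i m] chains_insert_mono[of _ N i m]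
  by (auto simp: zero_fun_def)

text \<open>A cycle \<open>f\<close> over \<open>N\<close> lifts to a cycle \<open>e\<^sub>m \<and> f - u\<close> because \<open>g\<^sub>m f\<close> is a boundary \<open>d u\<close>.\<close>

lemma slice_image_cycles:
  assumes "finite N" "m \<notin> N" "g m \<in> ideal_gen (g ` N)"
  shows "slice m ` cycles (insert m N) g (Suc i) = cycles N g i"
proof (intro equalityI subsetI)
  fix f assume "f \<in> slice m ` cycles (insert m N) g (Suc i)"
  then obtain u where u: "u \<in> chains (insert m N) (Suc i)" "koszul (insert m N) g u = (\<lambda>B. 0)" "f = slice m u"
    by (auto simp: cycles_def)
  have "koszul N g f B = 0" for B
    using slice_koszul[OF assms(2), of g u B] unfolding u by (simp add: slice_def[of m "\<lambda>B. 0"] split: if_splits)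
  then show "f \<in> cycles N g i" using u slice_chains assms by (auto simp: cycles_def)
next
  fix f assume f: "f \<in> cycles N g i"
  then obtain u where u: "u \<in> chains N (Suc i)" "koszul N g u = (\<lambda>A. g m * f A)"
    using ideal_mult_cycle_boundary[OF assms(1,3)] by (force simp: boundaries_def)
  have fc: "f \<in> chains N i" "koszul N g f = (\<lambda>B. 0)" using f by (auto simp: cycles_def)
  define v where "v = (\<lambda>A. wedge m f A - u A)"
  have sl: "slice m v = f"
    using slice_wedge[of m f] chains_vanish[OF fc(1) assms(2)] slice_chains_0[OF u(1) assms(2)]
    by (simp add: v_def slice_diff[abs_def])
  have "koszul (insert m N) g v = (\<lambda>B. 0)"
  proof (rule slice_eqI)
    fix B assume "m \<notin> B"
    then show "koszul (insert m N) g v B = 0"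
      using assms u sl by (simp add: koszul_insert) (simp add: v_def koszul_diff koszul_wedge_off)
  next
    have "slice m (koszul (insert m N) g v) B = 0" for B
      using assms(2) fc(2) sl by (simp add: slice_koszul)
    then show "slice m (koszul (insert m N) g v) = slice m (\<lambda>B. 0)"
      by (simp add: fun_eq_iff slice_def[of m "\<lambda>B. 0"])
  qed
  moreover have "v \<in> chains (insert m N) (Suc i)" unfolding v_def
    using assms u fc by (intro chains_closed wedge_chains chains_insert_mono) auto
  ultimately show "f \<in> slice m ` cycles (insert m N) g (Suc i)"
    using sl by (auto simp: cycles_def intro!: image_eqI[of _ _ v])
qed

lemma slice_kernel_cycles:
  assumes "finite N" "m \<notin> N"
  shows "{f \<in> cycles (insert m N) g i. slice m f = 0} = cycles N g i"
proof -
  have "{f \<in> cycles (insert m N) g i. slice m f = 0} =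
      {f \<in> chains N i. koszul (insert m N) g f = (\<lambda>B. 0)}"
    unfolding slice_kernel_chains[OF assms(2), symmetric] by (auto simp: cycles_def)
  also have "\<dots> = cycles N g i" unfolding cycles_def
    using koszul_insert_chains[OF assms, of _ i g] by (intro Collect_cong) (metis (no_types, lifting))
  finally show ?thesis .
qed

section \<open>Finite-dimensional graded algebras and Koszul homology\<close>

locale finite_graded_algebra = pos_graded_algebra scale G
  for scale :: "'k::field \<Rightarrow> 'r::comm_ring_1 \<Rightarrow> 'r" and G :: "nat \<Rightarrow> 'r set" +
  assumes finite_dimensional: "\<exists>B. finite B \<and> module.span scale B = UNIV"
begin

sublocale sc: vector_space scale by (rule vector_space)

sublocale pw: vector_space "pointwise_scale :: 'k \<Rightarrow> ('i \<Rightarrow> 'r) \<Rightarrow> 'i \<Rightarrow> 'r"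
  by standard (auto simp: pointwise_scale_def fun_eq_iff sc.scale_right_distrib sc.scale_left_distrib)

sublocale pp: vector_space_pair "pointwise_scale :: 'k \<Rightarrow> ('i \<Rightarrow> 'r) \<Rightarrow> 'i \<Rightarrow> 'r"
   "pointwise_scale :: 'k \<Rightarrow> ('j \<Rightarrow> 'r) \<Rightarrow> 'j \<Rightarrow> 'r" ..

sublocale sp: vector_space_pair scale "pointwise_scale :: 'k \<Rightarrow> ('j \<Rightarrow> 'r) \<Rightarrow> 'j \<Rightarrow> 'r" ..

lemma scale_mult_right: "x * scale c y = scale c (x * y)"
  using scale_mult[of c y x] by (simp add: mult.commute)

lemma scale_eq_mult: "scale c x = scale c 1 * x"
  by (simp add: scale_mult)

text \<open>Finiteness of all dimensions rests on this: \<open>R\<close> is finite-dimensional, and every chain that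
  occurs is supported on a fixed finite set.\<close>

lemma fin_dim_supported:
  assumes "finite J"
  shows "fin_dim pointwise_scale {f :: 'i \<Rightarrow> 'r. \<forall>x. x \<notin> J \<longrightarrow> f x = 0}"
proof -
  obtain B where B: "finite B" "sc.span B = UNIV" using finite_dimensional by blast
  define e :: "'i \<Rightarrow> 'r \<Rightarrow> 'i \<Rightarrow> 'r" where "e j r = (\<lambda>x. if x = j then r else 0)" for j r
  have lin: "Vector_Spaces.linear scale pointwise_scale (e j)" for j
    by unfold_locales (auto simp: e_def pointwise_scale_def fun_eq_iff)
  have mem: "e j r \<in> pw.span (\<Union>j\<in>J. e j ` B)" if "j \<in> J" for j r
  proof -
    have "e j r \<in> pw.span (e j ` B)"
      using sp.linear_span_image[OF lin, of j B] B by auto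
    then show ?thesis by (rule subsetD[OF pw.span_mono, rotated]) (use that in auto)
  qed
  have "f \<in> pw.span (\<Union>j\<in>J. e j ` B)" if "\<forall>x. x \<notin> J \<longrightarrow> f x = 0" for f
  proof -
    have "f = (\<Sum>j\<in>J. e j (f j))"
    proof
      fix x
      have "(\<Sum>j\<in>J. e j (f j)) x = (\<Sum>j\<in>J. e j (f j) x)" by (induction J rule: infinite_finite_induct) auto
      then show "f x = (\<Sum>j\<in>J. e j (f j)) x" using that assms by (simp add: e_def)
    qed
    also have "\<dots> \<in> pw.span (\<Union>j\<in>J. e j ` B)" by (intro pw.span_sum mem)
    finally show ?thesis .
  qed
  moreover have "pw.subspace {f :: 'i \<Rightarrow> 'r. \<forall>x. x \<notin> J \<longrightarrow> f x = 0}"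
    by (auto simp: pw.subspace_def pointwise_scale_def)
  ultimately show ?thesis
    unfolding fin_dim_def using assms B(1) by (intro conjI exI[of _ "\<Union>j\<in>J. e j ` B"]) auto
qed

lemma linear_intro:
  fixes T :: "('i \<Rightarrow> 'r) \<Rightarrow> 'j \<Rightarrow> 'r"
  assumes "\<And>f f' j. T (\<lambda>x. f x + f' x) j = T f j + T f' j"
    and "\<And>r f j. T (\<lambda>x. r * f x) j = r * T f j"
  shows "Vector_Spaces.linear pointwise_scale pointwise_scale T"
proof -
  have *: "pointwise_scale c f = (\<lambda>x. scale c 1 * f x)" for c and f :: "'l \<Rightarrow> 'r"
    by (simp add: pointwise_scale_def fun_eq_iff scale_mult)
  have "T (f + f') = T f + T f'" for f f'
    using assms(1) by (auto simp: plus_fun_def)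
  moreover have "T (pointwise_scale c f) = pointwise_scale c (T f)" for c f
    unfolding * using assms(2) by auto
  ultimately show ?thesis
    by unfold_locales auto
qed

lemma subspace_intro:
  fixes V :: "('i \<Rightarrow> 'r) set"
  assumes "(\<lambda>x. 0) \<in> V" "\<And>f f'. f \<in> V \<Longrightarrow> f' \<in> V \<Longrightarrow> (\<lambda>x. f x + f' x) \<in> V"
    "\<And>r f. f \<in> V \<Longrightarrow> (\<lambda>x. r * f x) \<in> V"
  shows "pw.subspace V"
proof (rule pw.subspaceI)
  show "0 \<in> V" using assms(1) by (simp add: zero_fun_def)
  show "f + f' \<in> V" if "f \<in> V" "f' \<in> V" for f f' using assms(2)[OF that] by (simp add: plus_fun_def)
  have *: "pointwise_scale c f = (\<lambda>x. scale c 1 * f x)" for c and f :: "'i \<Rightarrow> 'r"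
    by (simp add: pointwise_scale_def fun_eq_iff scale_mult)
  show "pointwise_scale c f \<in> V" if "f \<in> V" for c f unfolding * using assms(3)[OF that] .
qed

lemma fin_dim_chains: "finite N \<Longrightarrow> fin_dim pointwise_scale (chains N i :: (nat set \<Rightarrow> 'r) set)"
  by (rule pw.fin_dim_subset[OF fin_dim_supported[of "Pow N"]])
    (auto intro!: subspace_intro chains_closed, auto simp: chains_def)

lemma fin_dim_cycles: "finite N \<Longrightarrow> fin_dim pointwise_scale (cycles N g i :: (nat set \<Rightarrow> 'r) set)"
  by (rule pw.fin_dim_subset[OF fin_dim_chains[of N i]])
    (auto intro!: subspace_intro cycles_closed, auto simp: cycles_def)

lemma subspace_boundaries: "pw.subspace (boundaries N g i :: (nat set \<Rightarrow> 'r) set)"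
  by (intro subspace_intro boundaries_closed)

lemma linear_koszul: "Vector_Spaces.linear pointwise_scale pointwise_scale (koszul N g :: (nat set \<Rightarrow> 'r) \<Rightarrow> _)"
  by (intro linear_intro koszul_add koszul_mult)

lemma linear_slice: "Vector_Spaces.linear pointwise_scale pointwise_scale (slice m :: (nat set \<Rightarrow> 'r) \<Rightarrow> _)"
  by (intro linear_intro) (auto simp: slice_def algebra_simps)

lemma dim_chains_Suc:
  assumes "finite N"
  shows "pw.dim (chains N (Suc i) :: (nat set \<Rightarrow> 'r) set) = pw.dim (cycles N g (Suc i)) + pw.dim (boundaries N g i)"
  using pp.rank_nullity[OF linear_koszul[of N g] fin_dim_chains[OF assms], of "Suc i"]
  by (simp add: boundaries_def cycles_def zero_fun_def)

lemma cycles_0: "finite N \<Longrightarrow> cycles N g 0 = chains N 0"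
  using koszul_chains_0 by (auto simp: cycles_def)

definition homology_dim :: "nat set \<Rightarrow> (nat \<Rightarrow> 'r) \<Rightarrow> nat \<Rightarrow> nat" where
  "homology_dim N g i = pw.dim (cycles N g i) - pw.dim (boundaries N g i)"

lemma homology_dim_add:
  "finite N \<Longrightarrow> homology_dim N g i + pw.dim (boundaries N g i) = pw.dim (cycles N g i)"
  using pw.dim_mono_fin[OF fin_dim_cycles boundaries_subset_cycles]
  by (simp add: homology_dim_def)

lemma dim_chains_insert:
  assumes "finite N" "m \<notin> N"
  shows "pw.dim (chains (insert m N) (Suc i) :: (nat set \<Rightarrow> 'r) set) =
    pw.dim (chains N (Suc i) :: (nat set \<Rightarrow> 'r) set) + pw.dim (chains N i :: (nat set \<Rightarrow> 'r) set)"
  using pp.rank_nullity[OF linear_slice[of m] fin_dim_chains, of "insert m N" "Suc i"] assms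
  by (simp add: slice_image_chains slice_kernel_chains)

lemma dim_cycles_insert:
  fixes g :: "nat \<Rightarrow> 'r"
  assumes "finite N" "m \<notin> N" "g m \<in> ideal_gen (g ` N)"
  shows "pw.dim (cycles (insert m N) g (Suc i)) = pw.dim (cycles N g (Suc i)) + pw.dim (cycles N g i)"
  using pp.rank_nullity[OF linear_slice[of m] fin_dim_cycles, of "insert m N" g "Suc i"] assms
  by (simp add: slice_image_cycles slice_kernel_cycles)

lemma chains_insert_0: "finite N \<Longrightarrow> chains (insert m N) 0 = chains N 0"
proof -
  assume "finite N"
  then have "A \<subseteq> insert m N \<and> card A = 0 \<longleftrightarrow> A \<subseteq> N \<and> card A = 0" for A
    using finite_subset[of A "insert m N"] by auto
  then show ?thesis unfolding chains_def by simp
qed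

text \<open>An element of the ideal acts as zero on homology, so the long exact sequence of the mapping
  cone breaks up into short ones.\<close>

lemma homology_dim_insert:
  fixes g :: "nat \<Rightarrow> 'r"
  assumes "finite N" "m \<notin> N" "g m \<in> ideal_gen (g ` N)"
  shows "homology_dim (insert m N) g 0 = homology_dim N g 0"
    "homology_dim (insert m N) g (Suc i) = homology_dim N g (Suc i) + homology_dim N g i"
proof -
  note fin = assms(1) finite_insert[THEN iffD2, OF assms(1), of m]
  note sum = dim_chains_Suc[OF fin(1), of _ g] dim_chains_Suc[OF fin(2), of _ g]
    dim_chains_insert[OF assms(1,2)] dim_cycles_insert[OF assms]
  note h = homology_dim_add[OF fin(1), of g] homology_dim_add[OF fin(2), of g]
  have b0: "pw.dim (boundaries (insert m N) g 0) = pw.dim (boundaries N g 0)"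
    using sum[of 0] fin by (simp add: cycles_0)
  have c0: "cycles (insert m N) g 0 = cycles N g 0" using fin by (simp add: cycles_0 chains_insert_0)
  show "homology_dim (insert m N) g 0 = homology_dim N g 0"
    by (simp add: homology_dim_def b0 c0)
  have "pw.dim (boundaries (insert m N) g (Suc i)) = pw.dim (boundaries N g (Suc i)) + pw.dim (boundaries N g i)"
    using sum[of "Suc i"] sum(1)[of i] by simp
  then show "homology_dim (insert m N) g (Suc i) = homology_dim N g (Suc i) + homology_dim N g i"
    using h(1)[of "Suc i"] h(1)[of i] h(2)[of "Suc i"] sum(4)[of i] by simp
qed

definition homology_series :: "nat set \<Rightarrow> (nat \<Rightarrow> 'r) \<Rightarrow> rat fps" where
  "homology_series N g = Abs_fps (\<lambda>i. of_nat (homology_dim N g i))"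

lemma homology_series_insert:
  assumes "finite N" "m \<notin> N" "g m \<in> ideal_gen (g ` N)"
  shows "homology_series (insert m N) g = (1 + fps_X) * homology_series N g"
proof (rule fps_ext)
  fix i
  show "homology_series (insert m N) g $ i = ((1 + fps_X) * homology_series N g) $ i"
    using homology_dim_insert[OF assms]
    by (cases i) (simp_all add: homology_series_def distrib_right)
qed

lemma homology_series_Un:
  assumes "finite N" "finite M" "M \<inter> N = {}" "\<And>m. m \<in> M \<Longrightarrow> g m \<in> ideal_gen (g ` N)"
  shows "homology_series (M \<union> N) g = (1 + fps_X) ^ card M * homology_series N g"
  using assms(2-)
proof (induction M)
  case (insert m M)
  have "ideal_gen (g ` N) \<subseteq> ideal_gen (g ` (M \<union> N))"
    unfolding ideal_gen_def by (intro ideal.span_mono) auto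
  then have "homology_series (insert m (M \<union> N)) g = (1 + fps_X) * homology_series (M \<union> N) g"
    using insert.prems insert.hyps assms(1) by (intro homology_series_insert) auto
  then show ?case using insert by (simp add: mult.assoc)
qed simp

text \<open>Over \<open>M \<union> N\<close> either family is redundant relative to the other, so the homology series is both
  \<open>(1 + t)\<^bsup>card M\<^esup> H\<^sub>N(t)\<close> and \<open>(1 + t)\<^bsup>card N\<^esup> H\<^sub>M(t)\<close>.\<close>

lemma homology_dim_le:
  assumes fin: "finite M" "finite N" and disj: "M \<inter> N = {}"
    and gen: "ideal_gen (g ` M) = ideal_gen (g ` N)" and card: "card N \<le> card M"
  shows "homology_dim N g i \<le> homology_dim M g i"
proof -
  have base: "g m \<in> ideal_gen (g ` A)" if "m \<in> A" for m A
    unfolding ideal_gen_def using that by (intro ideal.span_base) auto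
  have "homology_series (M \<union> N) g = (1 + fps_X) ^ card M * homology_series N g"
    using fin disj base[of _ M] gen by (intro homology_series_Un) auto
  moreover have "homology_series (N \<union> M) g = (1 + fps_X) ^ card N * homology_series M g"
    using fin disj base[of _ N] gen by (intro homology_series_Un) auto
  ultimately have "(1 + fps_X) ^ card N * homology_series M g =
      (1 + fps_X) ^ card N * ((1 + fps_X) ^ (card M - card N) * homology_series N g)"
    using card by (simp add: Un_commute mult.assoc[symmetric] power_add[symmetric])
  moreover have "(1 + fps_X :: rat fps) $ 0 \<noteq> 0" by simp
  then have "(1 + fps_X :: rat fps) \<noteq> 0" by fastforce
  ultimately have eq: "homology_series M g = (1 + fps_X) ^ (card M - card N) * homology_series N g" by simp
  have nonneg: "0 \<le> ((1 + fps_X) ^ k * homology_series N g) $ i \<and>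
      homology_series N g $ i \<le> ((1 + fps_X) ^ k * homology_series N g) $ i" for k i
  proof (induction k arbitrary: i)
    case 0
    then show ?case by (simp add: homology_series_def)
  next
    case (Suc k)
    show ?case
      using Suc[of i] Suc[of "i - 1"] by (cases i) (simp_all add: distrib_right mult.assoc)
  qed
  have "(of_nat (homology_dim N g i) :: rat) \<le> of_nat (homology_dim M g i)"
    using nonneg[of "card M - card N" i] unfolding eq[symmetric] by (simp add: homology_series_def)
  then show ?thesis by simp
qed

end

section \<open>Koszul complexes with coefficients in a module\<close>

definition rlinear :: "(('i \<Rightarrow> 'r::comm_ring_1) \<Rightarrow> 'j \<Rightarrow> 'r) \<Rightarrow> bool" where
  "rlinear T \<longleftrightarrow> (\<forall>f f'. T (\<lambda>x. f x + f' x) = (\<lambda>x. T f x + T f' x)) \<and>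
    (\<forall>r f. T (\<lambda>x. r * f x) = (\<lambda>x. r * T f x))"

definition submodule :: "('i \<Rightarrow> 'r::comm_ring_1) set \<Rightarrow> bool" where
  "submodule M \<longleftrightarrow> (\<lambda>x. 0) \<in> M \<and> (\<forall>f\<in>M. \<forall>f'\<in>M. (\<lambda>x. f x + f' x) \<in> M) \<and>
    (\<forall>r. \<forall>f\<in>M. (\<lambda>x. r * f x) \<in> M)"

lemma rlinear_add: "rlinear T \<Longrightarrow> T (\<lambda>x. f x + f' x) = (\<lambda>x. T f x + T f' x)"
  and rlinear_mult: "rlinear T \<Longrightarrow> T (\<lambda>x. r * f x) = (\<lambda>x. r * T f x)"
  by (auto simp: rlinear_def)

lemma rlinear_zero:
  assumes "rlinear T" shows "T (\<lambda>x. 0) = (\<lambda>x. 0)"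
  using rlinear_mult[OF assms, of 0 "\<lambda>x. 0"] by simp

lemma rlinear_diff:
  assumes "rlinear T" shows "T (\<lambda>x. f x - f' x) = (\<lambda>x. T f x - T f' x)"
  using rlinear_add[OF assms, of f "\<lambda>x. (-1) * f' x"] rlinear_mult[OF assms, of "-1" f'] by simp

lemma rlinear_sum:
  assumes T: "rlinear T"
  shows "T (\<lambda>x. \<Sum>j\<in>J. c j * f j x) = (\<lambda>x. \<Sum>j\<in>J. c j * T (f j) x)"
  by (induction J rule: infinite_finite_induct)
    (simp_all add: rlinear_zero[OF T] rlinear_add[OF T] rlinear_mult[OF T])

lemma rlinear_comp: "rlinear S \<Longrightarrow> rlinear T \<Longrightarrow> rlinear (\<lambda>f. S (T f))"
  by (simp add: rlinear_def)

lemma submodule_zero: "submodule M \<Longrightarrow> (\<lambda>x. 0) \<in> M"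
  and submodule_add: "submodule M \<Longrightarrow> f \<in> M \<Longrightarrow> f' \<in> M \<Longrightarrow> (\<lambda>x. f x + f' x) \<in> M"
  and submodule_mult: "submodule M \<Longrightarrow> f \<in> M \<Longrightarrow> (\<lambda>x. r * f x) \<in> M"
  by (auto simp: submodule_def)

lemma submodule_sum:
  assumes M: "submodule M" and f: "\<And>j. j \<in> J \<Longrightarrow> f j \<in> M"
  shows "(\<lambda>x. \<Sum>j\<in>J. c j * f j x) \<in> M"
  using f by (induction J rule: infinite_finite_induct)
    (auto simp: submodule_zero[OF M] intro!: submodule_add[OF M] submodule_mult[OF M])

lemma submodule_diff: "submodule M \<Longrightarrow> f \<in> M \<Longrightarrow> f' \<in> M \<Longrightarrow> (\<lambda>x. f x - f' x) \<in> M"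
  using submodule_add[of M f "\<lambda>x. (-1) * f' x"] submodule_mult[of M f' "-1"] by simp

lemma submodule_image:
  assumes T: "rlinear T" and M: "submodule M" shows "submodule (T ` M)"
  unfolding submodule_def
proof (intro conjI ballI allI)
  show "(\<lambda>x. 0) \<in> T ` M"
    by (rule rev_image_eqI[OF submodule_zero[OF M]]) (simp add: rlinear_zero[OF T])
  show "(\<lambda>x. f x + f' x) \<in> T ` M" if ff: "f \<in> T ` M" "f' \<in> T ` M" for f f'
  proof -
    obtain u u' where u: "u \<in> M" "u' \<in> M" "f = T u" "f' = T u'" using ff by blast
    show ?thesis unfolding u
      by (rule rev_image_eqI[OF submodule_add[OF M u(1,2)]]) (simp add: rlinear_add[OF T])
  qed
  show "(\<lambda>x. r * f x) \<in> T ` M" if ff: "f \<in> T ` M" for r f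
  proof -
    obtain u where u: "u \<in> M" "f = T u" using ff by blast
    show ?thesis unfolding u
      by (rule rev_image_eqI[OF submodule_mult[OF M u(1)]]) (simp add: rlinear_mult[OF T])
  qed
qed

lemma submodule_kernel:
  assumes T: "rlinear T" and M: "submodule M" shows "submodule {v \<in> M. T v = (\<lambda>x. 0)}"
  using submodule_zero[OF M] submodule_add[OF M] submodule_mult[OF M]
  by (auto simp: submodule_def rlinear_zero[OF T] rlinear_add[OF T] rlinear_mult[OF T])

lemma submodule_Int: "submodule M \<Longrightarrow> submodule M' \<Longrightarrow> submodule (M \<inter> M')"
  by (simp add: submodule_def)

lemma submodule_cycles: "submodule (cycles N g i)"
  and submodule_boundaries: "submodule (boundaries N g i)"
  by (auto simp: submodule_def chains_closed cycles_closed boundaries_closed)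

text \<open>The map \<open>id \<otimes> T\<close> on chains with coefficients in \<open>R\<^sup>n\<close>. Such a chain is encoded as a function of
  pairs \<open>(A, r)\<close>, the coordinate \<open>r\<close> of the coefficient at \<open>e\<^sub>A\<close>.\<close>

definition lift :: "((nat \<Rightarrow> 'r) \<Rightarrow> nat \<Rightarrow> 'r) \<Rightarrow> (nat set \<times> nat \<Rightarrow> 'r) \<Rightarrow> nat set \<times> nat \<Rightarrow> 'r" where
  "lift T f = (\<lambda>(A, r). T (\<lambda>r. f (A, r)) r)"

lemma lift_row: "(\<lambda>r. lift T f (A, r)) = T (\<lambda>r. f (A, r))"
  by (simp add: lift_def)

lemma rlinear_lift: "rlinear T \<Longrightarrow> rlinear (lift T)"
  by (auto simp: rlinear_def lift_def fun_eq_iff)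

context finite_graded_algebra
begin

lemma rlinear_linear: "rlinear (T :: ('i \<Rightarrow> 'r) \<Rightarrow> 'j \<Rightarrow> 'r) \<Longrightarrow> Vector_Spaces.linear pointwise_scale pointwise_scale T"
  by (rule linear_intro) (simp_all add: rlinear_def)

lemma submodule_subspace: "submodule (M :: ('i \<Rightarrow> 'r) set) \<Longrightarrow> pw.subspace M"
  by (rule subspace_intro) (auto simp: submodule_def)

lemma rlinear_rank_nullity:
  fixes T :: "('i \<Rightarrow> 'r) \<Rightarrow> 'j \<Rightarrow> 'r"
  assumes "rlinear T" "fin_dim pointwise_scale V" "T ` V = A" "{v \<in> V. T v = (\<lambda>x. 0)} = C"
  shows "pw.dim V = pw.dim A + pw.dim C"
  using pp.rank_nullity[OF rlinear_linear[OF assms(1)] assms(2)] assms(3,4) by (simp add: zero_fun_def)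

lemma submodule_free: "submodule (free_module n)"
  by (auto simp: submodule_def free_module_def)

end

locale koszul_algebra = finite_graded_algebra scale G
  for scale :: "'k::field \<Rightarrow> 'r::comm_ring_1 \<Rightarrow> 'r" and G :: "nat \<Rightarrow> 'r set" +
  fixes N :: "nat set" and g :: "nat \<Rightarrow> 'r"
  assumes finite_N: "finite N" and generators: "ideal_gen (g ` N) = \<mm>"
begin

text \<open>The Koszul complex \<open>K \<otimes> M\<close> for a submodule \<open>M\<close> of some \<open>R\<^sup>n\<close>.\<close>

definition mkoszul :: "(nat set \<times> nat \<Rightarrow> 'r) \<Rightarrow> nat set \<times> nat \<Rightarrow> 'r" where
  "mkoszul f = (\<lambda>(A, r). koszul N g (\<lambda>A. f (A, r)) A)"

definition mchains :: "(nat \<Rightarrow> 'r) set \<Rightarrow> nat \<Rightarrow> (nat set \<times> nat \<Rightarrow> 'r) set" where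
  "mchains M i = {f. (\<forall>A. (\<lambda>r. f (A, r)) \<in> M) \<and> (\<forall>r. (\<lambda>A. f (A, r)) \<in> chains N i)}"

definition mcycles :: "(nat \<Rightarrow> 'r) set \<Rightarrow> nat \<Rightarrow> (nat set \<times> nat \<Rightarrow> 'r) set" where
  "mcycles M i = {f \<in> mchains M i. mkoszul f = (\<lambda>x. 0)}"

definition mboundaries :: "(nat \<Rightarrow> 'r) set \<Rightarrow> nat \<Rightarrow> (nat set \<times> nat \<Rightarrow> 'r) set" where
  "mboundaries M i = mkoszul ` mchains M (Suc i)"

lemma mkoszul_col: "(\<lambda>A. mkoszul f (A, r)) = koszul N g (\<lambda>A. f (A, r))"
  by (simp add: mkoszul_def)

lemma mkoszul_row: "(\<lambda>r. mkoszul f (A, r)) = (\<lambda>r. \<Sum>j\<in>N - A. (sign A j * g j) * f (insert j A, r))"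
  by (simp add: mkoszul_def koszul_def)

lemma rlinear_mkoszul: "rlinear mkoszul"
  by (auto simp: rlinear_def mkoszul_def fun_eq_iff koszul_add koszul_mult)

lemma mkoszul_mkoszul: "mkoszul (mkoszul f) = (\<lambda>x. 0)"
  by (auto simp: mkoszul_def[of "mkoszul f"] mkoszul_col koszul_koszul finite_N fun_eq_iff)

lemma lift_mkoszul:
  assumes "rlinear T" shows "lift T (mkoszul f) = mkoszul (lift T f)"
proof
  fix x :: "nat set \<times> nat"
  obtain A r where x: "x = (A, r)" by (cases x)
  have "lift T (mkoszul f) (A, r) = T (\<lambda>r. \<Sum>j\<in>N - A. (sign A j * g j) * f (insert j A, r)) r"
    unfolding mkoszul_row[symmetric] lift_def by simp
  also have "\<dots> = (\<Sum>j\<in>N - A. (sign A j * g j) * T (\<lambda>r. f (insert j A, r)) r)"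
    using rlinear_sum[OF assms, of "\<lambda>j. sign A j * g j" "\<lambda>j r. f (insert j A, r)" "N - A"] by simp
  also have "\<dots> = mkoszul (lift T f) (A, r)" by (simp add: mkoszul_def koszul_def lift_def)
  finally show "lift T (mkoszul f) x = mkoszul (lift T f) x" by (simp add: x)
qed

lemma submodule_mchains: assumes M: "submodule M" shows "submodule (mchains M i)"
  unfolding submodule_def mchains_def
  using submodule_zero[OF M] submodule_add[OF M] submodule_mult[OF M]
  by (auto intro: chains_closed)

lemma submodule_mcycles: "submodule M \<Longrightarrow> submodule (mcycles M i)"
  unfolding mcycles_def by (intro submodule_kernel rlinear_mkoszul submodule_mchains)

lemma submodule_mboundaries: "submodule M \<Longrightarrow> submodule (mboundaries M i)"
  unfolding mboundaries_def by (intro submodule_image rlinear_mkoszul submodule_mchains)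

lemma mchains_mono: "M \<subseteq> M' \<Longrightarrow> mchains M i \<subseteq> mchains M' i"
  by (auto simp: mchains_def)

lemma mcycles_mono: "M \<subseteq> M' \<Longrightarrow> mcycles M i \<subseteq> mcycles M' i"
  unfolding mcycles_def using mchains_mono[of M M' i] by blast

lemma mboundaries_mono: "M \<subseteq> M' \<Longrightarrow> mboundaries M i \<subseteq> mboundaries M' i"
  unfolding mboundaries_def by (intro image_mono mchains_mono)

lemma mkoszul_mchains:
  assumes M: "submodule M" and f: "f \<in> mchains M (Suc i)" shows "mkoszul f \<in> mchains M i"
  unfolding mchains_def mem_Collect_eq mkoszul_row mkoszul_col
  using f by (intro conjI allI submodule_sum[OF M] koszul_chains[OF finite_N]) (auto simp: mchains_def)

lemma mboundaries_subset_mcycles: "submodule M \<Longrightarrow> mboundaries M i \<subseteq> mcycles M i"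
  by (auto simp: mboundaries_def mcycles_def mkoszul_mchains mkoszul_mkoszul)

lemma mcycles_0: "mcycles M 0 = mchains M 0"
proof -
  have "mkoszul f = (\<lambda>x. 0)" if "f \<in> mchains M 0" for f
    using that koszul_chains_0[OF finite_N] by (auto simp: mkoszul_def mchains_def fun_eq_iff)
  then show ?thesis by (auto simp: mcycles_def)
qed

lemma fin_dim_mchains:
  assumes M: "submodule M" "M \<subseteq> free_module n"
  shows "fin_dim pointwise_scale (mchains M i)"
proof (rule pw.fin_dim_subset[OF fin_dim_supported[of "Pow N \<times> {..<n}"]])
  show "finite (Pow N \<times> {..<n})" using finite_N by simp
  show "pw.subspace (mchains M i)" by (intro submodule_subspace submodule_mchains M)
  show "mchains M i \<subseteq> {f. \<forall>x. x \<notin> Pow N \<times> {..<n} \<longrightarrow> f x = 0}"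
  proof (intro subsetI CollectI allI impI)
    fix f and x :: "nat set \<times> nat"
    assume f: "f \<in> mchains M i" and "x \<notin> Pow N \<times> {..<n}"
    then obtain A r where x: "x = (A, r)" "(A, r) \<notin> Pow N \<times> {..<n}" by (cases x) auto
    have "(\<lambda>r. f (A, r)) \<in> free_module n" "(\<lambda>A. f (A, r)) \<in> chains N i"
      using f M(2) by (auto simp: mchains_def)
    then show "f x = 0" using x by (auto simp: free_module_def chains_iff not_less)
  qed
qed

lemma fin_dim_sub_mchains:
  assumes "submodule M" "M \<subseteq> free_module n" "submodule V" "V \<subseteq> mchains M i"
  shows "fin_dim pointwise_scale V"
  using assms by (intro pw.fin_dim_subset[OF fin_dim_mchains[OF assms(1,2)]] submodule_subspace)

lemma fin_dim_mcycles:
  "submodule M \<Longrightarrow> M \<subseteq> free_module n \<Longrightarrow> fin_dim pointwise_scale (mcycles M i)"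
  by (rule fin_dim_sub_mchains[of M n _ i]) (simp_all add: submodule_mcycles, simp add: mcycles_def)

lemma fin_dim_mboundaries:
  "submodule M \<Longrightarrow> M \<subseteq> free_module n \<Longrightarrow> fin_dim pointwise_scale (mboundaries M i)"
  using mboundaries_subset_mcycles[of M i]
  by (intro fin_dim_sub_mchains[of M n _ i]) (auto simp: submodule_mboundaries mcycles_def)

section \<open>Comparison of Koszul homology along a short exact sequence\<close>

lemma lift_image_mchains:
  assumes T: "rlinear T" and F: "submodule F"
  shows "lift T ` mchains F i = mchains (T ` F) i"
proof (intro equalityI subsetI)
  fix f assume "f \<in> lift T ` mchains F i"
  then obtain u where u: "f = lift T u" "u \<in> mchains F i" by blast
  have "(\<lambda>A. f (A, r)) \<in> chains N i" for r
    unfolding chains_iff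
  proof (intro allI impI)
    fix A assume "\<not> (A \<subseteq> N \<and> card A = i)"
    then have "(\<lambda>r. u (A, r)) = (\<lambda>r. 0)" using u(2) unfolding mchains_def chains_iff by auto
    then show "f (A, r) = 0" using rlinear_zero[OF T] by (simp add: u(1) lift_def)
  qed
  then show "f \<in> mchains (T ` F) i" using u by (auto simp: mchains_def lift_row)
next
  fix f assume f: "f \<in> mchains (T ` F) i"
  then have "\<forall>A. \<exists>v\<in>F. (\<lambda>r. f (A, r)) = T v" by (auto simp: mchains_def)
  then obtain v where v: "\<And>A. v A \<in> F" "\<And>A. (\<lambda>r. f (A, r)) = T (v A)" by metis
  define u where "u = (\<lambda>(A, r). if A \<subseteq> N \<and> card A = i then v A r else 0)"
  have row: "(\<lambda>r. u (A, r)) = (if A \<subseteq> N \<and> card A = i then v A else (\<lambda>r. 0))" for A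
    by (rule ext) (auto simp: u_def)
  have "u \<in> mchains F i"
    unfolding mchains_def mem_Collect_eq row
    using v(1) submodule_zero[OF F] by (simp add: chains_iff u_def)
  moreover have "lift T u = f"
  proof
    fix x :: "nat set \<times> nat"
    obtain A r where x: "x = (A, r)" by (cases x)
    show "lift T u x = f x"
    proof (cases "A \<subseteq> N \<and> card A = i")
      case True
      then show ?thesis using fun_cong[OF v(2)[of A], of r] by (simp add: x lift_def row)
    next
      case False
      then have "f (A, r) = 0" using f by (auto simp: mchains_def chains_iff)
      moreover have "(\<lambda>r. u (A, r)) = (\<lambda>r. 0)" using False row[of A] by argo
      ultimately show ?thesis by (simp add: x lift_def rlinear_zero[OF T])
    qed
  qed
  ultimately show "f \<in> lift T ` mchains F i" by blast
qed

lemma lift_kernel_mchains: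
  assumes T: "rlinear T"
  shows "{f \<in> mchains F i. lift T f = (\<lambda>x. 0)} = mchains {v \<in> F. T v = (\<lambda>x. 0)} i"
proof -
  have "lift T f = (\<lambda>x. 0) \<longleftrightarrow> (\<forall>A. T (\<lambda>r. f (A, r)) = (\<lambda>x. 0))" for f
    by (auto simp: lift_def fun_eq_iff)
  then show ?thesis by (auto simp: mchains_def)
qed

lemma lift_image_mboundaries:
  assumes T: "rlinear T" and F: "submodule F"
  shows "lift T ` mboundaries F i = mboundaries (T ` F) i"
  unfolding mboundaries_def lift_image_mchains[OF assms, symmetric] image_image lift_mkoszul[OF T] ..

lemma lift_mcycles:
  assumes T: "rlinear T" and F: "submodule F" and f: "f \<in> mcycles F i"
  shows "lift T f \<in> mcycles (T ` F) i"
proof -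
  have "mkoszul (lift T f) = (\<lambda>x. 0)"
    using f rlinear_zero[OF rlinear_lift[OF T]] by (simp add: mcycles_def flip: lift_mkoszul[OF T])
  then show ?thesis using f lift_image_mchains[OF T F] by (auto simp: mcycles_def)
qed

lemma rank_nullity_mcycles:
  assumes T: "rlinear T" and F: "submodule F" "F \<subseteq> free_module n"
  defines "K \<equiv> {v \<in> F. T v = (\<lambda>x. 0)}"
  shows "pw.dim (mcycles F i) = pw.dim (lift T ` mcycles F i) + pw.dim (mcycles K i)"
    "pw.dim (mboundaries F i) = pw.dim (mboundaries (T ` F) i) + pw.dim (mchains K i \<inter> mboundaries F i)"
proof -
  note K = lift_kernel_mchains[OF T, of F i, folded K_def]
  have "{f \<in> mcycles F i. lift T f = (\<lambda>x. 0)} = mcycles K i"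
    using K by (auto simp: mcycles_def)
  then show "pw.dim (mcycles F i) = pw.dim (lift T ` mcycles F i) + pw.dim (mcycles K i)"
    by (rule rlinear_rank_nullity[OF rlinear_lift[OF T] fin_dim_mcycles[OF F] refl])
  have "{f \<in> mboundaries F i. lift T f = (\<lambda>x. 0)} = mchains K i \<inter> mboundaries F i"
    using K mboundaries_subset_mcycles[OF F(1)] by (auto simp: mcycles_def)
  then show "pw.dim (mboundaries F i) = pw.dim (mboundaries (T ` F) i) + pw.dim (mchains K i \<inter> mboundaries F i)"
    by (rule rlinear_rank_nullity[OF rlinear_lift[OF T] fin_dim_mboundaries[OF F] lift_image_mboundaries[OF T F(1)]])
qed

text \<open>The connecting homomorphism of the short exact sequence \<open>0 \<rightarrow> K \<rightarrow> F \<rightarrow> T ` F \<rightarrow> 0\<close> identifies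
  the cokernel of \<open>H\<^sub>i\<^sub>+\<^sub>1(F) \<rightarrow> H\<^sub>i\<^sub>+\<^sub>1(T ` F)\<close> with the kernel of \<open>H\<^sub>i(K) \<rightarrow> H\<^sub>i(F)\<close>.\<close>

lemma connecting_homomorphism:
  assumes T: "rlinear T" and F: "submodule F" "F \<subseteq> free_module n"
  defines "K \<equiv> {v \<in> F. T v = (\<lambda>x. 0)}"
  shows "pw.dim (mcycles (T ` F) (Suc i)) + pw.dim (mboundaries K i) =
    pw.dim (lift T ` mcycles F (Suc i)) + pw.dim (mchains K i \<inter> mboundaries F i)"
proof -
  \<comment> \<open>The chains whose boundary lies in \<open>K\<close>: \<open>T\<close> maps them onto cycles, the differential onto
    the classes of \<open>K\<close> that bound in \<open>F\<close>.\<close>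
  define W where "W = {f \<in> mchains F (Suc i). lift T (mkoszul f) = (\<lambda>x. 0)}"
  have K: "submodule K" "K \<subseteq> free_module n"
    unfolding K_def using F by (auto intro: submodule_kernel T)
  have W: "fin_dim pointwise_scale W" unfolding W_def
    using submodule_kernel[OF rlinear_comp[OF rlinear_lift[OF T] rlinear_mkoszul] submodule_mchains[OF F(1), of "Suc i"]]
    by (rule fin_dim_sub_mchains[OF F]) blast
  have "pw.dim W = pw.dim (mcycles (T ` F) (Suc i)) + pw.dim (mchains K (Suc i))"
  proof (rule rlinear_rank_nullity[OF rlinear_lift[OF T] W])
    show "lift T ` W = mcycles (T ` F) (Suc i)"
      unfolding W_def mcycles_def lift_mkoszul[OF T] lift_image_mchains[OF T F(1), symmetric] by blast
    have "lift T (mkoszul f) = (\<lambda>x. 0)" if "lift T f = (\<lambda>x. 0)" for f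
      unfolding lift_mkoszul[OF T] that by (rule rlinear_zero[OF rlinear_mkoszul])
    then show "{v \<in> W. lift T v = (\<lambda>x. 0)} = mchains K (Suc i)"
      unfolding K_def lift_kernel_mchains[OF T, symmetric] W_def by blast
  qed
  moreover have "pw.dim W = pw.dim (mchains K i \<inter> mboundaries F i) + pw.dim (mcycles F (Suc i))"
  proof (rule rlinear_rank_nullity[OF rlinear_mkoszul W])
    show "mkoszul ` W = mchains K i \<inter> mboundaries F i"
      unfolding W_def K_def mboundaries_def lift_kernel_mchains[OF T, symmetric]
      using mkoszul_mchains[OF F(1)] by blast
    show "{v \<in> W. mkoszul v = (\<lambda>x. 0)} = mcycles F (Suc i)"
      unfolding W_def mcycles_def using rlinear_zero[OF rlinear_lift[OF T]] by auto
  qed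
  moreover have "pw.dim (mchains K (Suc i)) = pw.dim (mboundaries K i) + pw.dim (mcycles K (Suc i))"
    by (rule rlinear_rank_nullity[OF rlinear_mkoszul fin_dim_mchains[OF K]])
      (auto simp: mboundaries_def mcycles_def)
  ultimately show ?thesis
    using rank_nullity_mcycles(1)[OF T F, of "Suc i"] unfolding K_def by simp
qed

section \<open>Coefficients in a free module\<close>

definition columns :: "(nat set \<Rightarrow> 'r) set \<Rightarrow> nat \<Rightarrow> (nat set \<times> nat \<Rightarrow> 'r) set" where
  "columns V n = {f. \<forall>r. (\<lambda>A. f (A, r)) \<in> V \<and> (n \<le> r \<longrightarrow> (\<forall>A. f (A, r) = 0))}"

lemma mchains_free: "mchains (free_module n) i = columns (chains N i) n"
  by (auto simp: mchains_def columns_def free_module_def)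

lemma mcycles_free: "mcycles (free_module n) i = columns (cycles N g i) n"
  unfolding mcycles_def mchains_free by (auto simp: columns_def cycles_def mkoszul_def fun_eq_iff)

lemma mboundaries_free: "mboundaries (free_module n) i = columns (boundaries N g i) n"
proof (intro equalityI subsetI)
  fix f assume "f \<in> mboundaries (free_module n) i"
  then obtain u where u: "f = mkoszul u" "u \<in> columns (chains N (Suc i)) n"
    unfolding mboundaries_def mchains_free by blast
  have "f (A, r) = 0" if "n \<le> r" for A r
  proof -
    have "(\<lambda>A. u (A, r)) = (\<lambda>A. 0)" using u(2) that by (auto simp: columns_def)
    then show ?thesis by (simp add: u(1) mkoszul_def koszul_zero)
  qed
  then show "f \<in> columns (boundaries N g i) n"
    using u by (auto simp: columns_def boundaries_def mkoszul_col)
next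
  fix f assume f: "f \<in> columns (boundaries N g i) n"
  then have "\<forall>r. \<exists>u\<in>chains N (Suc i). (\<lambda>A. f (A, r)) = koszul N g u"
    by (auto simp: columns_def boundaries_def)
  then obtain u where u: "\<And>r. u r \<in> chains N (Suc i)" "\<And>r. (\<lambda>A. f (A, r)) = koszul N g (u r)"
    by metis
  define v where "v = (\<lambda>(A, r). if r < n then u r A else 0)"
  have col: "(\<lambda>A. v (A, r)) = (if r < n then u r else (\<lambda>A. 0))" for r
    by (auto simp: v_def)
  have "mkoszul v (A, r) = f (A, r)" for A r
    using fun_cong[OF u(2)[of r], of A] f by (auto simp: mkoszul_def col koszul_zero columns_def)
  then have "mkoszul v = f" by auto
  moreover have "v \<in> columns (chains N (Suc i)) n"
    using u(1) by (auto simp: columns_def col chains_closed) (simp add: v_def)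
  ultimately show "f \<in> mboundaries (free_module n) i"
    unfolding mboundaries_def mchains_free by blast
qed

lemma dim_columns:
  assumes V: "submodule V" "V \<subseteq> chains N i"
  shows "pw.dim (columns V n) = n * pw.dim V"
proof (induction n)
  case 0
  have "columns V 0 \<subseteq> {0}" by (auto simp: columns_def zero_fun_def)
  then show ?case
    using pw.dim_le_card[of "columns V 0" "{}"] by simp
next
  case (Suc n)
  have sub: "submodule (columns V m)" for m
    using submodule_zero[OF V(1)] submodule_add[OF V(1)] submodule_mult[OF V(1)]
    by (auto simp: submodule_def columns_def)
  have "columns V m \<subseteq> mchains (free_module m) i" for m
    unfolding mchains_free using V(2) by (auto simp: columns_def)
  then have fin: "fin_dim pointwise_scale (columns V (Suc n))"
    by (intro fin_dim_sub_mchains[OF submodule_free order_refl sub])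
  define c :: "(nat set \<times> nat \<Rightarrow> 'r) \<Rightarrow> nat set \<Rightarrow> 'r" where "c f = (\<lambda>A. f (A, n))" for f
  have "pw.dim (columns V (Suc n)) = pw.dim V + pw.dim (columns V n)"
  proof (rule rlinear_rank_nullity[OF _ fin])
    show "rlinear c" by (simp add: rlinear_def c_def)
    show "c ` columns V (Suc n) = V"
    proof (intro equalityI subsetI)
      fix v assume v: "v \<in> V"
      have "(\<lambda>A. if r = n then v A else 0) = (if r = n then v else (\<lambda>A. 0))" for r by simp
      then have "(\<lambda>(A, r). if r = n then v A else 0) \<in> columns V (Suc n)"
        using v submodule_zero[OF V(1)] by (simp add: columns_def)
      then show "v \<in> c ` columns V (Suc n)" by (rule rev_image_eqI) (simp add: c_def)
    qed (auto simp: columns_def c_def)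
    show "{v \<in> columns V (Suc n). c v = (\<lambda>x. 0)} = columns V n"
    proof (intro equalityI subsetI CollectI conjI)
      fix f assume f: "f \<in> {v \<in> columns V (Suc n). c v = (\<lambda>x. 0)}"
      have "f (A, r) = 0" if "n \<le> r" for A r
        using f that by (cases "r = n") (auto simp: columns_def c_def dest: fun_cong[of _ "\<lambda>x. 0" A])
      then show "f \<in> columns V n" using f by (auto simp: columns_def)
    qed (auto simp: columns_def c_def)
  qed
  then show ?case using Suc by simp
qed

lemma dim_mcycles_free: "pw.dim (mcycles (free_module n) i) = n * pw.dim (cycles N g i)"
  unfolding mcycles_free by (rule dim_columns[OF submodule_cycles]) (auto simp: cycles_def)

lemma dim_mboundaries_free: "pw.dim (mboundaries (free_module n) i) = n * pw.dim (boundaries N g i)"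
  unfolding mboundaries_free using boundaries_subset_cycles[OF finite_N]
  by (intro dim_columns[OF submodule_boundaries]) (auto simp: cycles_def)

end

section \<open>The decomposition of the algebra into constants and the irrelevant ideal\<close>

lemma sum_unit_vector:
  fixes s :: nat
  shows "(\<Sum>c<s. x c * (if i = c then 1 else 0)) = (if i < s then x i else (0 :: 'r::comm_ring_1))"
proof -
  have "(\<Sum>c<s. x c * (if i = c then 1 else 0)) = (\<Sum>c<s. if i = c then x c else 0)"
    by (intro sum.cong) auto
  then show ?thesis by simp
qed

context finite_graded_algebra
begin

text \<open>Together with the next lemma this says \<open>R = k \<oplus> \<mm>\<close>.\<close>

lemma irrelevant_decomposition:
  obtains c m where "m \<in> \<mm>" "r = scale c 1 + m"
proof -
  obtain f where f: "\<forall>i. f i \<in> G i" "finite {i. f i \<noteq> 0}" "r = (\<Sum>i | f i \<noteq> 0. f i)"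
    using G_direct_sum[of r] by blast
  let ?A = "insert 0 {i. f i \<noteq> 0}"
  obtain c where c: "f 0 = scale c 1" using f(1) G_0 by blast
  have "r = (\<Sum>i\<in>?A. f i)" unfolding f(3) using f(2) by (intro sum.mono_neutral_left) auto
  also have "\<dots> = f 0 + (\<Sum>i\<in>?A - {0}. f i)" using f(2) by (subst sum.remove[of _ 0]) auto
  finally have "r = scale c 1 + (\<Sum>i\<in>?A - {0}. f i)" using c by simp
  moreover have "(\<Sum>i\<in>?A - {0}. f i) \<in> \<mm>"
    unfolding irrelevant_ideal_def using f(1) by (intro sc.span_sum sc.span_base) auto
  ultimately show ?thesis using that by blast
qed

lemma one_notin_irrelevant: "1 \<notin> \<mm>"
proof
  define P where "P = {\<Sum>i\<in>A. f i | A f. finite A \<and> 0 \<notin> A \<and> (\<forall>i. f i \<in> G i)}"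
  have G0: "0 \<in> G i" for i using G_subspace sc.subspace_0 by blast
  have "\<mm> \<subseteq> P"
    unfolding irrelevant_ideal_def
  proof (rule sc.span_minimal)
    show "(\<Union>i\<in>{1..}. G i) \<subseteq> P"
    proof clarify
      fix i x assume i: "1 \<le> i" "x \<in> G i"
      have "x = (\<Sum>j\<in>{i}. if j = i then x else 0)" by simp
      moreover have "\<forall>j. (if j = i then x else 0) \<in> G j" using i G0 by simp
      ultimately show "x \<in> P" using i unfolding P_def mem_Collect_eq
        by (intro exI[of _ "{i}"] exI[of _ "\<lambda>j. if j = i then x else 0"]) simp
    qed
    show "sc.subspace P"
    proof (rule sc.subspaceI)
      show "0 \<in> P" unfolding P_def using G0 by (auto intro!: exI[of _ "{}"] exI[of _ "\<lambda>_. 0"])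
    next
      fix x y assume "x \<in> P" "y \<in> P"
      then obtain A f B h where *: "finite A" "0 \<notin> A" "\<forall>i. f i \<in> G i" "x = sum f A"
        "finite B" "0 \<notin> B" "\<forall>i. h i \<in> G i" "y = sum h B" unfolding P_def by blast
      let ?k = "\<lambda>i. (if i \<in> A then f i else 0) + (if i \<in> B then h i else 0)"
      have "x = (\<Sum>i\<in>A \<union> B. if i \<in> A then f i else 0)" "y = (\<Sum>i\<in>A \<union> B. if i \<in> B then h i else 0)"
        using * by (simp_all add: sum.If_cases Int_absorb1 Int_absorb2)
      then have "x + y = sum ?k (A \<union> B)" by (simp add: sum.distrib)
      moreover have "\<forall>i. ?k i \<in> G i"
        using * G0 sc.subspace_add[OF G_subspace] by auto
      ultimately show "x + y \<in> P" unfolding P_def mem_Collect_eq using *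
        by (intro exI[of _ "A \<union> B"] exI[of _ ?k]) blast
    next
      fix c x assume "x \<in> P"
      then obtain A f where *: "finite A" "0 \<notin> A" "\<forall>i. f i \<in> G i" "x = sum f A"
        unfolding P_def by blast
      then have "scale c x = (\<Sum>i\<in>A. scale c (f i))" by (simp add: sc.scale_sum_right)
      then show "scale c x \<in> P" unfolding P_def mem_Collect_eq using * sc.subspace_scale[OF G_subspace]
        by (intro exI[of _ A] exI[of _ "\<lambda>i. scale c (f i)"]) blast
    qed
  qed
  moreover assume "1 \<in> \<mm>"
  ultimately obtain A f where *: "finite A" "0 \<notin> A" "\<forall>i. f i \<in> G i" "1 = sum f A"
    unfolding P_def by blast
  define f1 where "f1 i = (if i \<in> A then f i else 0)" for i
  define f2 where "f2 i = (if i = (0::nat) then 1 else 0 :: 'r)" for i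
  have "1 = sum f1 A" using * by (simp add: f1_def)
  also have "\<dots> = (\<Sum>i | f1 i \<noteq> 0. f1 i)"
    using * by (intro sum.mono_neutral_right) (auto simp: f1_def)
  finally have "1 = (\<Sum>i | f1 i \<noteq> 0. f1 i)" .
  moreover have "\<forall>i. f1 i \<in> G i" using * G0 by (simp add: f1_def)
  moreover have "finite {i. f1 i \<noteq> 0}" using * by (auto simp: f1_def intro: finite_subset[of _ A])
  moreover have "{i. f2 i \<noteq> 0} = {0}" by (auto simp: f2_def)
  moreover have "1 \<in> G 0" unfolding G_0 by (rule range_eqI[of _ _ 1]) simp
  moreover from this have "\<forall>i. f2 i \<in> G i" using G0 by (simp add: f2_def)
  moreover have "1 = (\<Sum>i | f2 i \<noteq> 0. f2 i)" unfolding \<open>{i. f2 i \<noteq> 0} = {0}\<close> by (simp add: f2_def)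
  moreover have "finite {i. f2 i \<noteq> 0}" unfolding \<open>{i. f2 i \<noteq> 0} = {0}\<close> by simp
  ultimately have "f1 = f2" using G_direct_sum[of 1] by (metis (no_types, lifting))
  then have "f1 0 = f2 0" by simp
  then show False using *(2) by (simp add: f1_def f2_def)
qed

lemma rlinear_differential: "rlinear (differential b D i)"
  by (auto simp: rlinear_def differential_def fun_eq_iff distrib_left sum.distrib sum_distrib_left
      mult.left_commute)

lemma differential_free: "differential b D i v \<in> free_module (b (i - 1))"
  by (simp add: differential_def free_module_def)

lemma fin_dim_free: "fin_dim pointwise_scale (free_module n)"
  using fin_dim_supported[of "{..<n}"] by (simp add: free_module_def not_less)

end

context koszul_algebra
begin

lemma irrelevant_closed:
  "0 \<in> \<mm>" "a \<in> \<mm> \<Longrightarrow> a' \<in> \<mm> \<Longrightarrow> a + a' \<in> \<mm>" "a \<in> \<mm> \<Longrightarrow> a' \<in> \<mm> \<Longrightarrow> a - a' \<in> \<mm>" "a \<in> \<mm> \<Longrightarrow> r * a \<in> \<mm>"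
  unfolding generators[symmetric] ideal_gen_def
  by (auto intro: ideal.span_zero ideal.span_add ideal.span_diff ideal.span_scale)

lemma irrelevant_sum: "(\<And>i. i \<in> A \<Longrightarrow> f i \<in> \<mm>) \<Longrightarrow> sum f A \<in> \<mm>"
  unfolding generators[symmetric] ideal_gen_def by (rule ideal.span_sum)

lemma generator_irrelevant: "j \<in> N \<Longrightarrow> g j \<in> \<mm>"
  unfolding generators[symmetric] ideal_gen_def by (intro ideal.span_base) auto

lemma submodule_irrelevant: "submodule (irrelevant_submodule n)"
  using irrelevant_closed by (auto simp: submodule_def irrelevant_submodule_def free_module_def)

lemma irrelevant_subset_free: "irrelevant_submodule n \<subseteq> free_module n"
  by (auto simp: irrelevant_submodule_def)

lemma irrelevant_mult_boundary:
  "a \<in> \<mm> \<Longrightarrow> f \<in> cycles N g i \<Longrightarrow> (\<lambda>A. a * f A) \<in> boundaries N g i"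
  using ideal_mult_cycle_boundary[OF finite_N] generators by blast

lemma chains_0_eq: "(f :: nat set \<Rightarrow> 'r) \<in> chains N 0 \<Longrightarrow> f = (\<lambda>A. f {} * (if A = {} then 1 else 0))"
proof
  fix A assume f: "f \<in> chains N 0"
  have "f A = 0" if "A \<noteq> {}"
  proof (rule ccontr)
    assume "f A \<noteq> 0"
    then have "A \<subseteq> N" "card A = 0" using f by (auto simp: chains_def)
    then show False using that finite_N finite_subset[of A N] by simp
  qed
  then show "f A = f {} * (if A = {} then 1 else 0)" by simp
qed

lemma unit_chain: "(\<lambda>A. if A = {} then 1 else 0) \<in> chains N 0"
  by (simp add: chains_def)

lemma boundaries_0: "boundaries N g 0 = {f \<in> chains N 0. f {} \<in> \<mm>}"
proof (intro equalityI subsetI)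
  fix f assume "f \<in> boundaries N g 0"
  then obtain u where u: "u \<in> chains N (Suc 0)" "f = koszul N g u" by (auto simp: boundaries_def)
  have "koszul N g u {} \<in> \<mm>"
    unfolding koszul_def
  proof (rule irrelevant_sum)
    fix j assume "j \<in> N - {}"
    then have "(sign {} j * u (insert j {})) * g j \<in> \<mm>"
      by (intro irrelevant_closed(4) generator_irrelevant) simp
    then show "sign {} j * g j * u (insert j {}) \<in> \<mm>" by (simp add: mult_ac)
  qed
  then show "f \<in> {f \<in> chains N 0. f {} \<in> \<mm>}" using u koszul_chains[OF finite_N u(1)] by simp
next
  fix f assume f: "f \<in> {f \<in> chains N 0. f {} \<in> \<mm>}"
  have "(\<lambda>A. f {} * (if A = {} then 1 else 0)) \<in> boundaries N g 0"
    using f unit_chain cycles_0[OF finite_N, of g] by (intro irrelevant_mult_boundary) auto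
  then show "f \<in> boundaries N g 0" using f chains_0_eq[of f] by simp
qed

lemma homology_dim_0: "homology_dim N g 0 = 1"
proof -
  let ?e = "(\<lambda>A. if A = {} then 1 else 0) :: nat set \<Rightarrow> 'r"
  have B: "pw.subspace (boundaries N g 0)" by (rule subspace_boundaries)
  have "basis_modulo pointwise_scale (chains N 0) (boundaries N g 0) {?e}"
    unfolding basis_modulo_def
  proof (intro conjI subsetI ballI)
    fix f :: "nat set \<Rightarrow> 'r" assume f: "f \<in> chains N 0"
    obtain c m where cm: "m \<in> \<mm>" "f {} = scale c 1 + m" using irrelevant_decomposition by blast
    have "f = pointwise_scale c ?e + (\<lambda>A. m * ?e A)"
      by (subst chains_0_eq[OF f]) (auto simp: fun_eq_iff cm(2) pointwise_scale_def)
    moreover have "(\<lambda>A. m * ?e A) \<in> boundaries N g 0"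
      using cm(1) by (simp add: boundaries_0 chains_def)
    ultimately show "f \<in> pw.span ({?e} \<union> boundaries N g 0)"
      by (auto intro!: pw.span_add pw.span_scale intro: pw.span_base)
  next
    fix t assume "t \<in> {?e}"
    then have t: "pw.span ({?e} - {t} \<union> boundaries N g 0) = boundaries N g 0" "t = ?e"
      using pw.span_eq_iff[THEN iffD2, OF B] by simp_all
    show "t \<notin> pw.span ({?e} - {t} \<union> boundaries N g 0)"
      unfolding t(1) unfolding t(2) using one_notin_irrelevant by (simp add: boundaries_0)
  qed (use unit_chain in auto)
  moreover have "boundaries N g 0 \<subseteq> chains N 0" by (auto simp: boundaries_0)
  ultimately have "card {?e} + pw.dim (boundaries N g 0) = pw.dim (chains N 0 :: (nat set \<Rightarrow> 'r) set)"
    using fin_dim_chains[OF finite_N] B by (intro pw.basis_modulo_card(2))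
  then show ?thesis by (simp add: homology_dim_def cycles_0[OF finite_N])
qed

section \<open>Koszul homology in degree zero\<close>

text \<open>The isomorphism of \<open>M\<close> with \<open>K\<^sub>0 \<otimes> M\<close>. It translates statements about \<open>\<mm>M\<close> and ranks modulo \<open>\<mm>\<close>
  into statements about boundaries, so that degree zero need not be treated apart.\<close>

definition embed :: "(nat \<Rightarrow> 'r) \<Rightarrow> nat set \<times> nat \<Rightarrow> 'r" where
  "embed v = (\<lambda>(A, r). if A = {} then v r else 0)"

lemma rlinear_embed: "rlinear embed"
  by (auto simp: rlinear_def embed_def fun_eq_iff)

lemma embed_inj: "inj embed"
proof (rule injI)
  fix v w assume "embed v = embed w"
  then have "embed v ({}, r) = embed w ({}, r)" for r by simp
  then show "v = w" by (simp add: embed_def fun_eq_iff)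
qed

lemma embed_row: "(\<lambda>r. embed v (A, r)) = (if A = {} then v else (\<lambda>r. 0))"
  by (auto simp: embed_def)

lemma lift_embed: "rlinear T \<Longrightarrow> lift T (embed v) = embed (T v)"
  using rlinear_zero[of T] by (auto simp: lift_def embed_row) (auto simp: embed_def)

lemma embed_mchains:
  assumes M: "submodule M" shows "embed ` M = mchains M 0"
proof (intro equalityI subsetI)
  fix f assume "f \<in> embed ` M"
  then obtain v where v: "v \<in> M" "f = embed v" by blast
  show "f \<in> mchains M 0" unfolding mchains_def mem_Collect_eq v(2) embed_row
    using v(1) submodule_zero[OF M] by (simp add: chains_def embed_def)
next
  fix f assume f: "f \<in> mchains M 0"
  have "f x = embed (\<lambda>r. f ({}, r)) x" for x
    using fun_cong[OF chains_0_eq[of "\<lambda>A. f (A, snd x)"], of "fst x"] f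
    by (cases x) (simp add: mchains_def embed_def)
  then have "f = embed (\<lambda>r. f ({}, r))" by (rule ext)
  moreover have "(\<lambda>r. f ({}, r)) \<in> M" using f by (simp add: mchains_def)
  ultimately show "f \<in> embed ` M" by blast
qed

lemma embed_irrelevant: "embed ` irrelevant_submodule n = mboundaries (free_module n) 0"
proof -
  have "embed ` irrelevant_submodule n = {f \<in> mchains (free_module n) 0. \<forall>r. f ({}, r) \<in> \<mm>}"
    unfolding embed_mchains[OF submodule_free, symmetric] irrelevant_submodule_def
    by (auto simp: embed_def)
  also have "\<dots> = mboundaries (free_module n) 0"
    unfolding mchains_free mboundaries_free by (auto simp: columns_def boundaries_0)
  finally show ?thesis .
qed

lemma dim_embed:
  assumes "submodule V" "V \<subseteq> free_module n" shows "pw.dim (embed ` V) = pw.dim V"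
proof (rule pp.dim_image_inj[OF rlinear_linear[OF rlinear_embed]])
  show "fin_dim pointwise_scale V"
    by (rule pw.fin_dim_subset[OF fin_dim_free submodule_subspace[OF assms(1)] assms(2)])
  show "v = 0" if "embed v = 0" for v
  proof -
    have "embed v = embed (\<lambda>x. 0)" using that unfolding rlinear_zero[OF rlinear_embed] by (simp add: zero_fun_def)
    then show ?thesis using injD[OF embed_inj] by (simp add: zero_fun_def)
  qed
qed

lemma dim_degree_0:
  assumes M: "submodule M" "M \<subseteq> free_module n"
  shows "pw.dim (mchains M 0) = pw.dim M"
    "pw.dim (mchains M 0 \<inter> mboundaries (free_module n) 0) = pw.dim (M \<inter> irrelevant_submodule n)"
proof -
  show "pw.dim (mchains M 0) = pw.dim M" using dim_embed[OF M] embed_mchains[OF M(1)] by simp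
  have "mchains M 0 \<inter> mboundaries (free_module n) 0 = embed ` (M \<inter> irrelevant_submodule n)"
    using embed_mchains[OF M(1)] embed_irrelevant image_Int[OF embed_inj] by simp
  then show "pw.dim (mchains M 0 \<inter> mboundaries (free_module n) 0) = pw.dim (M \<inter> irrelevant_submodule n)"
    using dim_embed[of "M \<inter> irrelevant_submodule n" n] M(2)
    by (simp add: submodule_Int M(1) submodule_irrelevant le_infI1)
qed

section \<open>The rank of a map modulo the irrelevant ideal\<close>

text \<open>A linear map between free modules that has rank \<open>s\<close> modulo \<open>\<mm>\<close> is, up to \<open>\<mm>\<close>,
  invertible on a free direct summand of rank \<open>s\<close>.\<close>

lemma split_rank:
  assumes T: "rlinear T" and TF: "T ` free_module n \<subseteq> free_module n'"
  obtains s V L where "s + pw.dim (T ` free_module n \<inter> irrelevant_submodule n') = pw.dim (T ` free_module n)"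
    "rlinear V" "V ` free_module s \<subseteq> free_module n" "rlinear L" "L ` free_module n' \<subseteq> free_module s"
    "\<And>x i. x \<in> free_module s \<Longrightarrow> L (T (V x)) i - x i \<in> \<mm>"
proof -
  let ?M = "T ` free_module n" and ?I = "irrelevant_submodule n'"
  have M: "submodule ?M" by (intro submodule_image T submodule_free)
  have finM: "fin_dim pointwise_scale ?M" and finI: "fin_dim pointwise_scale ?I"
    by (auto intro!: pw.fin_dim_subset[OF fin_dim_free[of n']] submodule_subspace M submodule_irrelevant TF
        irrelevant_subset_free)
  have MI: "pw.subspace (?M \<inter> ?I)" by (intro submodule_subspace submodule_Int M submodule_irrelevant)
  obtain S where S: "basis_modulo pointwise_scale ?M (?M \<inter> ?I) S"
    using pw.basis_modulo_exists[OF finM MI] by blast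
  note card = pw.basis_modulo_card[OF finM MI Int_lower1 S]
  have SM: "S \<subseteq> ?M" using S by (simp add: basis_modulo_def)
  obtain C where C: "finite C" "C \<subseteq> ?I" "pw.independent C" "pw.span C = ?I"
    using pw.fin_dim_basis[OF finI] by metis
  have "t \<notin> pw.span ((S - {t}) \<union> ?I)" if t: "t \<in> S" for t
  proof
    assume "t \<in> pw.span ((S - {t}) \<union> ?I)"
    then obtain y c where yc: "t = y + c" "y \<in> pw.span (S - {t})" "c \<in> ?I"
      unfolding pw.span_Un using pw.span_eq_iff[THEN iffD2, OF submodule_subspace[OF submodule_irrelevant]] by auto
    have "pw.span (S - {t}) \<subseteq> ?M" using SM by (intro pw.span_minimal submodule_subspace M) auto
    then have "c \<in> ?M" using yc SM t pw.subspace_diff[OF submodule_subspace[OF M], of t y] by auto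
    then have "t \<in> pw.span ((S - {t}) \<union> (?M \<inter> ?I))"
      unfolding yc(1) using yc(2,3) pw.span_mono[of "S - {t}" "(S - {t}) \<union> (?M \<inter> ?I)"]
      by (intro pw.span_add) (auto simp: yc(1)[symmetric] intro: pw.span_base)
    then show False using S t by (auto simp: basis_modulo_def)
  qed
  note SC = pw.independent_Un_modulo[OF card(1) this C(3,4)]
  define s where "s = card S"
  obtain w where w: "bij_betw w {..<s} S"
    using ex_bij_betw_nat_finite[OF card(1)] unfolding s_def atLeast0LessThan by blast
  then have wS: "w i \<in> S" if "i < s" for i using that by (auto simp: bij_betw_def)
  have "\<exists>v. v \<in> free_module n \<and> T v = w i" if "i < s" for i
  proof -
    have "w i \<in> T ` free_module n" using subsetD[OF SM wS[OF that]] .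
    then show ?thesis by (elim imageE) auto
  qed
  then obtain v where v: "\<And>i. i < s \<Longrightarrow> v i \<in> free_module n" "\<And>i. i < s \<Longrightarrow> T (v i) = w i" by metis
  interpret pk: vector_space_pair "pointwise_scale :: 'k \<Rightarrow> (nat \<Rightarrow> 'r) \<Rightarrow> _" "(*) :: 'k \<Rightarrow> 'k \<Rightarrow> 'k"
    by unfold_locales (auto simp: algebra_simps)
  have "\<exists>\<phi>. Vector_Spaces.linear pointwise_scale (*) \<phi> \<and> (\<forall>x\<in>S \<union> C. \<phi> x = (if x = w i then 1 else 0 :: 'k))" for i
    by (rule pk.linear_independent_extend[OF SC(1)])
  then obtain \<phi> :: "nat \<Rightarrow> (nat \<Rightarrow> 'r) \<Rightarrow> 'k" where lin: "\<And>i. Vector_Spaces.linear pointwise_scale (*) (\<phi> i)"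
    and \<phi>: "\<And>i x. x \<in> S \<union> C \<Longrightarrow> \<phi> i x = (if x = w i then 1 else 0)" by metis
  have \<phi>w: "\<phi> i (w l) = (if i = l then 1 else 0)" if "i < s" "l < s" for i l
    using \<phi>[of "w l" i] wS[OF that(2)] w that by (auto simp: bij_betw_def inj_on_def)
  have \<phi>I: "\<phi> i x = 0" if "i < s" "x \<in> ?I" for i x
  proof -
    interpret l: Vector_Spaces.linear pointwise_scale "(*)" "\<phi> i" by (rule lin)
    have "\<phi> i c = 0" if "c \<in> C" for c
      using \<phi>[of c i] that SC(2) wS[OF \<open>i < s\<close>] by auto
    then show ?thesis using l.eq_0_on_span[of C x] that C(4) by blast
  qed
  define e :: "nat \<Rightarrow> nat \<Rightarrow> 'r" where "e r = (\<lambda>x. if x = r then 1 else 0)" for r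
  define V where "V x = (\<lambda>r. \<Sum>l<s. x l * v l r)" for x
  define L where "L u = (\<lambda>i. if i < s then \<Sum>r<n'. scale (\<phi> i (e r)) (u r) else 0)" for u
  \<comment> \<open>\<open>\<phi> i\<close> vanishes on \<open>\<mm>R\<^sup>n\<close>, so it is determined by the constant terms of the coordinates.\<close>
  have Lw: "L u i - scale (\<phi> i u) 1 \<in> \<mm>" if u: "u \<in> free_module n'" and i: "i < s" for u i
  proof -
    interpret l: Vector_Spaces.linear pointwise_scale "(*)" "\<phi> i" by (rule lin)
    have "\<forall>r. \<exists>c m. m \<in> \<mm> \<and> u r = scale c 1 + m" using irrelevant_decomposition by metis
    then obtain c m where cm: "\<And>r. m r \<in> \<mm>" "\<And>r. u r = scale (c r) 1 + m r" by metis
    define u' where "u' = (\<Sum>r<n'. pointwise_scale (c r) (e r))"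
    have u': "u' x = (if x < n' then scale (c x) 1 else 0)" for x
    proof -
      have "u' x = (\<Sum>r<n'. pointwise_scale (c r) (e r) x)"
        unfolding u'_def by (induction n') auto
      also have "\<dots> = (\<Sum>r<n'. if x = r then scale (c r) 1 else 0)"
        by (intro sum.cong) (auto simp: pointwise_scale_def e_def)
      finally show ?thesis by simp
    qed
    have "u - u' \<in> ?I"
      unfolding irrelevant_submodule_def free_module_def using u cm irrelevant_closed(1)
      by (auto simp: u' free_module_def)
    then have "\<phi> i u = \<phi> i u'" using \<phi>I[OF i, of "u - u'"] l.diff[of u u'] by simp
    also have "\<dots> = (\<Sum>r<n'. c r * \<phi> i (e r))" unfolding u'_def by (simp add: l.sum l.scale)
    finally have "scale (\<phi> i u) 1 = (\<Sum>r<n'. scale (\<phi> i (e r)) (scale (c r) 1))"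
      by (simp add: sc.scale_sum_left mult.commute)
    then have "L u i - scale (\<phi> i u) 1 = (\<Sum>r<n'. scale (\<phi> i (e r)) 1 * m r)"
      using i by (simp add: L_def cm(2) sc.scale_right_distrib sum.distrib scale_eq_mult[of _ "m _"])
    also have "\<dots> \<in> \<mm>" by (intro irrelevant_sum irrelevant_closed(4) cm)
    finally show ?thesis .
  qed
  have rV: "rlinear V"
    by (auto simp: rlinear_def V_def fun_eq_iff sum.distrib sum_distrib_left algebra_simps)
  have rL: "rlinear L"
    by (auto simp: rlinear_def L_def fun_eq_iff sc.scale_right_distrib sum.distrib sum_distrib_left
        scale_mult_right)
  have "L (T (V x)) i - x i \<in> \<mm>" if x: "x \<in> free_module s" for x i
  proof (cases "i < s")
    case True
    have "T (V x) = (\<lambda>r. \<Sum>l<s. x l * w l r)"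
      unfolding V_def using rlinear_sum[OF T, of x v "{..<s}"] v(2) by simp
    then have "L (T (V x)) i = (\<Sum>l<s. x l * L (w l) i)"
      using rlinear_sum[OF rL, of x w "{..<s}"] by simp
    moreover have "x i = (\<Sum>l<s. x l * (if i = l then 1 else 0))" using True by (simp add: sum_unit_vector)
    ultimately have "L (T (V x)) i - x i = (\<Sum>l<s. x l * (L (w l) i - (if i = l then 1 else 0)))"
      by (simp only: sum_subtractf right_diff_distrib)
    also have "\<dots> \<in> \<mm>"
    proof (intro irrelevant_sum irrelevant_closed(4))
      fix l assume "l \<in> {..<s}"
      then have l: "l < s" by simp
      then have "w l \<in> free_module n'" using wS SM TF by blast
      from Lw[OF this True] show "L (w l) i - (if i = l then 1 else 0) \<in> \<mm>"
        using \<phi>w[OF True l] by (auto split: if_splits)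
    qed
    finally show ?thesis .
  next
    case False
    then show ?thesis using x irrelevant_closed(1) by (simp add: L_def free_module_def)
  qed
  moreover have "V ` free_module s \<subseteq> free_module n"
    using v(1) by (auto simp: V_def free_module_def)
  moreover have "L ` free_module n' \<subseteq> free_module s"
    by (auto simp: L_def free_module_def)
  ultimately show ?thesis using that[of s V L] card(2) rV rL by (simp add: s_def)
qed

text \<open>The difference in parentheses is the rank \<open>s\<close> of \<open>T\<close> modulo \<open>\<mm>\<close>, and the claim is that the map
  from \<open>H\<^sub>p(R\<^sup>n)\<close> to the homology of the target has rank at least \<open>s \<cdot> h\<^sub>p\<close>. On a free summand \<open>R\<^sup>s\<close>
  of \<open>R\<^sup>n\<close> the map has a left inverse modulo \<open>\<mm>\<close>; as \<open>\<mm>\<close> annihilates homology, it is injective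
  on \<open>H\<^sub>p(R\<^sup>s)\<close>.\<close>

lemma rank_homology_map:
  fixes n n' p :: nat
  assumes T: "rlinear T" and TF: "T ` free_module n \<subseteq> free_module n'"
  defines "M \<equiv> T ` free_module n" and "A \<equiv> lift T ` mcycles (free_module n) p"
  shows "homology_dim N g p * (pw.dim (mchains M 0) - pw.dim (mchains M 0 \<inter> mboundaries (free_module n') 0))
    + pw.dim (A \<inter> mboundaries (free_module n') p) \<le> pw.dim A"
proof -
  let ?B = "mboundaries (free_module n') p"
  obtain s V L where s: "s + pw.dim (M \<inter> irrelevant_submodule n') = pw.dim M"
    and V: "rlinear V" "V ` free_module s \<subseteq> free_module n"
    and L: "rlinear L" "L ` free_module n' \<subseteq> free_module s"
    and LV: "\<And>x i. x \<in> free_module s \<Longrightarrow> L (T (V x)) i - x i \<in> \<mm>"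
    using split_rank[OF T TF] unfolding M_def by metis
  define E where "E = (\<lambda>x. T (V x))"
  have rE: "rlinear E" unfolding E_def by (rule rlinear_comp[OF T V(1)])
  have liftE: "lift E f = lift T (lift V f)" for f
    by (auto simp: E_def lift_def)
  define Y where "Y = lift E ` mcycles (free_module s) p"
  define K where "K = {z \<in> mcycles (free_module s) p. lift E z = (\<lambda>x. 0)}"
  define W where "W = {z \<in> mcycles (free_module s) p. lift E z \<in> ?B}"
  have M: "submodule M" "M \<subseteq> free_module n'"
    unfolding M_def by (intro submodule_image T submodule_free) (rule TF)
  have finZ: "fin_dim pointwise_scale (mcycles (free_module s) p)"
    by (rule fin_dim_mcycles[OF submodule_free order_refl])
  have B: "submodule ?B" by (intro submodule_mboundaries submodule_free)
  have subW: "submodule W" unfolding W_def submodule_def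
    using submodule_mcycles[OF submodule_free, of s p] B rlinear_zero[OF rlinear_lift[OF rE]]
    by (auto simp: submodule_def rlinear_add[OF rlinear_lift[OF rE]] rlinear_mult[OF rlinear_lift[OF rE]])
  have finW: "fin_dim pointwise_scale W"
    by (rule pw.fin_dim_subset[OF finZ submodule_subspace[OF subW]]) (auto simp: W_def)
  have dimY: "pw.dim (mcycles (free_module s) p) = pw.dim Y + pw.dim K"
    by (rule rlinear_rank_nullity[OF rlinear_lift[OF rE] finZ]) (auto simp: Y_def K_def)
  have dimW: "pw.dim W = pw.dim (Y \<inter> ?B) + pw.dim K"
    using submodule_zero[OF B]
    by (intro rlinear_rank_nullity[OF rlinear_lift[OF rE] finW]) (auto simp: Y_def K_def W_def)
  have "W \<subseteq> mboundaries (free_module s) p"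
  proof
    fix z assume z: "z \<in> W"
    then have zc: "(\<lambda>A. z (A, r)) \<in> cycles N g p" "s \<le> r \<Longrightarrow> z (A, r) = 0" for A r
      by (auto simp: W_def mcycles_free columns_def)
    then have row: "(\<lambda>r. z (A, r)) \<in> free_module s" for A by (simp add: free_module_def)
    \<comment> \<open>\<open>z = L E z - P z\<close>: \<open>L E z\<close> is a boundary as \<open>E z\<close> is one, and the entries of \<open>P\<close> lie in \<open>\<mm>\<close>.\<close>
    define P where "P x = (\<lambda>i. L (E x) i - x i)" for x
    have rP: "rlinear P"
      unfolding P_def using rlinear_comp[OF L(1) rE] by (auto simp: rlinear_def fun_eq_iff algebra_simps)
    define e :: "nat \<Rightarrow> nat \<Rightarrow> 'r" where "e c = (\<lambda>x. if x = c then 1 else 0)" for c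
    have P: "P x r = (\<Sum>c<s. x c * P (e c) r)" if "x \<in> free_module s" for x r
    proof -
      have "x = (\<lambda>r. \<Sum>c<s. x c * e c r)"
        using that by (auto simp: e_def free_module_def fun_eq_iff sum_unit_vector)
      then show ?thesis using fun_cong[OF rlinear_sum[OF rP, of x e "{..<s}"], of r] by simp
    qed
    have "(\<lambda>A. z (A, r)) \<in> boundaries N g p" for r
    proof -
      have "P (e c) r \<in> \<mm>" if "c < s" for c
        using LV[of "e c" r] that unfolding P_def E_def by (simp add: e_def free_module_def)
      then have "(\<lambda>A. \<Sum>c<s. 1 * (P (e c) r * z (A, c))) \<in> boundaries N g p"
        by (intro submodule_sum[OF submodule_boundaries] irrelevant_mult_boundary zc) auto
      then have 1: "(\<lambda>A. P (\<lambda>r. z (A, r)) r) \<in> boundaries N g p"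
        by (simp add: P[OF row] mult.commute)
      have "lift E z \<in> ?B" using z by (simp add: W_def)
      then have "lift L (lift E z) \<in> mboundaries (free_module s) p"
        using lift_image_mboundaries[OF L(1) submodule_free] mboundaries_mono[OF L(2)] by blast
      then have 2: "(\<lambda>A. L (E (\<lambda>r. z (A, r))) r) \<in> boundaries N g p"
        by (simp add: mboundaries_free columns_def lift_def)
      show ?thesis using submodule_diff[OF submodule_boundaries 2 1] by (simp add: P_def)
    qed
    then show "z \<in> mboundaries (free_module s) p"
      using zc(2) by (simp add: mboundaries_free columns_def)
  qed
  then have "pw.dim W \<le> s * pw.dim (boundaries N g p)"
    using pw.dim_mono_fin[OF fin_dim_mboundaries[OF submodule_free order_refl]]
    by (simp flip: dim_mboundaries_free)
  moreover have "pw.dim (mcycles (free_module s) p) = s * homology_dim N g p + s * pw.dim (boundaries N g p)"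
    unfolding dim_mcycles_free homology_dim_add[OF finite_N, of g p, symmetric] by (rule distrib_left)
  moreover have "pw.dim Y + pw.dim (A \<inter> ?B) \<le> pw.dim A + pw.dim (Y \<inter> ?B)"
  proof (rule pw.codim_mono)
    have A: "submodule A" unfolding A_def by (intro submodule_image rlinear_lift T submodule_mcycles submodule_free)
    moreover have "A \<subseteq> mchains M p"
      using lift_mcycles[OF T submodule_free] by (auto simp: A_def M_def mcycles_def)
    ultimately show "fin_dim pointwise_scale A" by (rule fin_dim_sub_mchains[OF M])
    show "pw.subspace Y" unfolding Y_def
      by (intro submodule_subspace submodule_image rlinear_lift rE submodule_mcycles submodule_free)
    show "Y \<subseteq> A"
      unfolding Y_def A_def liftE using lift_mcycles[OF V(1) submodule_free] mcycles_mono[OF V(2)] by blast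
    show "pw.subspace ?B" by (rule submodule_subspace[OF B])
  qed
  moreover have "pw.dim (mchains M 0) - pw.dim (mchains M 0 \<inter> mboundaries (free_module n') 0) = s"
    unfolding dim_degree_0[OF M] using s by simp
  ultimately show ?thesis using dimY dimW by (simp add: mult.commute)
qed

end

context koszul_algebra
begin

section \<open>Syzygies, Tor and an upper bound for a Betti number\<close>

definition syzygies :: "(nat \<Rightarrow> nat) \<Rightarrow> (nat \<Rightarrow> nat \<Rightarrow> nat \<Rightarrow> 'r) \<Rightarrow> nat \<Rightarrow> (nat \<Rightarrow> 'r) set" where
  "syzygies b D i = differential b D i ` free_module (b i)"

lemma syzygies_submodule: "submodule (syzygies b D i)" "syzygies b D i \<subseteq> free_module (b (i - 1))"
  unfolding syzygies_def
  by (intro submodule_image rlinear_differential submodule_free) (intro image_subsetI differential_free)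

lemma syzygies_Suc:
  "free_resolution b D \<Longrightarrow> 1 \<le> i \<Longrightarrow>
    syzygies b D (Suc i) = {v \<in> free_module (b i). differential b D i v = (\<lambda>x. 0)}"
  by (simp add: free_resolution_def syzygies_def zero_fun_def)

lemma syzygies_1: "free_resolution b D \<Longrightarrow> syzygies b D 1 = irrelevant_submodule 1"
  by (simp add: free_resolution_def syzygies_def)

lemma tensor_homology_dim_0:
  assumes res: "free_resolution b D"
  shows "tensor_homology_dim b D 0 = 1"
proof -
  have b0: "b 0 = 1" using res by (simp add: free_resolution_def)
  have irr: "pw.subspace (irrelevant_submodule n)" for n
    by (intro submodule_subspace submodule_irrelevant)
  have Z: "{v \<in> free_module (b 0). \<forall>r. differential b D 0 v r \<in> \<mm>} = free_module 1"
    using irrelevant_closed(1) by (auto simp: differential_def b0)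
  have img: "differential b D (Suc 0) ` free_module (b (Suc 0)) = irrelevant_submodule 1"
    using syzygies_1[OF res] by (simp add: syzygies_def)
  have B: "{differential b D (Suc 0) u + w | u w. u \<in> free_module (b (Suc 0)) \<and> w \<in> irrelevant_submodule (b 0)} =
      irrelevant_submodule 1"
  proof -
    have "{differential b D (Suc 0) u + w | u w. u \<in> free_module (b (Suc 0)) \<and> w \<in> irrelevant_submodule (b 0)} =
        {v + w | v w. v \<in> irrelevant_submodule 1 \<and> w \<in> irrelevant_submodule 1}"
      unfolding img[symmetric] b0 by blast
    also have "\<dots> = irrelevant_submodule 1"
    proof (intro equalityI subsetI)
      fix v assume "v \<in> irrelevant_submodule 1"
      then have "v = v + 0 \<and> v \<in> irrelevant_submodule 1 \<and> 0 \<in> irrelevant_submodule 1"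
        using pw.subspace_0[OF irr] by simp
      then show "v \<in> {v + w | v w. v \<in> irrelevant_submodule 1 \<and> w \<in> irrelevant_submodule 1}" by blast
    qed (use pw.subspace_add[OF irr] in auto)
    finally show ?thesis .
  qed
  have "tensor_homology_dim b D 0 + pw.dim (irrelevant_submodule 1) = pw.dim (free_module 1)"
    unfolding tensor_homology_dim_def Z B
    by (rule pw.quotient_dim_eq[OF fin_dim_free irr irrelevant_subset_free])
  moreover have "pw.dim (free_module 1) = pw.dim (mcycles (free_module 1) 0)"
    using dim_degree_0(1)[OF submodule_free order_refl] by (simp add: mcycles_0)
  moreover have "pw.dim (irrelevant_submodule 1) = pw.dim (mboundaries (free_module 1) 0)"
    using dim_embed[OF submodule_irrelevant irrelevant_subset_free] embed_irrelevant by metis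
  moreover have "pw.dim (cycles N g 0) = 1 + pw.dim (boundaries N g 0)"
    using homology_dim_add[OF finite_N, of g 0] by (simp add: homology_dim_0)
  ultimately show ?thesis by (simp add: dim_mcycles_free dim_mboundaries_free)
qed

text \<open>The preimages in \<open>F\<^sub>j\<close> of the cycles and of the boundaries of \<open>F \<otimes> k\<close> both contain \<open>M\<^sub>j\<^sub>+\<^sub>1\<close>.
  Dividing it out by means of the differential \<open>F\<^sub>j \<rightarrow> M\<^sub>j\<close> identifies \<open>Tor\<^sub>j\<close> with
  \<open>(M\<^sub>j \<inter> \<mm>F\<^sub>j\<^sub>-\<^sub>1) / \<mm>M\<^sub>j\<close>, which is the kernel of \<open>H\<^sub>0(M\<^sub>j) \<rightarrow> H\<^sub>0(F\<^sub>j\<^sub>-\<^sub>1)\<close>.\<close>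

lemma tensor_homology_dim_eq:
  assumes res: "free_resolution b D" and j: "1 \<le> j"
  shows "tensor_homology_dim b D j + pw.dim (mboundaries (syzygies b D j) 0) =
    pw.dim (mchains (syzygies b D j) 0 \<inter> mboundaries (free_module (b (j - 1))) 0)"
proof -
  let ?T = "differential b D j" and ?F = "free_module (b j)" and ?I = "irrelevant_submodule (b j)"
  let ?S = "syzygies b D (Suc j)"
  define Z where "Z = {v \<in> ?F. \<forall>r. ?T v r \<in> \<mm>}"
  define B where "B = {differential b D (Suc j) u + w | u w. u \<in> free_module (b (Suc j)) \<and> w \<in> ?I}"
  have T: "rlinear ?T" by (rule rlinear_differential)
  have S: "?S = {v \<in> ?F. ?T v = (\<lambda>x. 0)}" by (rule syzygies_Suc[OF res j])
  have subZ: "submodule Z"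
    unfolding Z_def submodule_def
    using submodule_zero[OF submodule_free] submodule_add[OF submodule_free] submodule_mult[OF submodule_free]
    by (auto simp: rlinear_zero[OF T] rlinear_add[OF T] rlinear_mult[OF T] irrelevant_closed)
  have finZ: "fin_dim pointwise_scale Z"
    by (rule pw.fin_dim_subset[OF fin_dim_free[of "b j"] submodule_subspace[OF subZ]]) (auto simp: Z_def)
  have B_eq: "B = {(\<lambda>x. v x + w x) | v w. v \<in> ?S \<and> w \<in> ?I}"
    unfolding B_def syzygies_def plus_fun_def by blast
  have "pw.subspace B"
  proof -
    have "B = {v + w | v w. v \<in> ?S \<and> w \<in> ?I}" unfolding B_eq plus_fun_def ..
    then show ?thesis
      using pw.subspace_sums[OF submodule_subspace[OF syzygies_submodule(1)] submodule_subspace[OF submodule_irrelevant]]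
      by simp
  qed
  have TI: "?T w r \<in> \<mm>" if "w \<in> ?I" for w r
    unfolding differential_def using that irrelevant_closed(1)
    by (auto simp: irrelevant_submodule_def intro!: irrelevant_sum irrelevant_closed(4))
  have BZ: "B \<subseteq> Z"
  proof
    fix x assume "x \<in> B"
    then obtain v w where vw: "x = (\<lambda>x. v x + w x)" "v \<in> ?F" "?T v = (\<lambda>x. 0)" "w \<in> ?I"
      unfolding B_eq S by blast
    have "w \<in> ?F" using vw(4) irrelevant_subset_free by blast
    then show "x \<in> Z"
      unfolding Z_def vw(1) using submodule_add[OF submodule_free vw(2)] vw(3) TI[OF vw(4)]
      by (simp add: rlinear_add[OF T])
  qed
  have finB: "fin_dim pointwise_scale B" by (rule pw.fin_dim_subset[OF finZ \<open>pw.subspace B\<close> BZ])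
  have "pw.dim Z = pw.dim (syzygies b D j \<inter> irrelevant_submodule (b (j - 1))) + pw.dim ?S"
  proof (rule rlinear_rank_nullity[OF T finZ])
    show "?T ` Z = syzygies b D j \<inter> irrelevant_submodule (b (j - 1))"
      unfolding Z_def syzygies_def irrelevant_submodule_def using differential_free by blast
    show "{v \<in> Z. ?T v = (\<lambda>x. 0)} = ?S"
      unfolding S Z_def using irrelevant_closed(1) by auto
  qed
  moreover have "pw.dim B = pw.dim (?T ` ?I) + pw.dim ?S"
  proof (rule rlinear_rank_nullity[OF T finB])
    show "?T ` B = ?T ` ?I"
    proof (intro equalityI subsetI)
      fix y assume "y \<in> ?T ` B"
      then obtain v w where vw: "y = ?T (\<lambda>x. v x + w x)" "?T v = (\<lambda>x. 0)" "w \<in> ?I"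
        unfolding B_eq S by blast
      then have "y = ?T w" by (simp add: rlinear_add[OF T])
      then show "y \<in> ?T ` ?I" using vw(3) by blast
    next
      fix y assume "y \<in> ?T ` ?I"
      then obtain w where w: "w \<in> ?I" "y = ?T w" by blast
      have "w \<in> B"
        unfolding B_eq mem_Collect_eq
        using w(1) submodule_zero[OF syzygies_submodule(1)] by (intro exI[of _ "\<lambda>x. 0"] exI[of _ w]) simp
      then show "y \<in> ?T ` B" using w(2) by blast
    qed
    have "?S \<subseteq> B"
    proof
      fix v assume "v \<in> ?S"
      then show "v \<in> B" unfolding B_eq mem_Collect_eq
        using submodule_zero[OF submodule_irrelevant] by (intro exI[of _ v] exI[of _ "\<lambda>x. 0"]) simp
    qed
    moreover have "B \<subseteq> ?F" using BZ by (auto simp: Z_def)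
    ultimately show "{v \<in> B. ?T v = (\<lambda>x. 0)} = ?S" unfolding S by blast
  qed
  moreover have "pw.dim (?T ` ?I) = pw.dim (mboundaries (syzygies b D j) 0)"
  proof -
    have "embed ` ?T ` ?I = lift ?T ` embed ` ?I"
      by (simp add: image_image lift_embed[OF T])
    also have "\<dots> = mboundaries (syzygies b D j) 0"
      unfolding embed_irrelevant lift_image_mboundaries[OF T submodule_free] syzygies_def ..
    finally show ?thesis
      using dim_embed[OF submodule_image[OF T submodule_irrelevant] image_subsetI[OF differential_free], of "b j"]
      by simp
  qed
  moreover have "tensor_homology_dim b D j + pw.dim B = pw.dim Z"
    unfolding tensor_homology_dim_def Z_def[symmetric] B_def[symmetric]
    by (rule pw.quotient_dim_eq[OF finZ \<open>pw.subspace B\<close> BZ])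
  ultimately show ?thesis
    unfolding dim_degree_0(2)[OF syzygies_submodule] by simp
qed

lemma chains_empty: "card N < i \<Longrightarrow> chains N i = {\<lambda>A. 0}"
proof -
  assume i: "card N < i"
  have "\<not> (A \<subseteq> N \<and> card A = i)" for A using card_mono[OF finite_N, of A] i by auto
  then show ?thesis by (auto simp: chains_iff)
qed

text \<open>The case of equality in \<open>\<beta>\<^sub>5 \<le> h\<^sub>4 + h\<^sub>3\<beta>\<^sub>1 + h\<^sub>2\<beta>\<^sub>2 + h\<^sub>1\<beta>\<^sub>3\<close>. The inequality is a sum of dimension
  counts, each losing the excess rank of one map \<open>H\<^sub>p(F\<^sub>j) \<rightarrow> H\<^sub>p(M\<^sub>j)\<close>; equality leaves no excess, and
  the conclusions record this for three of the maps. For \<open>p = 4\<close>, \<open>j = 1\<close> it means that the map is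
  zero, since \<open>M\<^sub>1 = \<mm>\<close> has rank 0 modulo \<open>\<mm>\<close>; as there are no 4-boundaries, the image of every
  cycle is then zero.\<close>

lemma tor_bound:
  assumes res: "free_resolution b D" and N: "card N \<le> 4"
  defines "\<tau> \<equiv> tensor_homology_dim b D" and "h \<equiv> homology_dim N g"
    and "A \<equiv> \<lambda>p j. lift (differential b D j) ` mcycles (free_module (b j)) p"
    and "F \<equiv> \<lambda>j. free_module (b j)" and "M \<equiv> syzygies b D"
  assumes le: "h 4 + h 3 * \<tau> 1 + h 2 * \<tau> 2 + h 1 * \<tau> 3 \<le> \<tau> 5"
  shows "A 4 1 \<subseteq> {\<lambda>x. 0}" "A 3 2 \<inter> mboundaries (F 1) 3 \<subseteq> mboundaries (M 2) 3"
    "A 2 3 \<inter> mboundaries (F 2) 2 \<subseteq> mboundaries (M 3) 2"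
proof -
  define a where "a p j = pw.dim (A p j)" for p j
  define ab where "ab p j = pw.dim (A p j \<inter> mboundaries (F (j - 1)) p)" for p j
  define z where "z p j = pw.dim (mcycles (M j) p)" for p j
  define y where "y p j = pw.dim (mboundaries (M j) p)" for p j
  define i where "i p j = pw.dim (mchains (M j) p \<inter> mboundaries (F (j - 1)) p)" for p j
  \<comment> \<open>The rank of \<open>F\<^sub>j \<rightarrow> F\<^sub>j\<^sub>-\<^sub>1\<close> modulo \<open>\<mm>\<close>.\<close>
  define r where "r j = z 0 j - i 0 j" for j
  note rl = rlinear_differential[of b D]
  have fin: "fin_dim pointwise_scale (A p j)" and sub: "submodule (A p j)" for p j
  proof -
    show sub: "submodule (A p j)" unfolding A_def
      by (intro submodule_image rlinear_lift rl submodule_mcycles submodule_free)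
    have "A p j \<subseteq> mchains (M j) p"
      using lift_mcycles[OF rl submodule_free] unfolding A_def M_def syzygies_def by (auto simp: mcycles_def)
    then show "fin_dim pointwise_scale (A p j)"
      using fin_dim_sub_mchains[OF syzygies_submodule[of b D j] sub] unfolding M_def by blast
  qed
  have yab: "mboundaries (M j) p \<subseteq> A p j \<inter> mboundaries (F (j - 1)) p" for p j
  proof -
    have "mboundaries (M j) p = lift (differential b D j) ` mboundaries (free_module (b j)) p"
      unfolding M_def syzygies_def lift_image_mboundaries[OF rl submodule_free] ..
    then have "mboundaries (M j) p \<subseteq> A p j"
      unfolding A_def using mboundaries_subset_mcycles[OF submodule_free] by blast
    moreover have "mboundaries (M j) p \<subseteq> mboundaries (F (j - 1)) p"
      unfolding M_def F_def by (intro mboundaries_mono syzygies_submodule)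
    ultimately show ?thesis by blast
  qed
  have finab: "fin_dim pointwise_scale (A p j \<inter> mboundaries (F (j - 1)) p)" for p j
    unfolding F_def by (intro pw.fin_dim_subset[OF fin] submodule_subspace submodule_Int sub
      submodule_mboundaries submodule_free) auto
  have le_ab: "y p j \<le> ab p j" for p j
    unfolding y_def ab_def by (rule pw.dim_mono_fin[OF finab yab])
  have e1: "z (Suc p) j + y p (Suc j) = a (Suc p) j + i p (Suc j)" if "1 \<le> j" for p j
    using connecting_homomorphism[OF rl submodule_free order_refl, of j "b j" p]
      syzygies_Suc[OF res that]
    by (simp add: z_def y_def a_def i_def M_def A_def F_def syzygies_def)
  have e2: "b j * h p + y p j + i p (Suc j) = a p j + z p (Suc j)" if "1 \<le> j" for p j
  proof -
    note rn = rank_nullity_mcycles[OF rl[of j] submodule_free order_refl, of "b j" p,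
      folded syzygies_Suc[OF res that] syzygies_def]
    have "b j * pw.dim (cycles N g p) = a p j + z p (Suc j)"
      using rn(1) by (simp add: z_def a_def M_def A_def dim_mcycles_free)
    moreover have "b j * pw.dim (boundaries N g p) = y p j + i p (Suc j)"
      using rn(2) by (simp add: y_def i_def M_def F_def dim_mboundaries_free)
    moreover have "b j * pw.dim (cycles N g p) = b j * h p + b j * pw.dim (boundaries N g p)"
      unfolding homology_dim_add[OF finite_N, of g p, symmetric] h_def by (rule distrib_left)
    ultimately show ?thesis by simp
  qed
  have e3: "h p * r j + ab p j \<le> a p j" if "1 \<le> j" for p j
    using rank_homology_map[OF rl, of j "b j" "b (j - 1)" p] differential_free
    by (auto simp: h_def r_def ab_def a_def z_def i_def A_def M_def F_def syzygies_def mcycles_0)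
  have e4: "\<tau> j + y 0 j = i 0 j" if "1 \<le> j" for j
    using tensor_homology_dim_eq[OF res that] by (simp add: \<tau>_def y_def i_def M_def F_def)
  have e5: "a 0 j = z 0 j" for j
    by (simp add: a_def z_def A_def M_def mcycles_0 lift_image_mchains[OF rl submodule_free] syzygies_def)
  have e6: "z 0 j = i 0 j + r j" for j
  proof -
    have "i 0 j \<le> z 0 j" unfolding i_def z_def mcycles_0 M_def
      by (intro pw.dim_mono_fin fin_dim_mchains[OF syzygies_submodule]) auto
    then show ?thesis by (simp add: r_def)
  qed
  have e7: "z 4 1 \<le> h 4"
  proof -
    have "chains N 5 = {\<lambda>A. 0 :: 'r}" using N by (intro chains_empty) simp
    moreover have "koszul N g (\<lambda>A. 0) = (\<lambda>B. 0)" by (rule ext) (rule koszul_zero)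
    ultimately have "boundaries N g 4 = {0}" by (simp add: boundaries_def zero_fun_def)
    then have "pw.dim (boundaries N g 4) = 0"
      using pw.dim_le_card[of "{0 :: nat set \<Rightarrow> 'r}" "{}"] by simp
    then have "pw.dim (mcycles (free_module 1) 4) = h 4"
      using homology_dim_add[OF finite_N, of g 4] by (simp add: dim_mcycles_free h_def)
    moreover have "M 1 \<subseteq> free_module 1"
      using syzygies_1[OF res] irrelevant_subset_free by (simp add: M_def)
    ultimately show ?thesis unfolding z_def
      using pw.dim_mono_fin[OF fin_dim_mcycles[OF submodule_free order_refl] mcycles_mono] by metis
  qed
  have b: "b j = \<tau> j + r j + r (Suc j)" if "1 \<le> j" for j
    using e2[OF that, of 0] e4[OF that] e5[of j] e6[of j] e6[of "Suc j"]
    by (simp add: h_def homology_dim_0)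
  have hb: "b j * h p = h p * \<tau> j + h p * r j + h p * r (Suc j)" if "1 \<le> j" for j p
    unfolding b[OF that] by (simp add: algebra_simps)
  \<comment> \<open>The walk from \<open>H\<^sub>0(M\<^sub>5)\<close> down to \<open>H\<^sub>4(M\<^sub>1)\<close>.\<close>
  have l1: "\<tau> 5 + a 1 4 = z 1 4" using e1[of 4 0] e4[of 5] by simp
  have l2: "z 1 4 + a 1 3 = h 1 * \<tau> 3 + h 1 * r 3 + h 1 * r 4 + y 1 3 + i 1 4"
    using e2[of 3 1] hb[of 3 1] by simp
  have l3: "i 1 4 + a 2 3 = z 2 3 + y 1 4" using e1[of 3 1] by (simp add: numeral_2_eq_2)
  have l4: "z 2 3 + a 2 2 = h 2 * \<tau> 2 + h 2 * r 2 + h 2 * r 3 + y 2 2 + i 2 3"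
    using e2[of 2 2] hb[of 2 2] by simp
  have l5: "i 2 3 + a 3 2 = z 3 2 + y 2 3" using e1[of 2 2] by simp
  have l6: "z 3 2 + a 3 1 = h 3 * \<tau> 1 + h 3 * r 1 + h 3 * r 2 + y 3 1 + i 3 2"
    using e2[of 1 3] hb[of 1 3] by (simp add: numeral_2_eq_2)
  have l7: "i 3 2 + a 4 1 = z 4 1 + y 3 2" using e1[of 1 3] by (simp add: numeral_2_eq_2)
  have total: "a 4 1 + (ab 3 2 - y 3 2) + (ab 2 3 - y 2 3) = 0"
    using l1 l2 l3 l4 l5 l6 l7 e7 le
      e3[of 4 1] e3[of 3 1] e3[of 3 2] e3[of 2 2] e3[of 1 3] e3[of 2 3]
      le_ab[of 1 4] le_ab[of 1 3] le_ab[of 2 3] le_ab[of 2 2] le_ab[of 3 2] le_ab[of 3 1]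
    by simp
  have eq: "A p j \<inter> mboundaries (F (j - 1)) p \<subseteq> mboundaries (M j) p" if "ab p j \<le> y p j" for p j
  proof (rule ccontr)
    assume "\<not> ?thesis"
    then have "mboundaries (M j) p \<subset> A p j \<inter> mboundaries (F (j - 1)) p" using yab[of j p] by blast
    then have "y p j < ab p j" unfolding y_def ab_def M_def
      by (intro pw.dim_strict_mono_fin[OF finab] submodule_subspace submodule_mboundaries syzygies_submodule) auto
    then show False using that by simp
  qed
  show "A 3 2 \<inter> mboundaries (F 1) 3 \<subseteq> mboundaries (M 2) 3"
    "A 2 3 \<inter> mboundaries (F 2) 2 \<subseteq> mboundaries (M 3) 2"
    using eq[of 3 2] eq[of 2 3] total by simp_all
  show "A 4 1 \<subseteq> {\<lambda>x. 0}"
  proof (rule ccontr)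
    assume "\<not> ?thesis"
    then have "{0} \<subset> A 4 1" using submodule_zero[OF sub] by (auto simp: zero_fun_def)
    then have "pw.dim ({0} :: (nat set \<times> nat \<Rightarrow> 'r) set) < a 4 1"
      unfolding a_def by (intro pw.dim_strict_mono_fin[OF fin]) (auto simp: pw.subspace_def)
    then show False using total by simp
  qed
qed

end

context koszul_algebra
begin

section \<open>Existence of free resolutions\<close>

lemma presentation_exists:
  assumes K: "submodule K" "K \<subseteq> free_module n"
  shows "\<exists>m E. (\<lambda>v r. if r < n then \<Sum>c<m. E r c * v c else 0) ` free_module m = K"
proof -
  have "fin_dim pointwise_scale K"
    by (rule pw.fin_dim_subset[OF fin_dim_free submodule_subspace[OF K(1)] K(2)])
  then obtain B where B: "finite B" "B \<subseteq> K" "pw.span B = K" using pw.fin_dim_basis by metis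
  define m where "m = card B"
  obtain w where "bij_betw w {..<m} B"
    using ex_bij_betw_nat_finite[OF B(1)] unfolding m_def atLeast0LessThan by blast
  then have w: "w ` {..<m} = B" by (simp add: bij_betw_def)
  define T where "T = (\<lambda>v r. if r < n then \<Sum>c<m. w c r * v c else 0)"
  have T: "rlinear T"
    by (auto simp: T_def rlinear_def fun_eq_iff sum.distrib sum_distrib_left algebra_simps)
  have Tv: "T v = (\<lambda>r. \<Sum>c<m. v c * w c r)" for v
  proof
    fix r
    have "w c r = 0" if "c < m" "n \<le> r" for c
    proof -
      have "w c \<in> free_module n" using w B(2) K(2) that(1) by blast
      then show ?thesis using that(2) by (simp add: free_module_def)
    qed
    then show "T v r = (\<Sum>c<m. v c * w c r)" by (auto simp: T_def mult.commute)
  qed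
  have "T ` free_module m = K"
  proof
    show "T ` free_module m \<subseteq> K"
    proof (rule image_subsetI)
      fix v show "T v \<in> K" unfolding Tv
        using w B(2) by (intro submodule_sum[OF K(1)]) blast
    qed
    have "w c \<in> T ` free_module m" if c: "c < m" for c
    proof (rule image_eqI)
      show "(\<lambda>i. if c = i then 1 else 0) \<in> free_module m" using c by (auto simp: free_module_def)
      have "(\<Sum>i<m. (if c = i then 1 else 0) * w i r) = w c r" for r
        using sum_unit_vector[where s = m and x = "\<lambda>i. w i r" and i = c] c by (simp add: mult.commute)
      then show "w c = T (\<lambda>i. if c = i then 1 else 0)" unfolding Tv by simp
    qed
    then have "B \<subseteq> T ` free_module m" using w by blast
    moreover have "pw.subspace (T ` free_module m)"
      by (intro submodule_subspace submodule_image T submodule_free)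
    ultimately show "K \<subseteq> T ` free_module m" using pw.span_minimal B(3) by blast
  qed
  then show ?thesis unfolding T_def by (intro exI[of _ m] exI[of _ "\<lambda>r c. w c r"])
qed

lemma free_resolution_exists: "\<exists>b D. free_resolution b D"
proof -
  define T :: "nat \<times> nat \<times> (nat \<Rightarrow> nat \<Rightarrow> 'r) \<Rightarrow> (nat \<Rightarrow> 'r) \<Rightarrow> nat \<Rightarrow> 'r"
    where "T = (\<lambda>(n, m, E) v r. if r < n then \<Sum>c<m. E r c * v c else 0)"
  have rT: "rlinear (T s)" for s
    by (cases s) (auto simp: T_def rlinear_def fun_eq_iff sum.distrib sum_distrib_left algebra_simps)
  \<comment> \<open>A state \<open>(n, m, E)\<close> stands for a map from \<open>R\<^sup>m\<close> to \<open>R\<^sup>n\<close> with matrix \<open>E\<close>.\<close>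
  define P where "P s \<longleftrightarrow> fst s = 1 \<and> T s ` free_module (fst (snd s)) = irrelevant_submodule 1" for s
  define Q where "Q s s' \<longleftrightarrow> fst s' = fst (snd s) \<and>
    T s' ` free_module (fst (snd s')) = {v \<in> free_module (fst (snd s)). T s v = (\<lambda>x. 0)}" for s s'
  have "\<exists>f. \<forall>i. (i = (0::nat) \<longrightarrow> P (f i)) \<and> Q (f i) (f (Suc i))"
  proof (rule dependent_nat_choice)
    obtain m E where "(\<lambda>v r. if r < 1 then \<Sum>c<m. E r c * v c else 0) ` free_module m = irrelevant_submodule 1"
      using presentation_exists[OF submodule_irrelevant irrelevant_subset_free] by blast
    then have "P (1, m, E)" by (simp add: P_def T_def)
    then show "\<exists>s. 0 = 0 \<longrightarrow> P s" by blast
  next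
    fix s :: "nat \<times> nat \<times> (nat \<Rightarrow> nat \<Rightarrow> 'r)" and i :: nat
    let ?K = "{v \<in> free_module (fst (snd s)). T s v = (\<lambda>x. 0)}"
    have "submodule ?K" by (rule submodule_kernel[OF rT submodule_free])
    moreover have "?K \<subseteq> free_module (fst (snd s))" by blast
    ultimately obtain m E where
      "(\<lambda>v r. if r < fst (snd s) then \<Sum>c<m. E r c * v c else 0) ` free_module m = ?K"
      using presentation_exists[of ?K] by blast
    then have "Q s (fst (snd s), m, E)" by (simp add: Q_def T_def)
    then show "\<exists>s'. (Suc i = 0 \<longrightarrow> P s') \<and> Q s s'" by blast
  qed
  then obtain f where "P (f 0)" "\<And>i. Q (f i) (f (Suc i))" by blast
  note f = this[unfolded P_def Q_def]
  define b where "b i = (case i of 0 \<Rightarrow> 1 | Suc k \<Rightarrow> fst (snd (f k)))" for i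
  define D where "D i = (case i of 0 \<Rightarrow> (\<lambda>_ _. 0) | Suc k \<Rightarrow> snd (snd (f k)))" for i
  have fst_f: "fst (f i) = b i" for i
    using f(1) f(2)[of "i - 1"] by (cases i) (auto simp: b_def)
  have d: "differential b D (Suc i) = T (f i)" for i
    by (cases "f i") (use fst_f[of i] in \<open>auto simp: differential_def T_def b_def D_def fun_eq_iff\<close>)
  have "free_resolution b D"
    unfolding free_resolution_def
  proof (intro conjI allI impI)
    show "b 0 = 1" by (simp add: b_def)
    show "differential b D 1 ` free_module (b 1) = irrelevant_submodule (b 0)"
      using f(1) d[of 0] by (simp add: b_def)
    fix i :: nat assume "1 \<le> i"
    then obtain k where k: "i = Suc k" by (cases i) auto
    show "differential b D (Suc i) ` free_module (b (Suc i)) =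
        {v \<in> free_module (b i). differential b D i v = 0}"
      using f(2)[of k] d[of k] d[of "Suc k"] by (simp add: k b_def zero_fun_def)
  qed
  then show ?thesis by blast
qed

section \<open>A nonzero product in Koszul homology makes the bound strict\<close>

text \<open>The chain \<open>e\<^sub>A \<otimes> v\<close>.\<close>

definition elem_chain :: "nat set \<Rightarrow> (nat \<Rightarrow> 'r) \<Rightarrow> nat set \<times> nat \<Rightarrow> 'r" where
  "elem_chain A v = (\<lambda>(B, r). if B = A then v r else 0)"

lemma elem_chain_row: "(\<lambda>r. elem_chain A v (B, r)) = (if B = A then v else (\<lambda>r. 0))"
  by (auto simp: elem_chain_def)

lemma elem_chain_mchains:
  "submodule M \<Longrightarrow> A \<subseteq> N \<Longrightarrow> card A = i \<Longrightarrow> v \<in> M \<Longrightarrow> elem_chain A v \<in> mchains M i"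
  unfolding mchains_def mem_Collect_eq elem_chain_row by (auto simp: submodule_zero chains_def elem_chain_def)

lemma lift_elem_chain: "rlinear T \<Longrightarrow> lift T (elem_chain A v) = elem_chain A (T v)"
proof
  fix x :: "nat set \<times> nat"
  assume T: "rlinear T"
  show "lift T (elem_chain A v) x = elem_chain A (T v) x"
  proof (cases x)
    case (Pair B r)
    then show ?thesis
      using rlinear_zero[OF T] by (cases "B = A") (simp_all add: lift_def elem_chain_row, simp_all add: elem_chain_def)
  qed
qed

text \<open>All terms of \<open>d(e\<^sub>A \<otimes> v)\<close> but one vanish if \<open>v\<close> is annihilated by the other \<open>g\<^sub>j\<close>.\<close>

lemma mkoszul_elem_chain:
  assumes i: "i \<in> A" "A \<subseteq> N" and v: "\<And>j r. j \<in> A - {i} \<Longrightarrow> g j * v r = 0"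
  shows "mkoszul (elem_chain A v) = elem_chain (A - {i}) (\<lambda>r. sign A i * g i * v r)"
proof
  fix x :: "nat set \<times> nat"
  obtain B r where x: "x = (B, r)" by (cases x)
  have mkoszul: "mkoszul (elem_chain A v) x = (\<Sum>j\<in>N - B. sign B j * g j * (if insert j B = A then v r else 0))"
    by (simp add: x mkoszul_def koszul_def elem_chain_def)
  show "mkoszul (elem_chain A v) x = elem_chain (A - {i}) (\<lambda>r. sign A i * g i * v r) x"
  proof (cases "B = A - {i}")
    case True
    have "insert j B = A \<longleftrightarrow> j = i" if "j \<in> N - B" for j using True that i by blast
    then have "mkoszul (elem_chain A v) x = (\<Sum>j\<in>N - B. if j = i then sign B i * g i * v r else 0)"
      unfolding mkoszul by (intro sum.cong) simp_all
    also have "\<dots> = sign B i * g i * v r" using i True finite_N by auto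
    finally show ?thesis using True by (simp add: x elem_chain_def sign_insert_same)
  next
    case False
    have "sign B j * g j * (if insert j B = A then v r else 0) = 0" if "j \<in> N - B" for j
    proof (cases "insert j B = A")
      case True
      then have "j \<in> A - {i}" using that False by auto
      then show ?thesis using v by (simp add: mult.assoc)
    qed simp
    then show ?thesis unfolding mkoszul using False by (simp add: x elem_chain_def)
  qed
qed

lemma mkoszul_elem_chain_zero:
  assumes v: "\<And>j r. j \<in> A \<Longrightarrow> g j * v r = 0"
  shows "mkoszul (elem_chain A v) = (\<lambda>x. 0)"
proof
  fix x :: "nat set \<times> nat"
  obtain B r where x: "x = (B, r)" by (cases x)
  have "sign B j * g j * (if insert j B = A then v r else 0) = 0" for j
    using v[of j r] by (auto simp: mult.assoc)
  then show "mkoszul (elem_chain A v) x = 0" by (simp add: x mkoszul_def koszul_def elem_chain_def)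
qed

text \<open>Assuming equality, the conclusions of \<open>tor_bound\<close> turn each step of the zigzag from
  \<open>zw \<cdot> e\<^sub>z \<and> e\<^sub>w \<otimes> u\<close> to \<open>xyzw \<cdot> e\<^sub>x \<and> e\<^sub>y \<and> e\<^sub>z \<and> e\<^sub>w\<close> into an honest lift: an image that bounds in the
  free module also bounds in the syzygies, and the difference of the two bounding chains is a
  cycle one step further down.\<close>

lemma tor_strict_bound:
  assumes res: "free_resolution b D"
    and N: "N = {i, j, k, l}" and distinct: "distinct [i, j, k, l]"
    and sq: "\<And>v r. v \<in> N \<Longrightarrow> r \<in> \<mm> \<Longrightarrow> g v * g v * r = 0"
    and socle: "g i * g j * g k * g l \<noteq> 0"
  defines "\<tau> \<equiv> tensor_homology_dim b D" and "h \<equiv> homology_dim N g"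
  shows "\<tau> 5 < h 4 + h 3 * \<tau> 1 + h 2 * \<tau> 2 + h 1 * \<tau> 3"
proof (rule ccontr)
  assume "\<not> ?thesis"
  then have le: "h 4 + h 3 * \<tau> 1 + h 2 * \<tau> 2 + h 1 * \<tau> 3 \<le> \<tau> 5" by simp
  have card: "card N \<le> 4" unfolding N using distinct by simp
  let ?d = "differential b D" and ?F = "\<lambda>i. free_module (b i)" and ?M = "syzygies b D"
  note bound = tor_bound[OF res card le[unfolded \<tau>_def h_def]]
  note rl = rlinear_differential[of b D]
  define x y z w where "x = g i" and "y = g j" and "z = g k" and "w = g l"
  have m: "x \<in> \<mm>" "y \<in> \<mm>" "z \<in> \<mm>" "w \<in> \<mm>"
    by (auto simp: x_def y_def z_def w_def N intro: generator_irrelevant)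
  have sq: "x * (x * r) = 0" "y * (y * r) = 0" "z * (z * r) = 0" "w * (w * r) = 0" if "r \<in> \<mm>" for r
    using sq[OF _ that] by (auto simp: x_def y_def z_def w_def N mult.assoc)
  have mm: "r * s \<in> \<mm>" if "r \<in> \<mm> \<or> s \<in> \<mm>" for r s
    using that irrelevant_closed(4)[of s r] irrelevant_closed(4)[of r s] by (auto simp: mult.commute)
  have M1: "?M 1 = irrelevant_submodule 1" by (rule syzygies_1[OF res])
  define \<delta> :: "'r \<Rightarrow> nat \<Rightarrow> 'r" where "\<delta> r = (\<lambda>i. if i = 0 then r else 0)" for r
  have "\<exists>e\<in>?F 1. ?d 1 e = \<delta> r" if "r \<in> \<mm>" for r
  proof -
    have "\<delta> r \<in> ?M 1" unfolding M1 using that irrelevant_closed(1)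
      by (auto simp: \<delta>_def irrelevant_submodule_def free_module_def)
    then show ?thesis unfolding syzygies_def by auto
  qed
  then obtain ex ey where e: "ex \<in> ?F 1" "?d 1 ex = \<delta> x" "ey \<in> ?F 1" "?d 1 ey = \<delta> y"
    using m by metis
  have "(\<lambda>r. x * ey r - y * ex r) \<in> ?M 2"
  proof -
    have "?d 1 (\<lambda>r. x * ey r - y * ex r) = (\<lambda>r. 0)"
      unfolding rlinear_diff[OF rl] rlinear_mult[OF rl] e by (auto simp: \<delta>_def mult.commute)
    moreover have "(\<lambda>r. x * ey r - y * ex r) \<in> ?F 1"
      by (intro submodule_diff submodule_mult submodule_free e)
    ultimately show ?thesis using syzygies_Suc[OF res, of 1] by (simp add: numeral_2_eq_2)
  qed
  then obtain \<eta> where \<eta>: "\<eta> \<in> ?F 2" "?d 2 \<eta> = (\<lambda>r. x * ey r - y * ex r)"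
    unfolding syzygies_def by auto
  have "(\<lambda>r. x * y * \<eta> r) \<in> ?M 3"
  proof -
    have "?d 2 (\<lambda>r. x * y * \<eta> r) = (\<lambda>r. x * (x * y) * ey r - y * (y * x) * ex r)"
      unfolding rlinear_mult[OF rl] \<eta> by (simp add: algebra_simps)
    also have "\<dots> = (\<lambda>r. 0)" using sq(1)[OF m(2)] sq(2)[OF m(1)] by simp
    finally show ?thesis
      using syzygies_Suc[OF res, of 2] submodule_mult[OF submodule_free] \<eta> by (simp add: numeral_3_eq_3)
  qed
  then obtain u where u: "u \<in> ?F 3" "?d 3 u = (\<lambda>r. x * y * \<eta> r)"
    unfolding syzygies_def by auto
  have sub: "{k, l} \<subseteq> N" "{i, k, l} \<subseteq> N" "N \<subseteq> N" by (auto simp: N)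
  have cards: "card {k, l} = 2" "card {i, k, l} = 3" "card N = 4" using distinct by (auto simp: N)
  have dropi: "{i, k, l} - {i} = {k, l}" and dropj: "N - {j} = {i, k, l}"
    using distinct by (auto simp: N)
  define s t :: 'r where "s = sign {i, k, l} i" and "t = sign N j"
  have st: "s * (s * r) = r" "t * (t * r) = r" for r by (simp_all add: s_def t_def sign_cancel)

  \<comment> \<open>\<open>\<zeta>\<close> is a cycle since \<open>z\<^sup>2w = zw\<^sup>2 = 0\<close>; its image is the product \<open>xyzw \<cdot> e\<^sub>z \<and> e\<^sub>w\<close> at \<open>\<eta>\<close>.\<close>
  define \<zeta> where "\<zeta> = elem_chain {k, l} (\<lambda>r. z * w * u r)"
  have "\<zeta> \<in> mcycles (?F 3) 2"
  proof -
    have "\<zeta> \<in> mchains (?F 3) 2" unfolding \<zeta>_def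
      by (intro elem_chain_mchains submodule_free sub cards submodule_mult u)
    moreover have "mkoszul \<zeta> = (\<lambda>x. 0)" unfolding \<zeta>_def
    proof (rule mkoszul_elem_chain_zero)
      fix v r assume "v \<in> {k, l}"
      then have "g v = z \<or> g v = w" by (auto simp: z_def w_def)
      then have "g v * (z * w) = 0" using sq(3)[OF m(4)] sq(4)[OF m(3)] by (auto simp: mult_ac)
      then show "g v * (z * w * u r) = 0" by (simp add: mult.assoc[symmetric])
    qed
    ultimately show ?thesis by (simp add: mcycles_def)
  qed
  then have \<zeta>A: "lift (?d 3) \<zeta> \<in> lift (?d 3) ` mcycles (?F 3) 2" by blast
  have \<zeta>d: "lift (?d 3) \<zeta> = elem_chain {k, l} (\<lambda>r. x * y * z * w * \<eta> r)"
    unfolding \<zeta>_def lift_elem_chain[OF rl] rlinear_mult[OF rl] u(2) by (simp add: mult_ac)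
  \<comment> \<open>In \<open>K \<otimes> F\<^sub>2\<close> the image of \<open>\<zeta>\<close> bounds: take \<open>e\<^sub>x\<close> out of the coefficient \<open>xyzw\<close>.
    The sign \<open>s\<close> cancels that of the differential.\<close>
  define P where "P = elem_chain {i, k, l} (\<lambda>r. s * y * z * w * \<eta> r)"
  have P: "P \<in> mchains (?F 2) 3" unfolding P_def
    by (intro elem_chain_mchains submodule_free sub cards submodule_mult \<eta>)
  have dP: "mkoszul P = lift (?d 3) \<zeta>"
  proof -
    have "mkoszul P = elem_chain ({i, k, l} - {i}) (\<lambda>r. sign {i, k, l} i * g i * (s * y * z * w * \<eta> r))"
      unfolding P_def
    proof (rule mkoszul_elem_chain)
      fix v r assume "v \<in> {i, k, l} - {i}"
      then have "g v = z \<or> g v = w" by (auto simp: z_def w_def)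
      then have "g v * (z * w) = 0" using sq(3)[OF m(4)] sq(4)[OF m(3)] by (auto simp: mult_ac)
      then have "s * y * \<eta> r * (g v * (z * w)) = 0" by simp
      then show "g v * (s * y * z * w * \<eta> r) = 0" by (simp only: mult_ac)
    qed (auto simp: N)
    also have "\<dots> = elem_chain {k, l} (\<lambda>r. s * (s * (x * y * z * w * \<eta> r)))"
      unfolding dropi s_def[symmetric] x_def[symmetric] by (simp only: mult_ac)
    finally show ?thesis by (simp add: st \<zeta>d)
  qed
  have "lift (?d 3) \<zeta> \<in> mboundaries (?F 2) 2"
    unfolding mboundaries_def dP[symmetric] using P by (simp add: numeral_2_eq_2 numeral_3_eq_3)
  then have "lift (?d 3) \<zeta> \<in> mboundaries (?M 3) 2" using bound(3) \<zeta>A by blast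
  then obtain \<omega> where \<omega>: "\<omega> \<in> mchains (?M 3) 3" "lift (?d 3) \<zeta> = mkoszul \<omega>"
    unfolding mboundaries_def by (auto simp: numeral_2_eq_2 numeral_3_eq_3)

  define \<theta> where "\<theta> = (\<lambda>x. P x - \<omega> x)"
  have "\<theta> \<in> mcycles (?F 2) 3"
  proof -
    have "\<omega> \<in> mchains (?F 2) 3" using \<omega>(1) mchains_mono[OF syzygies_submodule(2)[of b D 3]] by auto
    then have "\<theta> \<in> mchains (?F 2) 3"
      unfolding \<theta>_def by (intro submodule_diff submodule_mchains submodule_free P)
    moreover have "mkoszul \<theta> = (\<lambda>x. 0)"
      unfolding \<theta>_def rlinear_diff[OF rlinear_mkoszul] dP \<omega>(2) by simp
    ultimately show ?thesis by (simp add: mcycles_def)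
  qed
  then have \<theta>A: "lift (?d 2) \<theta> \<in> lift (?d 2) ` mcycles (?F 2) 3" by blast
  have \<theta>d: "lift (?d 2) \<theta> = elem_chain {i, k, l} (\<lambda>r. s * x * y * z * w * ey r)"
  proof -
    have "lift (?d 2) \<omega> = (\<lambda>x. 0)"
      using \<omega>(1) lift_kernel_mchains[OF rl, of "?F 2" 3 2] syzygies_Suc[OF res, of 2]
      by (auto simp: numeral_3_eq_3)
    then have "lift (?d 2) \<theta> = elem_chain {i, k, l} (\<lambda>r. s * y * z * w * (x * ey r - y * ex r))"
      unfolding \<theta>_def rlinear_diff[OF rlinear_lift[OF rl]] P_def lift_elem_chain[OF rl] rlinear_mult[OF rl] \<eta>(2)
      by simp
    also have "\<dots> = elem_chain {i, k, l} (\<lambda>r. s * x * y * z * w * ey r - s * ex r * (y * (y * (z * w))))"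
      by (simp add: algebra_simps)
    finally show ?thesis using sq(2)[OF mm[of z w]] m by simp
  qed
  \<comment> \<open>The same with \<open>e\<^sub>y\<close>; no chain of degree 5 is left to repeat this once more.\<close>
  define Q where "Q = elem_chain N (\<lambda>r. t * s * x * z * w * ey r)"
  have Q: "Q \<in> mchains (?F 1) 4" unfolding Q_def
    by (intro elem_chain_mchains submodule_free sub cards submodule_mult e)
  have dQ: "mkoszul Q = lift (?d 2) \<theta>"
  proof -
    have "mkoszul Q = elem_chain (N - {j}) (\<lambda>r. sign N j * g j * (t * s * x * z * w * ey r))"
      unfolding Q_def
    proof (rule mkoszul_elem_chain)
      fix v r assume "v \<in> N - {j}"
      then have "g v = x \<or> g v = z \<or> g v = w" by (auto simp: x_def z_def w_def N)
      then have "g v * (x * (z * w)) = 0"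
        using sq(1)[of "z * w"] sq(3)[of "x * w"] sq(4)[of "x * z"] m mm by (auto simp: mult_ac)
      then have "t * s * ey r * (g v * (x * (z * w))) = 0" by simp
      then show "g v * (t * s * x * z * w * ey r) = 0" by (simp only: mult_ac)
    qed (auto simp: N)
    also have "\<dots> = elem_chain {i, k, l} (\<lambda>r. t * (t * (s * x * y * z * w * ey r)))"
      unfolding dropj t_def[symmetric] y_def[symmetric] by (simp only: mult_ac)
    finally show ?thesis by (simp add: st \<theta>d)
  qed
  have "lift (?d 2) \<theta> \<in> mboundaries (?F 1) 3"
    unfolding mboundaries_def dQ[symmetric] using Q by simp
  then have "lift (?d 2) \<theta> \<in> mboundaries (?M 2) 3" using bound(2) \<theta>A by blast
  then obtain \<omega>' where \<omega>': "\<omega>' \<in> mchains (?M 2) 4" "lift (?d 2) \<theta> = mkoszul \<omega>'"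
    unfolding mboundaries_def by auto

  define \<theta>' where "\<theta>' = (\<lambda>x. Q x - \<omega>' x)"
  have "\<theta>' \<in> mcycles (?F 1) 4"
  proof -
    have "\<omega>' \<in> mchains (?F 1) 4" using \<omega>'(1) mchains_mono[OF syzygies_submodule(2)[of b D 2]] by auto
    then have "\<theta>' \<in> mchains (?F 1) 4"
      unfolding \<theta>'_def by (intro submodule_diff submodule_mchains submodule_free Q)
    moreover have "mkoszul \<theta>' = (\<lambda>x. 0)"
      unfolding \<theta>'_def rlinear_diff[OF rlinear_mkoszul] dQ \<omega>'(2) by simp
    ultimately show ?thesis by (simp add: mcycles_def)
  qed
  then have "lift (?d 1) \<theta>' = (\<lambda>x. 0)" using bound(1) by blast
  moreover have "lift (?d 1) \<omega>' = (\<lambda>x. 0)"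
    using \<omega>'(1) lift_kernel_mchains[OF rl, of "?F 1" 4 1] syzygies_Suc[OF res, of 1]
    by (auto simp: numeral_2_eq_2)
  ultimately have "elem_chain N (\<lambda>r. t * s * x * z * w * \<delta> y r) = (\<lambda>x. 0)"
    unfolding \<theta>'_def rlinear_diff[OF rlinear_lift[OF rl]] Q_def lift_elem_chain[OF rl] rlinear_mult[OF rl] e(4)
    by simp
  from fun_cong[OF this, of "(N, 0)"] have "t * (s * (x * y * z * w)) = 0"
    by (simp add: elem_chain_def \<delta>_def mult_ac)
  then have "s * (t * (t * (s * (x * y * z * w)))) = 0" by simp
  then have "x * y * z * w = 0" by (simp only: st)
  then show False using socle by (simp add: x_def y_def z_def w_def)
qed

end

section \<open>Comparison with the Golod property\<close>

context pos_graded_algebra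
begin

text \<open>Compare the coefficients of \<open>t\<^sup>5\<close> in \<open>P(t) (1 - t \<Sum>\<^sub>i\<^sub>\<ge>\<^sub>1 h\<^sub>i t\<^sup>i) = (1 + t)\<^sup>n\<close>; the right-hand one is
  not negative.\<close>

lemma golod_coefficient_5:
  assumes golod
  defines "h \<equiv> koszul_homology_dim (SOME xs. minimal_homogeneous_generators xs)"
  shows "h 4 * tor_dim 0 + h 3 * tor_dim 1 + h 2 * tor_dim 2 + h 1 * tor_dim 3 \<le> tor_dim 5"
proof -
  let ?X = "fps_X :: rat fps"
  define H :: "rat fps" where "H = Abs_fps (\<lambda>i. if i = 0 then 0 else of_nat (h i))"
  have "is_unit (1 - ?X * H)" by (simp add: fps_is_unit_iff)
  then have "(1 + ?X) ^ embedding_dim / (1 - ?X * H) * (1 - ?X * H) = (1 + ?X) ^ embedding_dim"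
    by (rule dvd_div_mult_self[OF unit_imp_dvd])
  moreover have "poincare_series = (1 + ?X) ^ embedding_dim / (1 - ?X * H)"
    using assms(1) unfolding golod_def serre_bound_def Let_def H_def h_def .
  ultimately have eq: "poincare_series - ?X * (poincare_series * H) = (1 + ?X) ^ embedding_dim"
    by (simp add: right_diff_distrib mult.left_commute)
  have "0 \<le> ((1 + ?X) ^ n) $ k" for n k
  proof (induction n arbitrary: k)
    case (Suc n)
    then show ?case by (cases k) (simp_all add: distrib_right)
  qed simp
  then have "0 \<le> (poincare_series - ?X * (poincare_series * H)) $ 5" unfolding eq .
  then have "(poincare_series * H) $ 4 \<le> poincare_series $ 5" by simp
  moreover have "(poincare_series * H) $ 4 =
      of_nat (h 4 * tor_dim 0 + h 3 * tor_dim 1 + h 2 * tor_dim 2 + h 1 * tor_dim 3)"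
    by (simp add: fps_mult_nth numeral_eq_Suc atLeast0_atMost_Suc H_def poincare_series_def mult.commute)
  ultimately have "(of_nat (h 4 * tor_dim 0 + h 3 * tor_dim 1 + h 2 * tor_dim 2 + h 1 * tor_dim 3) :: rat)
      \<le> of_nat (tor_dim 5)" by (simp add: poincare_series_def)
  then show ?thesis unfolding of_nat_le_iff .
qed

text \<open>Nothing is known about the resolution chosen in \<open>tor_dim\<close> except that it is one; in particular
  it need not be minimal.\<close>

lemma tor_dim_resolution:
  assumes "free_resolution b0 D0"
  obtains b D where "free_resolution b D" "tor_dim = tensor_homology_dim b D"
proof -
  obtain b D where bD: "(SOME (b, D). free_resolution b D) = (b, D)" by fastforce
  have "case (SOME (b, D). free_resolution b D) of (b, D) \<Rightarrow> free_resolution b D"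
    by (rule someI[of _ "(b0, D0)"]) (use assms in simp)
  then have "free_resolution b D" by (simp add: bD)
  moreover have "tor_dim = tensor_homology_dim b D" by (simp add: tor_dim_def bD fun_eq_iff)
  ultimately show ?thesis using that by blast
qed

end

context finite_graded_algebra
begin

lemma koszul_homology_dim_eq: "koszul_homology_dim xs i = homology_dim {..<length xs} (nth xs) i"
proof -
  let ?N = "{..<length xs}"
  have "koszul_module (length xs) i = chains ?N i" for i
    by (simp add: koszul_module_def chains_def)
  moreover have "koszul_differential xs = koszul ?N (nth xs)"
    by (simp add: koszul_differential_def koszul_def sign_def fun_eq_iff)
  ultimately have "koszul_homology_dim xs i =
      quotient_dim pointwise_scale (cycles ?N (nth xs) i) (boundaries ?N (nth xs) i)"
    by (simp add: koszul_homology_dim_def cycles_def boundaries_def zero_fun_def)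
  then show ?thesis
    using pw.quotient_dim_eq[OF fin_dim_cycles subspace_boundaries boundaries_subset_cycles, of ?N "nth xs" i]
    by (simp add: homology_dim_def)
qed

lemma homology_dim_cong:
  assumes "\<And>j. j \<in> N \<Longrightarrow> g j = g' j" shows "homology_dim N g i = homology_dim N g' i"
proof -
  have "koszul N g = koszul N g'" using assms by (auto simp: koszul_def fun_eq_iff intro!: sum.cong)
  then show ?thesis by (simp add: homology_dim_def cycles_def boundaries_def)
qed

text \<open>Modulo products of elements of \<open>\<mm>\<close>, only the constant terms of coefficients matter, so a
  generating set of the ideal \<open>\<mm>\<close> spans it over \<open>k\<close>.\<close>

lemma card_generators:
  assumes Q: "sc.subspace Q" "\<And>a b. a \<in> \<mm> \<Longrightarrow> b \<in> \<mm> \<Longrightarrow> a * b \<in> Q"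
    and T: "finite T" "T \<subseteq> \<mm>" "\<And>t. t \<in> T \<Longrightarrow> t \<notin> sc.span ((T - {t}) \<union> Q)"
    and A: "finite A" "ideal_gen A = \<mm>"
  shows "card T \<le> card A"
proof -
  obtain B where B: "finite B" "sc.span B = UNIV" using finite_dimensional by blast
  have "fin_dim scale Q" using Q(1) B by (auto simp: fin_dim_def)
  then obtain C where C: "finite C" "sc.independent C" "sc.span C = Q" using sc.fin_dim_basis by metis
  note TC = sc.independent_Un_modulo[OF T(1,3) C(2,3)]
  have "r \<in> sc.span (A \<union> Q)" if "r \<in> ideal_gen A" for r
    using that unfolding ideal_gen_def
  proof (induction r rule: ideal.span_induct_alt)
    case (step c x y)
    obtain d m where dm: "m \<in> \<mm>" "c = scale d 1 + m" using irrelevant_decomposition by blast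
    have "x \<in> \<mm>" using step.hyps A(2) unfolding ideal_gen_def by (metis ideal.span_base)
    then have "m * x \<in> Q" using dm(1) Q(2) by blast
    then have "scale d x + m * x + y \<in> sc.span (A \<union> Q)"
      using step by (intro sc.span_add sc.span_scale) (auto intro: sc.span_base)
    then show ?case by (simp add: dm(2) distrib_right scale_mult)
  qed (rule sc.span_zero)
  then have "T \<subseteq> sc.span (A \<union> C)" using T(2) A(2) by (auto simp: sc.span_Un_basis[OF C(3)])
  moreover have "C \<subseteq> sc.span (A \<union> C)" by (auto intro: sc.span_base)
  ultimately have "card (T \<union> C) \<le> card (A \<union> C)"
    using sc.independent_span_bound[OF _ TC(1)] A(1) C(1) by blast
  moreover have "card (A \<union> C) \<le> card A + card C" by (rule card_Un_le)
  ultimately show ?thesis using TC(2) T(1) C(1) by (simp add: card_Un_disjoint)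
qed

text \<open>The generators \<open>xs\<close> of Serre's bound are joined with \<open>x, y, z, w\<close> into one family \<open>g\<close>, the latter
  at the indices from \<open>n\<close> on, so that \<open>homology_dim_le\<close> applies to two parts of the same family.\<close>

lemma not_golod:
  assumes gen: "ideal_gen {x, y, z, w} = \<mm>"
    and min: "\<exists>xs. minimal_homogeneous_generators xs"
      "\<And>A. finite A \<Longrightarrow> ideal_gen A = \<mm> \<Longrightarrow> 4 \<le> card A"
    and sq: "\<And>v r. v \<in> {x, y, z, w} \<Longrightarrow> r \<in> \<mm> \<Longrightarrow> v * v * r = 0"
    and socle: "x * y * z * w \<noteq> 0"
  shows "\<not> golod"
proof
  assume golod: golod
  define xs where "xs = (SOME xs. minimal_homogeneous_generators xs)"
  have xs: "minimal_homogeneous_generators xs" unfolding xs_def by (rule someI_ex[OF min(1)])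
  define n where "n = length xs"
  define g where "g i = (if i < n then xs ! i else [x, y, z, w] ! (i - n))" for i
  define N where "N = {n, n + 1, n + 2, n + 3}"
  have gN: "g ` N = {x, y, z, w}" by (simp add: N_def g_def numeral_eq_Suc)
  interpret K: koszul_algebra scale G N g
    by unfold_locales (simp_all add: gN gen, simp add: N_def)
  have "g ` {..<n} = set xs" by (auto simp: g_def n_def set_conv_nth)
  then have gM: "ideal_gen (g ` {..<n}) = \<mm>" using xs by (simp add: minimal_homogeneous_generators_def)
  have "4 \<le> n"
    using min(2)[of "set xs"] xs card_length[of xs] by (simp add: minimal_homogeneous_generators_def n_def)
  then have "homology_dim N g i \<le> homology_dim {..<n} g i" for i
  proof (intro homology_dim_le)
    show "ideal_gen (g ` {..<n}) = ideal_gen (g ` N)" unfolding gM gN gen ..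
  qed (simp_all add: N_def)
  moreover have "homology_dim {..<n} g i = koszul_homology_dim xs i" for i
    unfolding koszul_homology_dim_eq n_def[symmetric] by (rule homology_dim_cong) (simp add: g_def)
  ultimately have h: "homology_dim N g i \<le> koszul_homology_dim xs i" for i by simp
  obtain b D where bD: "free_resolution b D" "tor_dim = tensor_homology_dim b D"
    using K.free_resolution_exists tor_dim_resolution by metis
  have "tor_dim 5 < homology_dim N g 4 + homology_dim N g 3 * tor_dim 1 +
      homology_dim N g 2 * tor_dim 2 + homology_dim N g 1 * tor_dim 3"
    unfolding bD(2)
  proof (rule K.tor_strict_bound[OF bD(1) N_def])
    show "g v * g v * r = 0" if "v \<in> N" "r \<in> \<mm>" for v r
      using sq[of "g v" r] that gN by blast
    show "g n * g (n + 1) * g (n + 2) * g (n + 3) \<noteq> 0"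
      using socle by (simp add: g_def numeral_eq_Suc)
  qed simp
  also have "\<dots> \<le> koszul_homology_dim xs 4 * tor_dim 0 + koszul_homology_dim xs 3 * tor_dim 1 +
      koszul_homology_dim xs 2 * tor_dim 2 + koszul_homology_dim xs 1 * tor_dim 3"
    using K.tensor_homology_dim_0[OF bD(1)] by (intro add_mono mult_mono h) (simp_all add: bD(2) h)
  also have "\<dots> \<le> tor_dim 5" using golod_coefficient_5[OF golod] by (simp add: xs_def)
  finally show False by simp
qed

end

section \<open>The algebra \<open>k[x,y,z,w] / m(x\<^sup>2,y\<^sup>2,z\<^sup>2,w\<^sup>2)\<close>\<close>

lemma finite_graded_algebra_quot:
  "finite_graded_algebra (quot_scale :: 'k::field \<Rightarrow> 'k quot_ring \<Rightarrow> 'k quot_ring) quot_grading"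
  by (intro finite_graded_algebra.intro pos_graded_algebra_quot finite_graded_algebra_axioms.intro quot_finite_span)

interpretation R: finite_graded_algebra "quot_scale :: 'k::field \<Rightarrow> 'k quot_ring \<Rightarrow> 'k quot_ring" quot_grading
  by (rule finite_graded_algebra_quot)

text \<open>The elements represented by polynomials without terms of degree below \<open>d\<close>; it stands in for the
  \<open>d\<close>-th power of the irrelevant ideal.\<close>

definition order_ge :: "nat \<Rightarrow> 'k::field quot_ring set" where
  "order_ge d = quot ` {p. \<forall>m\<in>Poly_Mapping.keys p. d \<le> monomial_degree m}"

lemma order_geI: "(\<And>m. m \<in> Poly_Mapping.keys p \<Longrightarrow> d \<le> monomial_degree m) \<Longrightarrow> quot p \<in> order_ge d"
  by (auto simp: order_ge_def)

lemma order_ge_add: "r \<in> order_ge d \<Longrightarrow> s \<in> order_ge d \<Longrightarrow> r + s \<in> order_ge d"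
proof -
  assume "r \<in> order_ge d" "s \<in> order_ge d"
  then obtain p q where pq: "\<forall>m\<in>Poly_Mapping.keys p. d \<le> monomial_degree m"
    "\<forall>m\<in>Poly_Mapping.keys q. d \<le> monomial_degree m" "r = quot p" "s = quot q"
    by (auto simp: order_ge_def)
  then show ?thesis
    using Poly_Mapping.keys_add[of p q] by (auto simp flip: quot_add intro!: order_geI)
qed

lemma order_ge_mult:
  assumes "r \<in> order_ge d" "s \<in> order_ge e" shows "r * s \<in> order_ge (d + e)"
proof -
  obtain p q where pq: "\<forall>m\<in>Poly_Mapping.keys p. d \<le> monomial_degree m"
    "\<forall>m\<in>Poly_Mapping.keys q. e \<le> monomial_degree m" "r = quot p" "s = quot q"
    using assms by (auto simp: order_ge_def)
  have "d + e \<le> monomial_degree m" if m: "m \<in> Poly_Mapping.keys (p * q)" for m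
  proof -
    obtain a c where "m = a + c" "a \<in> Poly_Mapping.keys p" "c \<in> Poly_Mapping.keys q"
      using m keys_mult[of p q] by blast
    then show ?thesis using pq by (auto simp: monomial_degree_add intro: add_mono)
  qed
  then show ?thesis unfolding pq quot_mult[symmetric] by (rule order_geI)
qed

lemma order_ge_0: "r \<in> order_ge 0"
  using quot_surj[of r] by (auto simp: order_ge_def)

lemma zero_order_ge: "0 \<in> order_ge d"
  using order_geI[of 0 d] by (simp add: quot_0)

lemma order_ge_mult_left: "s \<in> order_ge d \<Longrightarrow> r * s \<in> order_ge d"
  using order_ge_mult[OF order_ge_0[of r]] by fastforce

lemma subspace_order_ge: "R.sc.subspace (order_ge d)"
  by (rule R.sc.subspaceI) (auto simp: zero_order_ge order_ge_add quot_scale_def order_ge_mult_left)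

lemma is_ideal_order_ge: "ideal.subspace (order_ge d)"
  by (rule ideal.subspaceI) (auto simp: zero_order_ge order_ge_add order_ge_mult_left)

lemma irrelevant_ideal_quot: "R.irrelevant_ideal = (order_ge 1 :: 'k::field quot_ring set)"
proof
  show "R.irrelevant_ideal \<subseteq> (order_ge 1 :: 'k quot_ring set)"
    unfolding R.irrelevant_ideal_def
  proof (rule R.sc.span_minimal)
    show "(\<Union>i\<in>{1..}. quot_grading i) \<subseteq> (order_ge 1 :: 'k quot_ring set)"
      by (auto simp: quot_grading_def homogeneous_def intro!: order_geI)
  qed (rule subspace_order_ge)
  show "order_ge 1 \<subseteq> (R.irrelevant_ideal :: 'k quot_ring set)"
  proof
    fix r :: "'k quot_ring" assume "r \<in> order_ge 1"
    then obtain p where p: "\<forall>m\<in>Poly_Mapping.keys p. 1 \<le> monomial_degree m" "r = quot p"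
      by (auto simp: order_ge_def)
    have "quot (Poly_Mapping.single m (Poly_Mapping.lookup p m)) \<in> (\<Union>i\<in>{1..}. quot_grading i)"
      if "m \<in> Poly_Mapping.keys p" for m
      using p(1) that by (auto simp: quot_grading_def homogeneous_def intro!: bexI[of _ "monomial_degree m"])
    then show "r \<in> R.irrelevant_ideal"
      unfolding p(2) R.irrelevant_ideal_def
      by (subst poly_sum) (unfold quot_sum, intro R.sc.span_sum R.sc.span_base)
  qed
qed

definition quot_var :: "var \<Rightarrow> 'k::field quot_ring" where
  "quot_var v = quot (indeterminate v)"

lemma quot_var_order: "quot_var v \<in> order_ge 1"
  unfolding quot_var_def by (rule order_geI) (simp add: indeterminate_def)

lemma ideal_gen_vars: "ideal_gen (range quot_var) = (R.irrelevant_ideal :: 'k::field quot_ring set)"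
  unfolding irrelevant_ideal_quot
proof
  show "ideal_gen (range quot_var) \<subseteq> (order_ge 1 :: 'k quot_ring set)"
    unfolding ideal_gen_def using quot_var_order by (intro ideal.span_minimal is_ideal_order_ge) auto
  show "order_ge 1 \<subseteq> (ideal_gen (range quot_var) :: 'k quot_ring set)"
  proof
    fix r :: "'k quot_ring" assume "r \<in> order_ge 1"
    then obtain p where p: "\<forall>m\<in>Poly_Mapping.keys p. 1 \<le> monomial_degree m" "r = quot p"
      by (auto simp: order_ge_def)
    have "quot (Poly_Mapping.single m c) \<in> ideal.span (range quot_var)"
      if m: "1 \<le> monomial_degree m" for m and c :: 'k
    proof -
      obtain u where u: "1 \<le> Poly_Mapping.lookup m u"
        using m by (fastforce simp: monomial_degree_def Suc_le_eq)
      define l where "l = m - Poly_Mapping.single u 1"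
      have "m = l + Poly_Mapping.single u 1"
        using u by (intro poly_mapping_eqI) (auto simp: l_def lookup_add lookup_minus lookup_single when_def)
      then have "quot (Poly_Mapping.single m c) = quot (Poly_Mapping.single l c) * quot_var u"
        by (simp add: quot_var_def indeterminate_def mult_single flip: quot_mult)
      then show ?thesis by (auto intro: ideal.span_scale ideal.span_base)
    qed
    then show "r \<in> ideal_gen (range quot_var)"
      unfolding p(2) ideal_gen_def using p(1)
      by (subst poly_sum) (auto simp: quot_sum intro!: ideal.span_sum)
  qed
qed

lemma not_bad_degree: "monomial_degree m \<le> 2 \<Longrightarrow> \<not> bad m"
  by (simp add: bad_def)

text \<open>The coefficient of a variable is well defined on \<open>R\<close>, since \<open>I\<close> has no terms of degree one. It
  separates this variable from the others and from the elements of order two.\<close>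

lemma quot_var_independent:
  "quot_var v \<notin> R.sc.span (range quot_var - {quot_var v} \<union> (order_ge 2 :: 'k::field quot_ring set))"
proof
  let ?m = "Poly_Mapping.single v 1 :: monomial"
  define H where "H = quot ` {p :: 'k polynomial. Poly_Mapping.lookup p ?m = 0}"
  have "R.sc.subspace H"
  proof (rule R.sc.subspaceI)
    show "0 \<in> H" unfolding H_def by (rule image_eqI[of _ _ 0]) (simp_all add: quot_0)
    show "r + s \<in> H" if "r \<in> H" "s \<in> H" for r s
      using that by (auto simp: H_def lookup_add simp flip: quot_add)
    show "quot_scale c r \<in> H" if "r \<in> H" for c r
    proof -
      obtain p where p: "Poly_Mapping.lookup p ?m = 0" "r = quot p" using \<open>r \<in> H\<close> by (auto simp: H_def)
      then have "Poly_Mapping.lookup (constant_poly c * p) ?m = 0"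
        using keys_constant_mult[of c p] by (auto simp: in_keys_iff)
      then show ?thesis by (simp add: H_def quot_scale_def p flip: quot_mult)
    qed
  qed
  moreover have "range quot_var - {quot_var v} \<subseteq> H"
  proof
    fix r :: "'k quot_ring" assume "r \<in> range quot_var - {quot_var v}"
    then obtain u where u: "r = quot_var u" "quot_var u \<noteq> (quot_var v :: 'k quot_ring)" by auto
    then have "u \<noteq> v" by auto
    then have "Poly_Mapping.lookup (indeterminate u :: 'k polynomial) ?m = 0"
      by (auto simp: indeterminate_def lookup_single when_def dest: arg_cong[of _ _ "\<lambda>m. Poly_Mapping.lookup m v"])
    then show "r \<in> H" by (simp add: u H_def quot_var_def)
  qed
  moreover have "order_ge 2 \<subseteq> H"
  proof
    fix r :: "'k quot_ring" assume "r \<in> order_ge 2"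
    then obtain p where p: "\<forall>m\<in>Poly_Mapping.keys p. 2 \<le> monomial_degree m" "r = quot p"
      by (auto simp: order_ge_def)
    have "?m \<notin> Poly_Mapping.keys p"
    proof
      assume "?m \<in> Poly_Mapping.keys p"
      then have "2 \<le> monomial_degree ?m" using p(1) by blast
      then show False by simp
    qed
    then show "r \<in> H" by (simp add: H_def p(2) in_keys_iff)
  qed
  ultimately have "R.sc.span (range quot_var - {quot_var v} \<union> order_ge 2) \<subseteq> H"
    by (intro R.sc.span_minimal) auto
  moreover assume "quot_var v \<in> R.sc.span (range quot_var - {quot_var v} \<union> (order_ge 2 :: 'k quot_ring set))"
  ultimately obtain p :: "'k polynomial" where p: "quot_var v = quot p" "Poly_Mapping.lookup p ?m = 0"
    by (auto simp: H_def)
  then have "indeterminate v - p \<in> ideal_I" by (simp add: quot_var_def quot_eq_iff)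
  then have "?m \<notin> Poly_Mapping.keys (indeterminate v - p)"
    using not_bad_degree[of ?m] by (auto simp: mem_ideal_I_iff)
  then show False using p(2) by (simp add: in_keys_iff lookup_minus indeterminate_def)
qed

lemma inj_quot_var: "inj (quot_var :: var \<Rightarrow> 'k::field quot_ring)"
proof (rule injI)
  fix u v assume "quot_var u = (quot_var v :: 'k quot_ring)"
  then have "indeterminate u - indeterminate v \<in> (ideal_I :: 'k polynomial set)"
    by (simp add: quot_var_def quot_eq_iff)
  then have "Poly_Mapping.single u 1 \<notin> Poly_Mapping.keys (indeterminate u - indeterminate v :: 'k polynomial)"
    using not_bad_degree[of "Poly_Mapping.single u 1"] by (auto simp: mem_ideal_I_iff)
  then have "(Poly_Mapping.single u 1 :: monomial) = Poly_Mapping.single v 1"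
    by (auto simp: in_keys_iff lookup_minus indeterminate_def lookup_single when_def split: if_splits)
  then show "u = v"
    by (auto dest: arg_cong[of _ _ "\<lambda>m. Poly_Mapping.lookup m u"] simp: lookup_single when_def split: if_splits)
qed

lemma card_generators_quot:
  assumes "finite A" "ideal_gen A = (R.irrelevant_ideal :: 'k::field quot_ring set)"
  shows "4 \<le> card A"
proof -
  have "card (range (quot_var :: var \<Rightarrow> 'k quot_ring)) \<le> card A"
  proof (rule R.card_generators[OF subspace_order_ge[of 2]])
    show "a * b \<in> order_ge 2" if "a \<in> R.irrelevant_ideal" "b \<in> R.irrelevant_ideal" for a b :: "'k quot_ring"
      using order_ge_mult[of a 1 b 1] that by (simp add: irrelevant_ideal_quot numeral_2_eq_2)
    show "range quot_var \<subseteq> (R.irrelevant_ideal :: 'k quot_ring set)"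
      using quot_var_order by (auto simp: irrelevant_ideal_quot)
    show "t \<notin> R.sc.span (range quot_var - {t} \<union> order_ge 2)" if "t \<in> range quot_var" for t :: "'k quot_ring"
      using that quot_var_independent by blast
  qed (use assms in auto)
  moreover have "card (range (quot_var :: var \<Rightarrow> 'k quot_ring)) = card (UNIV :: var set)"
    by (rule card_image[OF inj_quot_var])
  ultimately show ?thesis by (simp add: UNIV_var)
qed

lemma minimal_generators_quot:
  "R.minimal_homogeneous_generators (map quot_var [Var_x, Var_y, Var_z, Var_w] :: 'k::field quot_ring list)"
proof -
  let ?xs = "map quot_var [Var_x, Var_y, Var_z, Var_w] :: 'k quot_ring list"
  have set: "set ?xs = range quot_var" by (simp add: UNIV_var)
  have "distinct ?xs" by (simp add: inj_eq[OF inj_quot_var])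
  moreover have "quot_var v \<in> (quot_grading 1 :: 'k quot_ring set)" for v
    unfolding quot_var_def by (rule quot_gradingI) (simp add: homogeneous_def indeterminate_def)
  then have "set ?xs \<subseteq> (\<Union>i. quot_grading i)" unfolding set by blast
  moreover have "ideal_gen A \<noteq> R.irrelevant_ideal" if "A \<subset> set ?xs" for A
  proof
    assume "ideal_gen A = R.irrelevant_ideal"
    moreover have "finite A" "card A < card (set ?xs)"
      using that by (auto intro: finite_subset psubset_card_mono)
    moreover have "card (set ?xs) \<le> 4" using card_length[of ?xs] by simp
    ultimately show False using card_generators_quot[of A] by simp
  qed
  ultimately show ?thesis
    unfolding R.minimal_homogeneous_generators_def using ideal_gen_vars unfolding set by blast
qed

lemma quot_var_sq:
  assumes "r \<in> order_ge 1" shows "quot_var v * quot_var v * r = (0 :: 'k::field quot_ring)"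
proof -
  obtain p where p: "\<forall>m\<in>Poly_Mapping.keys p. 1 \<le> monomial_degree m" "r = quot p"
    using assms by (auto simp: order_ge_def)
  have "indeterminate v ^ 2 * p \<in> ideal_I"
    unfolding mem_ideal_I_iff
  proof
    fix m assume "m \<in> Poly_Mapping.keys (indeterminate v ^ 2 * p)"
    then obtain l where "m = Poly_Mapping.single v 2 + l" "l \<in> Poly_Mapping.keys p"
      using keys_mult[of "indeterminate v ^ 2" p] unfolding indeterminate_sq by auto
    then show "bad m" using p(1)
      by (auto simp: bad_def monomial_degree_add lookup_add intro!: exI[of _ v])
  qed
  then show ?thesis by (simp add: p(2) quot_var_def quot_eq_0_iff power2_eq_square flip: quot_mult)
qed

lemma quot_var_prod: "quot_var Var_x * quot_var Var_y * quot_var Var_z * quot_var Var_w \<noteq> (0 :: 'k::field quot_ring)"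
proof
  define m :: monomial where "m = Poly_Mapping.single Var_x 1 + Poly_Mapping.single Var_y 1 +
    Poly_Mapping.single Var_z 1 + Poly_Mapping.single Var_w 1"
  assume "quot_var Var_x * quot_var Var_y * quot_var Var_z * quot_var Var_w = (0 :: 'k quot_ring)"
  then have "Poly_Mapping.single m (1 :: 'k) \<in> ideal_I"
    by (simp add: quot_var_def quot_eq_0_iff indeterminate_def mult_single m_def flip: quot_mult)
  then have "bad m" by (simp add: mem_ideal_I_iff)
  then obtain v where "2 \<le> Poly_Mapping.lookup m v" by (auto simp: bad_def)
  then show False by (cases v) (simp_all add: m_def lookup_add lookup_single when_def)
qed

lemma ideal_I_generators:
  "(ideal_I :: 'k::field polynomial set) = ideal_gen {indeterminate u * indeterminate v ^ 2 | u v. True}"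
proof
  let ?A = "{indeterminate u * indeterminate v ^ 2 | u v. True} :: 'k polynomial set"
  show "ideal_gen ?A \<subseteq> ideal_I"
    unfolding ideal_gen_def
  proof (rule ideal.span_minimal)
    show "?A \<subseteq> ideal_I"
      unfolding ideal_I_def ideal_prod_def ideal_gen_def
      using indeterminate_m indeterminate_J by (auto intro!: ideal.span_base)
  qed (use is_ideal_I in \<open>simp add: is_ideal_def\<close>)
  have "{a * b | a b. a \<in> ideal_m \<and> b \<in> ideal_J} \<subseteq> ideal_gen ?A"
  proof clarify
    fix a b :: "'k polynomial" assume a: "a \<in> ideal_m" and b: "b \<in> ideal_J"
    have *: "indeterminate u * b \<in> ideal.span ?A" for u
      using b unfolding ideal_J_def ideal_gen_def
    proof (induction b rule: ideal.span_induct_alt)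
      case (step c x y)
      then have "indeterminate u * x \<in> ideal.span ?A" by (intro ideal.span_base) auto
      then have "c * (indeterminate u * x) + indeterminate u * y \<in> ideal.span ?A"
        using step.IH by (rule ideal.span_add[OF ideal.span_scale])
      then show ?case by (simp add: algebra_simps)
    qed (simp add: ideal.span_zero)
    show "a * b \<in> ideal_gen ?A"
      using a unfolding ideal_m_def ideal_gen_def
    proof (induction a rule: ideal.span_induct_alt)
      case (step c x y)
      then have "x * b \<in> ideal.span ?A" using * by auto
      then have "c * (x * b) + y * b \<in> ideal.span ?A"
        using step.IH by (rule ideal.span_add[OF ideal.span_scale])
      then show ?case by (simp add: algebra_simps)
    qed (simp add: ideal.span_zero)
  qed
  then show "ideal_I \<subseteq> ideal_gen ?A"
    unfolding ideal_I_def ideal_prod_def ideal_gen_def by (intro ideal.span_minimal ideal.subspace_span)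
qed

theorem mainTheorem1:
  shows "(ideal_I :: 'k::field polynomial set) = ideal_gen
      {pX^3, pX^2 * pY, pX^2 * pZ, pX^2 * pW,
       pX * pY^2, pY^3, pY^2 * pZ, pY^2 * pW,
       pX * pZ^2, pY * pZ^2, pZ^3, pZ^2 * pW,
       pX * pW^2, pY * pW^2, pZ * pW^2, pW^3} \<and>
    \<not> pos_graded_algebra.golod
        (quot_scale :: 'k \<Rightarrow> 'k quot_ring \<Rightarrow> 'k quot_ring) quot_grading"
proof
  have "{indeterminate u * indeterminate v ^ 2 | u v. True} = (\<lambda>(u, v). indeterminate u * indeterminate v ^ 2 :: 'k polynomial) ` (UNIV \<times> UNIV)"
    by auto
  also have "\<dots> = {pX^3, pX^2 * pY, pX^2 * pZ, pX^2 * pW,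
       pX * pY^2, pY^3, pY^2 * pZ, pY^2 * pW,
       pX * pZ^2, pY * pZ^2, pZ^3, pZ^2 * pW,
       pX * pW^2, pY * pW^2, pZ * pW^2, pW^3}"
    unfolding UNIV_var by (simp add: power3_eq_cube power2_eq_square mult_ac) blast
  finally show "(ideal_I :: 'k polynomial set) = ideal_gen
      {pX^3, pX^2 * pY, pX^2 * pZ, pX^2 * pW,
       pX * pY^2, pY^3, pY^2 * pZ, pY^2 * pW,
       pX * pZ^2, pY * pZ^2, pZ^3, pZ^2 * pW,
       pX * pW^2, pY * pW^2, pZ * pW^2, pW^3}"
    unfolding ideal_I_generators by simp
  have vars: "{quot_var Var_x, quot_var Var_y, quot_var Var_z, quot_var Var_w} = (range quot_var :: 'k quot_ring set)"
    by (simp add: UNIV_var)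
  show "\<not> pos_graded_algebra.golod (quot_scale :: 'k \<Rightarrow> 'k quot_ring \<Rightarrow> 'k quot_ring) quot_grading"
  proof (rule R.not_golod)
    show "ideal_gen {quot_var Var_x, quot_var Var_y, quot_var Var_z, quot_var Var_w :: 'k quot_ring} = R.irrelevant_ideal"
      unfolding vars by (rule ideal_gen_vars)
    show "\<exists>xs :: 'k quot_ring list. R.minimal_homogeneous_generators xs"
      using minimal_generators_quot by blast
    show "v * v * r = 0" if "v \<in> {quot_var Var_x, quot_var Var_y, quot_var Var_z, quot_var Var_w}"
      "r \<in> R.irrelevant_ideal" for v r :: "'k quot_ring"
      using that quot_var_sq[of r] unfolding irrelevant_ideal_quot by auto
  qed (rule card_generators_quot quot_var_prod; assumption)+
qed

end
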